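(* Let $L$ be a link (given by a diagram) and $p,p',q,q'$ points on $L$ (not at crossings) so that $p,p'$ lie on the same component of $L$ and $q,q'$ lie on the same component of $L$. (1) Write $\mathcal{C}_{Kh}(L)_{p,q}$ (respectively $\mathcal{C}_{Kh}(L)_{p',q'}$) for the Khovanov complex $\mathcal{C}_{Kh}(L)$ viewed as a module over $\mathbb{F}_2[W,X]/(W^2,X^2)$ via the basepoints $p,q$ (respectively $p',q'$). Then $\mathcal{C}_{Kh}(L)_{p,q}$ is quasi-isomorphic to $\mathcal{C}_{Kh}(L)_{p',q'}$. (2) Write $\widetilde{\mathcal{C}}_{Kh}(L)_{p,q}$ (respectively $\widetilde{\mathcal{C}}_{Kh}(L)_{p',q'}$) for the reduced Khovanov complex, reduced at $p$ (respectively $p'$), and viewed as a module over $\mathbb{F}_2[X]/(X^2)$ via the basepoint $q$ (respectively $q'$). Then $\widetilde{\mathcal{C}}_{Kh}(L)_{p,q}$ is quasi-isomorphic to $\widetilde{\mathcal{C}}_{Kh}(L)_{p',q'}$.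
   Context: A generator of the Khovanov complex $\mathcal{C}_{Kh}(L)$ (over $\mathbb{F}_2$) of a link diagram is a complete resolution together with a labeling of each circle of the resolution by $1$ or $X$; the differential is the usual Khovanov differential (from the Frobenius algebra $\mathbb{F}_2[X]/(X^2)$ with $\Delta(1)=1\otimes X+X\otimes 1$, $\Delta(X)=X\otimes X$). A basepoint $q$ gives an action of $\mathbb{F}_2[X]/(X^2)$ by chain maps: multiplication by $X$ sends a generator to zero if it labels the circle containing $q$ by $X$, and changes the label of the circle containing $q$ to $X$ if that label is $1$. A basepoint $p$ likewise gives an action of $\mathbb{F}_2[W]/(W^2)$; the two actions commute, making $\mathcal{C}_{Kh}(L)$ a differential module over $\mathbb{F}_2[W,X]/(W^2,X^2)$. The reduced Khovanov complex at $p$ is (up to a grading shift) the subcomplex of $\mathcal{C}_{Kh}(L)$ where the circle containing $p$ is labeled $X$ or, equivalently, the quotient complex where the circle containing $p$ is labeled $1$; a second basepoint $q$ makes it a differential module over $\mathbb{F}_2[X]/(X^2)$. Quasi-isomorphic means connected by a zig-zag of quasi-isomorphisms of differential modules over the indicated ring (equivalently, $A_\infty$ quasi-isomorphic). *)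

theory Defs
  imports
    "HOL-Algebra.Algebraic_Closure_Type"
    "HOL-Algebra.Module"
    "HOL-Algebra.QuotRing"
    "HOL-Library.Z2"
    "HOL-Computational_Algebra.Polynomial"
begin

section \<open>Differential modules and quasi-isomorphism\<close>

record ('a, 'b) dmodule = "('a, 'b) module" +
  bdry :: "'b \<Rightarrow> 'b"

definition module_hom ::
    "('r, 'm) ring_scheme \<Rightarrow> ('r, 'a, 'k) module_scheme \<Rightarrow> ('r, 'b, 'l) module_scheme \<Rightarrow> ('a \<Rightarrow> 'b) set"
  where "module_hom R M N =
    {f \<in> hom (add_monoid M) (add_monoid N).
       \<forall>r\<in>carrier R. \<forall>x\<in>carrier M. f (r \<odot>\<^bsub>M\<^esub> x) = r \<odot>\<^bsub>N\<^esub> f x}"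

text \<open>Differential modules carry no grading.\<close>

definition diff_module :: "'r ring \<Rightarrow> ('r, 'a) dmodule \<Rightarrow> bool"
  where "diff_module R M \<longleftrightarrow>
    Module.module R M \<and> bdry M \<in> module_hom R M M \<and>
    (\<forall>x\<in>carrier M. bdry M (bdry M x) = \<zero>\<^bsub>M\<^esub>)"

definition cycles :: "('r, 'a) dmodule \<Rightarrow> 'a set"
  where "cycles M = {x \<in> carrier M. bdry M x = \<zero>\<^bsub>M\<^esub>}"

definition boundaries :: "('r, 'a) dmodule \<Rightarrow> 'a set"
  where "boundaries M = bdry M ` carrier M"

definition homology :: "('r, 'a) dmodule \<Rightarrow> 'a set monoid"
  where "homology M = (add_monoid M)\<lparr>carrier := cycles M\<rparr> Mod boundaries M"

definition homology_map :: "('r, 'b) dmodule \<Rightarrow> ('a \<Rightarrow> 'b) \<Rightarrow> 'a set \<Rightarrow> 'b set"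
  where "homology_map N f C = (\<Union>x\<in>C. boundaries N +>\<^bsub>N\<^esub> f x)"

definition quasi_iso :: "'r ring \<Rightarrow> ('a \<Rightarrow> 'b) \<Rightarrow> ('r, 'a) dmodule \<Rightarrow> ('r, 'b) dmodule \<Rightarrow> bool"
  where "quasi_iso R f M N \<longleftrightarrow>
    f \<in> module_hom R M N \<and>
    (\<forall>x\<in>carrier M. f (bdry M x) = bdry N (f x)) \<and>
    homology_map N f \<in> iso (homology M) (homology N)"

text \<open>
  Zig-zags of quasi-isomorphisms of arbitrary length. The intermediate differential modules have
  arbitrary carriers inside the type \<open>'a\<close>. Below, \<open>'a\<close> is the type of all
  functions from the infinite type of potential Khovanov generators to \<open>bit\<close>, so it has room
  for an isomorphic copy of every module that is countable, or of the cardinality of the continuum.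
  Resolutions of the finite modules considered here are countable, so this is no restriction.
\<close>

definition quasi_isomorphic :: "'r ring \<Rightarrow> ('r, 'a) dmodule \<Rightarrow> ('r, 'a) dmodule \<Rightarrow> bool"
  where "quasi_isomorphic R M N \<longleftrightarrow>
    diff_module R M \<and> diff_module R N \<and>
    equivclp (\<lambda>A B. diff_module R A \<and> diff_module R B \<and> (\<exists>f. quasi_iso R f A B)) M N"


section \<open>The ground rings\<close>

text \<open>\<open>bit\<close> is the field with two elements.\<close>

definition F2X_ideal :: "bit poly set"
  where "F2X_ideal = genideal ring_of_type_algebra {[:0, 0, 1:]}"

definition F2X :: "bit poly set ring"
  where "F2X = ring_of_type_algebra Quot F2X_ideal"

text \<open>In \<open>bit poly poly\<close> the outer variable is $X$ and the inner (coefficient)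
  variable is $W$, so \<open>[:[:0, 0, 1:]:]\<close> is $W^2$ and \<open>[:0, 0, 1:]\<close> is $X^2$.\<close>

definition F2WX_ideal :: "bit poly poly set"
  where "F2WX_ideal = genideal ring_of_type_algebra {[:[:0, 0, 1:]:], [:0, 0, 1:]}"

definition F2WX :: "bit poly poly set ring"
  where "F2WX = ring_of_type_algebra Quot F2WX_ideal"

definition poly_act :: "(('g \<Rightarrow> bit) \<Rightarrow> 'g \<Rightarrow> bit) \<Rightarrow> bit poly \<Rightarrow> ('g \<Rightarrow> bit) \<Rightarrow> 'g \<Rightarrow> bit"
  where "poly_act x f c = (\<lambda>g. \<Sum>i\<le>Polynomial.degree f. Polynomial.coeff f i * (x ^^ i) c g)"

definition poly2_act ::
    "(('g \<Rightarrow> bit) \<Rightarrow> 'g \<Rightarrow> bit) \<Rightarrow> (('g \<Rightarrow> bit) \<Rightarrow> 'g \<Rightarrow> bit) \<Rightarrow>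
     bit poly poly \<Rightarrow> ('g \<Rightarrow> bit) \<Rightarrow> 'g \<Rightarrow> bit"
  where "poly2_act w x f c =
    (\<lambda>g. \<Sum>i\<le>Polynomial.degree f. poly_act w (Polynomial.coeff f i) ((x ^^ i) c) g)"

text \<open>
  An element of the quotient ring is a coset, and it acts through any of its representatives.
  The choice is immaterial when the operators commute and square to zero.
\<close>

definition F2X_smult :: "(('g \<Rightarrow> bit) \<Rightarrow> 'g \<Rightarrow> bit) \<Rightarrow> bit poly set \<Rightarrow> ('g \<Rightarrow> bit) \<Rightarrow> 'g \<Rightarrow> bit"
  where "F2X_smult x r = poly_act x (SOME f. f \<in> r)"

definition F2WX_smult ::
    "(('g \<Rightarrow> bit) \<Rightarrow> 'g \<Rightarrow> bit) \<Rightarrow> (('g \<Rightarrow> bit) \<Rightarrow> 'g \<Rightarrow> bit) \<Rightarrow>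
     bit poly poly set \<Rightarrow> ('g \<Rightarrow> bit) \<Rightarrow> 'g \<Rightarrow> bit"
  where "F2WX_smult w x r = poly2_act w x (SOME f. f \<in> r)"


section \<open>Link diagrams\<close>

text \<open>
  Planar diagram codes. A crossing \<open>[a, b, c, d]\<close> lists the labels of the four arcs meeting there
  in counterclockwise order, \<open>a\<close> and \<open>c\<close> being the two ends of the under-strand. Labels in
  \<open>loops\<close> stand for components without crossings. A point of the link away from
  the crossings is recorded by the arc on which it lies.
\<close>

record pd_code =
  crossings :: "nat list list"
  loops :: "nat set"

definition eq_closure :: "('a \<times> 'a) set \<Rightarrow> ('a \<times> 'a) set"
  where "eq_closure r = (r \<union> r\<inverse>)\<^sup>*"

definition arc_ends :: "pd_code \<Rightarrow> (nat \<times> nat) set"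
  where "arc_ends D = {..<length (crossings D)} \<times> {..<4}"

definition arc_at :: "pd_code \<Rightarrow> nat \<times> nat \<Rightarrow> nat"
  where "arc_at D = (\<lambda>(c, k). crossings D ! c ! k)"

definition arcs :: "pd_code \<Rightarrow> nat set"
  where "arcs D = arc_at D ` arc_ends D \<union> loops D"

text \<open>
  Follow an arc from the end \<open>e\<close> to its other end, then turn to the next end of that crossing.
  The orbits are the boundary walks of the faces of the surface that the code determines.
\<close>

definition face_step :: "pd_code \<Rightarrow> ((nat \<times> nat) \<times> (nat \<times> nat)) set"
  where "face_step D = {(e, (c, (k + 1) mod 4)) | e c k.
    e \<in> arc_ends D \<and> (c, k) \<in> arc_ends D \<and> e \<noteq> (c, k) \<and> arc_at D e = arc_at D (c, k)}"

definition adjacent_crossings :: "pd_code \<Rightarrow> (nat \<times> nat) set"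
  where "adjacent_crossings D = {(c, c') | c c'. \<exists>k k'.
    (c, k) \<in> arc_ends D \<and> (c', k') \<in> arc_ends D \<and> arc_at D (c, k) = arc_at D (c', k')}"

text \<open>
  Every connected piece of the 4-valent graph has genus 0: with $V = n$ crossings, $E = 2n$ arcs,
  $F$ faces and $c$ pieces, $V - E + F \le 2c$ holds always, with equality iff all pieces are planar.
\<close>

definition planar_code :: "pd_code \<Rightarrow> bool"
  where "planar_code D \<longleftrightarrow>
    card (arc_ends D // eq_closure (face_step D)) =
    length (crossings D) +
    2 * card ({..<length (crossings D)} // eq_closure (adjacent_crossings D))"

definition link_diagram :: "pd_code \<Rightarrow> bool"
  where "link_diagram D \<longleftrightarrow>
    (\<forall>x\<in>set (crossings D). length x = 4) \<and>
    (\<forall>a\<in>arc_at D ` arc_ends D. card {e \<in> arc_ends D. arc_at D e = a} = 2) \<and>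
    finite (loops D) \<and> loops D \<inter> arc_at D ` arc_ends D = {} \<and>
    planar_code D"

text \<open>A strand runs straight through a crossing, from position \<open>k\<close> to position \<open>k + 2\<close>.\<close>

definition strand_step :: "pd_code \<Rightarrow> (nat \<times> nat) set"
  where "strand_step D =
    {(arc_at D (c, k), arc_at D (c, (k + 2) mod 4)) | c k. (c, k) \<in> arc_ends D}"

definition same_component :: "pd_code \<Rightarrow> nat \<Rightarrow> nat \<Rightarrow> bool"
  where "same_component D p q \<longleftrightarrow>
    p \<in> arcs D \<and> q \<in> arcs D \<and> (p, q) \<in> eq_closure (strand_step D)"


section \<open>The Khovanov complex\<close>

text \<open>
  A complete resolution is the set \<open>v\<close> of crossings that are 1-resolved. At \<open>[a, b, c, d]\<close> the
  0-resolution joins \<open>a\<close> to \<open>b\<close> and \<open>c\<close> to \<open>d\<close> (it merges the two regions swept out when the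
  over-strand is rotated counterclockwise); the 1-resolution joins \<open>a\<close> to \<open>d\<close> and \<open>b\<close> to \<open>c\<close>.
  A circle is represented by the set of arcs it contains.
\<close>

definition glue :: "pd_code \<Rightarrow> nat set \<Rightarrow> (nat \<times> nat) set"
  where "glue D v = (\<Union>c\<in>{..<length (crossings D)}.
    if c \<notin> v
    then {(arc_at D (c, 0), arc_at D (c, 1)), (arc_at D (c, 2), arc_at D (c, 3))}
    else {(arc_at D (c, 0), arc_at D (c, 3)), (arc_at D (c, 1), arc_at D (c, 2))})"

definition circles :: "pd_code \<Rightarrow> nat set \<Rightarrow> nat set set"
  where "circles D v = arcs D // eq_closure (glue D v)"

definition circle_at :: "pd_code \<Rightarrow> nat set \<Rightarrow> nat \<Rightarrow> nat set"
  where "circle_at D v p = eq_closure (glue D v) `` {p}"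

text \<open>A generator is a resolution together with the set of circles labeled $X$; the others are labeled 1.\<close>

type_synonym generator = "nat set \<times> nat set set"
type_synonym chain = "generator \<Rightarrow> bit"

definition generators :: "pd_code \<Rightarrow> generator set"
  where "generators D = {(v, S). v \<subseteq> {..<length (crossings D)} \<and> S \<subseteq> circles D v}"

definition chains_on :: "generator set \<Rightarrow> chain set"
  where "chains_on G = {c. \<forall>g. g \<notin> G \<longrightarrow> c g = 0}"

text \<open>The linear map sending the generator \<open>g\<close> to the sum of all generators \<open>h\<close> with \<open>T g h\<close>.\<close>

definition linear_ext :: "generator set \<Rightarrow> (generator \<Rightarrow> generator \<Rightarrow> bool) \<Rightarrow> chain \<Rightarrow> chain"
  where "linear_ext G T c = (\<lambda>h. \<Sum>g\<in>G. if h \<in> G \<and> T g h then c g else 0)"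

text \<open>
  Merging circles \<open>A\<close>, \<open>B\<close> into \<open>C\<close>: $1 \otimes 1 \mapsto 1$, $1 \otimes X, X \otimes 1 \mapsto X$,
  $X \otimes X \mapsto 0$. Splitting \<open>C\<close> into \<open>A\<close>, \<open>B\<close>: $1 \mapsto 1 \otimes X + X \otimes 1$,
  $X \mapsto X \otimes X$. Here \<open>S\<close> and \<open>S'\<close> are the sets of $X$-labeled circles before and after.
  Planarity ensures that changing one crossing always merges two circles or splits one.
\<close>

definition merge_term :: "nat set set \<Rightarrow> nat set set \<Rightarrow> nat set \<Rightarrow> nat set \<Rightarrow> nat set \<Rightarrow> bool"
  where "merge_term S S' A B C \<longleftrightarrow> \<not> (A \<in> S \<and> B \<in> S) \<and> (C \<in> S' \<longleftrightarrow> A \<in> S \<or> B \<in> S)"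

definition split_term :: "nat set set \<Rightarrow> nat set set \<Rightarrow> nat set \<Rightarrow> nat set \<Rightarrow> nat set \<Rightarrow> bool"
  where "split_term S S' C A B \<longleftrightarrow>
    (if C \<in> S then A \<in> S' \<and> B \<in> S' else (A \<in> S') \<noteq> (B \<in> S'))"

definition khovanov_term :: "pd_code \<Rightarrow> generator \<Rightarrow> generator \<Rightarrow> bool"
  where "khovanov_term D = (\<lambda>(v, S) (v', S').
    (\<exists>c < length (crossings D). c \<notin> v \<and> v' = insert c v) \<and>
    (\<forall>Z \<in> circles D v \<inter> circles D v'. Z \<in> S \<longleftrightarrow> Z \<in> S') \<and>
    ((\<exists>A B C. A \<noteq> B \<and> circles D v - circles D v' = {A, B} \<and> circles D v' - circles D v = {C} \<and>
        merge_term S S' A B C) \<or>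
     (\<exists>A B C. A \<noteq> B \<and> circles D v - circles D v' = {C} \<and> circles D v' - circles D v = {A, B} \<and>
        split_term S S' C A B)))"

definition khovanov_diff :: "pd_code \<Rightarrow> chain \<Rightarrow> chain"
  where "khovanov_diff D = linear_ext (generators D) (khovanov_term D)"

definition dot_term :: "pd_code \<Rightarrow> nat \<Rightarrow> generator \<Rightarrow> generator \<Rightarrow> bool"
  where "dot_term D q = (\<lambda>(v, S) (v', S').
    v' = v \<and> circle_at D v q \<notin> S \<and> S' = insert (circle_at D v q) S)"

definition basepoint_act :: "pd_code \<Rightarrow> nat \<Rightarrow> chain \<Rightarrow> chain"
  where "basepoint_act D q = linear_ext (generators D) (dot_term D q)"

text \<open>The ring fields \<open>mult\<close> and \<open>one\<close> of the record play no role for modules.\<close>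

definition CKh :: "pd_code \<Rightarrow> nat \<Rightarrow> nat \<Rightarrow> (bit poly poly set, chain) dmodule"
  where "CKh D p q =
    \<lparr>carrier = chains_on (generators D),
     monoid.mult = undefined, one = undefined,
     zero = (\<lambda>_. 0), add = (\<lambda>x y g. x g + y g),
     module.smult = F2WX_smult (basepoint_act D p) (basepoint_act D q),
     bdry = khovanov_diff D\<rparr>"

text \<open>The reduced complex is the subcomplex on which the circle through \<open>p\<close> is labeled $X$.\<close>

definition reduced_generators :: "pd_code \<Rightarrow> nat \<Rightarrow> generator set"
  where "reduced_generators D p = {(v, S) \<in> generators D. circle_at D v p \<in> S}"

definition reduced_CKh :: "pd_code \<Rightarrow> nat \<Rightarrow> nat \<Rightarrow> (bit poly set, chain) dmodule"
  where "reduced_CKh D p q =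
    \<lparr>carrier = chains_on (reduced_generators D p),
     monoid.mult = undefined, one = undefined,
     zero = (\<lambda>_. 0), add = (\<lambda>x y g. x g + y g),
     module.smult = F2X_smult (basepoint_act D q),
     bdry = khovanov_diff D\<rparr>"

end

theory Submission
  imports Defs "HOL-Library.Function_Algebras"
begin

text \<open>
  It suffices to move a basepoint through one crossing, from $a$ to $b$. Let $H$ be the edge map of the cube
  at that crossing, taken backwards. Then $X_b = X_a + dH + Hd$, $H^2 = 0$, $H$ commutes with every basepoint
  action, and $H X_a = X_b H$ because $a$ and $b$ are on the same circle on one of the two ends of each edge.
  These identities make $(1, H)$ an $A_\infty$ isomorphism between the two module structures.
  It is realized by a zig-zag through a three-term quotient of the bar resolution. For the reduced
  complexes, which are the kernels of $X_a$ and $X_b$, the zig-zag runs through the Koszul complexes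
  $(C[t], d + tX_a)$ and $(C[t], d + tX_b)$, which are isomorphic through $1 + tH$.

  That $d^2 = 0$ and $dH + Hd$ has no further terms are both instances of the commutation of the faces of
  the cube with arbitrary orientations of the edges. This rests on the fact that the two strands of a crossing
  lie on the same circle in at least one of its two resolutions, which is a parity argument.
\<close>

text \<open>On a single edge the homotopy comes from the Frobenius algebra: a merge followed by the
  reverse split is multiplication by X_a + X_b, and a split followed by the reverse merge is
  multiplication by 2X = 0, which again equals X_a + X_b because a and b then lie on one circle. The
  relation H X_a = X_b H is what lets the A-infinity map stop at H without higher terms. Two
  obstacles shape the rest. Checking faces circle by circle leads to many configurations; embedding
  all chains in one exterior algebra on the arcs turns every edge map into multiplication by X_a +
  X_b, plus the identity for a split, so that a face depends only on which crossings are separated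
  and on the numbers of circles. All intermediate modules must again consist of functions on
  generators, so triples and polynomials in t are encoded as chains.\<close>

declare add_bit_eq_xor [simp del] mult_bit_eq_and [simp del]

section \<open>Differential modules of functions into the field with two elements\<close>

lemma fun_bit_add_self [simp]: "x + x = 0" for x :: "'g \<Rightarrow> bit"
  by (rule ext) (simp add: add_bit_eq_xor)

lemma fun_bit_add_left_self [simp]: "x + (x + y) = y" for x :: "'g \<Rightarrow> bit"
  by (simp flip: add.assoc)

lemma fun_bit_uminus [simp]: "- x = x" for x :: "'g \<Rightarrow> bit"
  by (metis add_eq_0_iff fun_bit_add_self)

lemma bit_add_eq_0_iff: "a + b = 0 \<longleftrightarrow> a = b" for a b :: bit
  by (cases a; cases b) simp_all

lemma fun_bit_add_eq_0_iff: "x + y = 0 \<longleftrightarrow> x = y" for x :: "'g \<Rightarrow> bit"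
  by (metis add_eq_0_iff fun_bit_uminus)

definition subspace_F2 :: "('g \<Rightarrow> bit) set \<Rightarrow> bool"
  where "subspace_F2 V \<longleftrightarrow> 0 \<in> V \<and> (\<forall>x\<in>V. \<forall>y\<in>V. x + y \<in> V)"

text \<open>Additivity is linearity here, since the only scalars are 0 and 1. Nothing is required
  outside \<open>V\<close>.\<close>

definition linear_map :: "('g \<Rightarrow> bit) set \<Rightarrow> ('h \<Rightarrow> bit) set \<Rightarrow> (('g \<Rightarrow> bit) \<Rightarrow> 'h \<Rightarrow> bit) \<Rightarrow> bool"
  where "linear_map V W f \<longleftrightarrow> (\<forall>x\<in>V. f x \<in> W) \<and> (\<forall>x\<in>V. \<forall>y\<in>V. f (x + y) = f x + f y)"

lemma subspace_F2_0: "subspace_F2 V \<Longrightarrow> 0 \<in> V"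
  and subspace_F2_add: "subspace_F2 V \<Longrightarrow> x \<in> V \<Longrightarrow> y \<in> V \<Longrightarrow> x + y \<in> V"
  by (auto simp: subspace_F2_def)

lemma linear_map_in: "linear_map V W f \<Longrightarrow> x \<in> V \<Longrightarrow> f x \<in> W"
  and linear_map_add: "linear_map V W f \<Longrightarrow> x \<in> V \<Longrightarrow> y \<in> V \<Longrightarrow> f (x + y) = f x + f y"
  by (auto simp: linear_map_def)

lemma linear_map_0: "subspace_F2 V \<Longrightarrow> linear_map V W f \<Longrightarrow> f 0 = 0"
  by (metis fun_bit_add_self linear_map_add subspace_F2_0)

definition chain_complex :: "('g \<Rightarrow> bit) set \<Rightarrow> (('g \<Rightarrow> bit) \<Rightarrow> 'g \<Rightarrow> bit) \<Rightarrow> bool"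
  where "chain_complex V d \<longleftrightarrow> subspace_F2 V \<and> linear_map V V d \<and> (\<forall>y\<in>V. d (d y) = 0)"

definition square_zero_action ::
    "('g \<Rightarrow> bit) set \<Rightarrow> (('g \<Rightarrow> bit) \<Rightarrow> 'g \<Rightarrow> bit) \<Rightarrow> (('g \<Rightarrow> bit) \<Rightarrow> 'g \<Rightarrow> bit) \<Rightarrow> bool"
  where "square_zero_action V d x \<longleftrightarrow>
    linear_map V V x \<and> (\<forall>y\<in>V. x (x y) = 0 \<and> x (d y) = d (x y))"

text \<open>The third and fourth clauses are surjectivity and injectivity on homology, phrased with
  representatives so that the zig-zags can be built without mentioning cosets.\<close>

definition quasi_iso_map ::
    "('g \<Rightarrow> bit) set \<Rightarrow> (('g \<Rightarrow> bit) \<Rightarrow> 'g \<Rightarrow> bit) \<Rightarrow>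
     ('h \<Rightarrow> bit) set \<Rightarrow> (('h \<Rightarrow> bit) \<Rightarrow> 'h \<Rightarrow> bit) \<Rightarrow> (('g \<Rightarrow> bit) \<Rightarrow> 'h \<Rightarrow> bit) \<Rightarrow> bool"
  where "quasi_iso_map V d V' d' f \<longleftrightarrow>
    linear_map V V' f \<and> (\<forall>y\<in>V. f (d y) = d' (f y)) \<and>
    (\<forall>z\<in>V'. d' z = 0 \<longrightarrow> (\<exists>y\<in>V. d y = 0 \<and> (\<exists>b\<in>V'. z = f y + d' b))) \<and>
    (\<forall>y\<in>V. \<forall>b\<in>V'. d y = 0 \<and> f y = d' b \<longrightarrow> (\<exists>a\<in>V. y = d a))"

text \<open>Common shape of both Khovanov complexes: the fields that are not parameters have the
  same values as in \<open>CKh\<close> and \<open>reduced_CKh\<close>, which makes these instances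
  by unfolding.\<close>

definition dmod ::
    "('g \<Rightarrow> bit) set \<Rightarrow> ('r \<Rightarrow> ('g \<Rightarrow> bit) \<Rightarrow> 'g \<Rightarrow> bit) \<Rightarrow> (('g \<Rightarrow> bit) \<Rightarrow> 'g \<Rightarrow> bit) \<Rightarrow>
     ('r, 'g \<Rightarrow> bit) dmodule"
  where "dmod V sm d =
    \<lparr>carrier = V, monoid.mult = undefined, one = undefined, zero = (\<lambda>_. 0),
     add = (\<lambda>x y g. x g + y g), module.smult = sm, bdry = d\<rparr>"

lemma dmod_simps [simp]:
  "carrier (dmod V sm d) = V" "zero (dmod V sm d) = 0" "add (dmod V sm d) = (+)"
  "module.smult (dmod V sm d) = sm" "bdry (dmod V sm d) = d"
  by (auto simp: dmod_def plus_fun_def zero_fun_def fun_eq_iff)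

lemma abelian_group_dmod:
  assumes "subspace_F2 V"
  shows "abelian_group (dmod V sm d)"
proof (rule abelian_groupI)
  fix x assume "x \<in> carrier (dmod V sm d)"
  then show "\<exists>y\<in>carrier (dmod V sm d). y \<oplus>\<^bsub>dmod V sm d\<^esub> x = \<zero>\<^bsub>dmod V sm d\<^esub>"
    by (intro bexI[of _ x]) simp_all
qed (use assms in \<open>auto simp: subspace_F2_def ac_simps\<close>)

lemma module_hom_dmod_iff:
  "f \<in> module_hom R (dmod V sm d) (dmod V' sm' d') \<longleftrightarrow>
   linear_map V V' f \<and> (\<forall>r\<in>carrier R. \<forall>y\<in>V. f (sm r y) = sm' r (f y))"
  by (auto simp: module_hom_def hom_def linear_map_def)

definition homology_class :: "('g \<Rightarrow> bit) set \<Rightarrow> (('g \<Rightarrow> bit) \<Rightarrow> 'g \<Rightarrow> bit) \<Rightarrow> ('g \<Rightarrow> bit) \<Rightarrow> ('g \<Rightarrow> bit) set"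
  where "homology_class V d z = (\<lambda>y. d y + z) ` V"

lemma carrier_homology_dmod:
  "carrier (homology (dmod V sm d)) = homology_class V d ` {z \<in> V. d z = 0}"
  by (auto simp: homology_def FactGroup_def RCOSETS_def r_coset_def cycles_def boundaries_def
      homology_class_def)

lemma homology_class_eq_iff:
  assumes "chain_complex V d" "z \<in> V" "z' \<in> V"
  shows "homology_class V d z = homology_class V d z' \<longleftrightarrow> (\<exists>b\<in>V. z = z' + d b)"
proof -
  have V: "subspace_F2 V" and d: "linear_map V V d"
    using assms(1) by (auto simp: chain_complex_def)
  have sub: "homology_class V d u \<subseteq> homology_class V d u'" if "b \<in> V" "u = u' + d b" for u u' b
  proof
    fix t assume "t \<in> homology_class V d u"
    then obtain y where "y \<in> V" "t = d y + u" by (auto simp: homology_class_def)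
    with that show "t \<in> homology_class V d u'"
      unfolding homology_class_def
      by (intro image_eqI[of _ _ "y + b"])
        (auto simp: linear_map_add[OF d] ac_simps subspace_F2_add[OF V])
  qed
  show ?thesis
  proof
    assume eq: "homology_class V d z = homology_class V d z'"
    have "z \<in> homology_class V d z"
      unfolding homology_class_def
      by (intro image_eqI[of _ _ 0]) (auto simp: linear_map_0[OF V d] subspace_F2_0[OF V])
    with eq show "\<exists>b\<in>V. z = z' + d b" by (auto simp: homology_class_def ac_simps)
  next
    assume "\<exists>b\<in>V. z = z' + d b"
    then obtain b where b: "b \<in> V" "z = z' + d b" by blast
    then have "z' = z + d b" by (simp add: ac_simps)
    with b sub show "homology_class V d z = homology_class V d z'" by blast
  qed
qed

lemma mult_homology_dmod:
  assumes "chain_complex V d" "z \<in> V" "z' \<in> V"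
  shows "homology_class V d z \<otimes>\<^bsub>homology (dmod V sm d)\<^esub> homology_class V d z' =
    homology_class V d (z + z')"
proof -
  have V: "subspace_F2 V" and d: "linear_map V V d"
    using assms(1) by (auto simp: chain_complex_def)
  have "homology_class V d z \<otimes>\<^bsub>homology (dmod V sm d)\<^esub> homology_class V d z' =
      {a + b | a b. a \<in> homology_class V d z \<and> b \<in> homology_class V d z'}"
    by (auto simp: homology_def FactGroup_def set_mult_def)
  also have "\<dots> = homology_class V d (z + z')"
  proof (intro equalityI subsetI)
    fix t assume "t \<in> {a + b | a b. a \<in> homology_class V d z \<and> b \<in> homology_class V d z'}"
    then obtain y y' where "y \<in> V" "y' \<in> V" "t = (d y + z) + (d y' + z')"
      by (auto simp: homology_class_def)
    then show "t \<in> homology_class V d (z + z')"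
      unfolding homology_class_def
      by (intro image_eqI[of _ _ "y + y'"])
        (auto simp: linear_map_add[OF d] ac_simps subspace_F2_add[OF V])
  next
    fix t assume "t \<in> homology_class V d (z + z')"
    then obtain y where y: "y \<in> V" "t = d y + (z + z')" by (auto simp: homology_class_def)
    have "z' \<in> homology_class V d z'"
      unfolding homology_class_def
      by (intro image_eqI[of _ _ 0]) (auto simp: linear_map_0[OF V d] subspace_F2_0[OF V])
    moreover have "d y + z \<in> homology_class V d z" using y by (auto simp: homology_class_def)
    moreover have "t = (d y + z) + z'" using y by (simp add: ac_simps)
    ultimately show "t \<in> {a + b | a b. a \<in> homology_class V d z \<and> b \<in> homology_class V d z'}"
      by blast
  qed
  finally show ?thesis .
qed

text \<open>The union over a class is a single class, because \<open>f (d y + z)\<close> and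
  \<open>f z\<close> differ by the boundary \<open>d' (f y)\<close>.\<close>

lemma homology_map_dmod:
  assumes "chain_complex V d" "chain_complex V' d'" "linear_map V V' f"
    and comm: "\<And>y. y \<in> V \<Longrightarrow> f (d y) = d' (f y)" and z: "z \<in> V"
  shows "homology_map (dmod V' sm' d') f (homology_class V d z) = homology_class V' d' (f z)"
proof -
  have V: "subspace_F2 V" and d: "linear_map V V d"
    using assms(1) by (auto simp: chain_complex_def)
  have "homology_map (dmod V' sm' d') f (homology_class V d z) =
      (\<Union>x\<in>homology_class V d z. homology_class V' d' (f x))"
    by (auto simp: homology_map_def boundaries_def a_r_coset_def r_coset_def homology_class_def)
  also have "\<dots> = (\<Union>y\<in>V. homology_class V' d' (f (d y + z)))"
    by (simp add: homology_class_def[of V])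
  also have "\<dots> = (\<Union>y\<in>V. homology_class V' d' (f z))"
  proof (intro SUP_cong refl)
    fix y assume y: "y \<in> V"
    then have "f (d y + z) = f z + d' (f y)"
      using assms d by (simp add: linear_map_add[OF assms(3)] linear_map_in[OF d] ac_simps)
    moreover have "f y \<in> V'" "f z \<in> V'" "f (d y + z) \<in> V'"
      using y z by (auto intro: linear_map_in[OF assms(3)] linear_map_in[OF d] subspace_F2_add[OF V])
    ultimately show "homology_class V' d' (f (d y + z)) = homology_class V' d' (f z)"
      using homology_class_eq_iff[OF assms(2)] by blast
  qed
  \<comment> \<open>The constant union needs a nonempty index set; \<open>z\<close> provides
    it.\<close>
  also have "\<dots> = homology_class V' d' (f z)" using z by auto
  finally show ?thesis .
qed

lemma quasi_iso_dmod:
  assumes C: "chain_complex V d" "chain_complex V' d'" and f: "quasi_iso_map V d V' d' f"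
    and eqv: "\<And>r y. r \<in> carrier R \<Longrightarrow> y \<in> V \<Longrightarrow> f (sm r y) = sm' r (f y)"
  shows "quasi_iso R f (dmod V sm d) (dmod V' sm' d')"
proof -
  have V: "subspace_F2 V" "subspace_F2 V'" and d: "linear_map V V d" "linear_map V' V' d'"
    using C by (auto simp: chain_complex_def)
  have lin: "linear_map V V' f" and comm: "\<And>y. y \<in> V \<Longrightarrow> f (d y) = d' (f y)"
    and surj: "\<And>z. z \<in> V' \<Longrightarrow> d' z = 0 \<Longrightarrow> \<exists>y\<in>V. d y = 0 \<and> (\<exists>b\<in>V'. z = f y + d' b)"
    and inj: "\<And>y b. y \<in> V \<Longrightarrow> b \<in> V' \<Longrightarrow> d y = 0 \<Longrightarrow> f y = d' b \<Longrightarrow> \<exists>a\<in>V. y = d a"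
    using f by (auto simp: quasi_iso_map_def)
  let ?Z = "{z \<in> V. d z = 0}" and ?Z' = "{z \<in> V'. d' z = 0}"
  let ?h = "homology_map (dmod V' sm' d') f"
  have h: "?h (homology_class V d z) = homology_class V' d' (f z)" if "z \<in> V" for z
    using homology_map_dmod[OF C lin comm that] .
  have fZ: "f z \<in> ?Z'" if "z \<in> ?Z" for z
    using that comm[of z] linear_map_in[OF lin] linear_map_0[OF V(1) lin] by auto
  have ZZ: "z + z' \<in> ?Z" if "z \<in> ?Z" "z' \<in> ?Z" for z z'
    using that by (auto simp: linear_map_add[OF d(1)] subspace_F2_add[OF V(1)])
  have "?h \<in> iso (homology (dmod V sm d)) (homology (dmod V' sm' d'))"
    unfolding iso_def
  proof (intro CollectI conjI homI)
    fix x assume "x \<in> carrier (homology (dmod V sm d))"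
    then show "?h x \<in> carrier (homology (dmod V' sm' d'))"
      using fZ by (auto simp: carrier_homology_dmod h)
  next
    fix x y assume "x \<in> carrier (homology (dmod V sm d))" "y \<in> carrier (homology (dmod V sm d))"
    then show "?h (x \<otimes>\<^bsub>homology (dmod V sm d)\<^esub> y) =
        ?h x \<otimes>\<^bsub>homology (dmod V' sm' d')\<^esub> ?h y"
      using fZ ZZ by (auto simp: carrier_homology_dmod h mult_homology_dmod[OF C(1)]
        mult_homology_dmod[OF C(2)] linear_map_add[OF lin])
  next
    have "inj_on ?h (carrier (homology (dmod V sm d)))"
    proof (rule inj_onI)
      fix x y assume xy: "x \<in> carrier (homology (dmod V sm d))"
        "y \<in> carrier (homology (dmod V sm d))" "?h x = ?h y"
      then obtain z z' where z: "z \<in> ?Z" "z' \<in> ?Z" "x = homology_class V d z"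
        "y = homology_class V d z'" by (auto simp: carrier_homology_dmod)
      then have "homology_class V' d' (f z) = homology_class V' d' (f z')" using xy by (simp add: h)
      then obtain b where b: "b \<in> V'" "f z = f z' + d' b"
        using homology_class_eq_iff[OF C(2)] fZ z by auto
      then have "f (z + z') = d' b" using z by (simp add: linear_map_add[OF lin] ac_simps)
      then obtain a where "a \<in> V" "z + z' = d a" using inj[of "z + z'" b] ZZ[of z z'] z b by auto
      then have "z = z' + d a" by (metis add.commute fun_bit_add_left_self)
      with \<open>a \<in> V\<close> show "x = y" using homology_class_eq_iff[OF C(1), of z z'] z by auto
    qed
    moreover have "carrier (homology (dmod V' sm' d')) \<subseteq> ?h ` carrier (homology (dmod V sm d))"
    proof
      fix x assume "x \<in> carrier (homology (dmod V' sm' d'))"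
      then obtain z where z: "z \<in> ?Z'" "x = homology_class V' d' z"
        by (auto simp: carrier_homology_dmod)
      with surj[of z] obtain y b where y: "y \<in> ?Z" "b \<in> V'" "z = f y + d' b" by auto
      then have "x = homology_class V' d' (f y)"
        using homology_class_eq_iff[OF C(2), of z "f y"] z fZ[of y] by auto
      then show "x \<in> ?h ` carrier (homology (dmod V sm d))"
        using y h[of y] by (force simp: carrier_homology_dmod)
    qed
    ultimately show "bij_betw ?h (carrier (homology (dmod V sm d))) (carrier (homology (dmod V' sm' d')))"
      using fZ by (auto simp: bij_betw_def carrier_homology_dmod h)
  qed
  then show ?thesis
    using lin comm eqv by (auto simp: quasi_iso_def module_hom_dmod_iff)
qed

section \<open>Modules over the ground rings\<close>

lemma ring_of_type_algebra_simps [simp]: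
  "carrier ring_of_type_algebra = UNIV" "monoid.mult ring_of_type_algebra = (*)"
  "one ring_of_type_algebra = 1" "zero ring_of_type_algebra = 0" "add ring_of_type_algebra = (+)"
  by (auto simp: ring_of_type_algebra_def)

lemma ideal_ring_of_type_algebraI:
  fixes I :: "'a :: comm_ring_1 set"
  assumes "0 \<in> I" "\<And>a b. a \<in> I \<Longrightarrow> b \<in> I \<Longrightarrow> a + b \<in> I" "\<And>a b. a \<in> I \<Longrightarrow> b * a \<in> I"
  shows "ideal I ring_of_type_algebra"
proof (rule idealI)
  show "ring (ring_of_type_algebra :: 'a ring)" by (rule ring_from_type_algebra)
  interpret ring "ring_of_type_algebra :: 'a ring" by (rule ring_from_type_algebra)
  have inv: "inv\<^bsub>add_monoid ring_of_type_algebra\<^esub> x = - x" for x :: 'a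
    using minus_equality[of "- x" x] unfolding a_inv_def by simp
  show "subgroup I (add_monoid ring_of_type_algebra)"
  proof
    fix x assume "x \<in> I"
    then show "inv\<^bsub>add_monoid ring_of_type_algebra\<^esub> x \<in> I"
      using assms(3)[of x "- 1"] unfolding inv by simp
  qed (use assms in auto)
qed (use assms(3) in \<open>auto simp: mult.commute\<close>)

locale type_algebra_quotient =
  fixes I :: "'a :: comm_ring_1 set"
  assumes ideal_I: "ideal I ring_of_type_algebra"
begin

lemma cring_quotient: "cring (ring_of_type_algebra Quot I)"
  by (rule ideal.quotient_is_cring[OF ideal_I cring_from_type_algebra])

lemma carrier_quotientE:
  assumes "r \<in> carrier (ring_of_type_algebra Quot I)"
  obtains a where "r = {i + a | i. i \<in> I}"
  using assms by (auto simp: FactRing_def A_RCOSETS_def RCOSETS_def r_coset_def)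

lemma quotient_nonempty:
  assumes "r \<in> carrier (ring_of_type_algebra Quot I)"
  obtains f where "f \<in> r"
  using assms ideal.axioms(1)[OF ideal_I] additive_subgroup.zero_closed
  by (elim carrier_quotientE) fastforce

lemma quotient_diff_in:
  assumes "r \<in> carrier (ring_of_type_algebra Quot I)" "f \<in> r" "g \<in> r"
  shows "f - g \<in> I"
proof -
  obtain a i j where "f = i + a" "g = j + a" "i \<in> I" "j \<in> I"
    using assms by (auto elim!: carrier_quotientE)
  moreover have "(- 1) * j \<in> I" using ideal.I_l_closed[OF ideal_I, of j "- 1"] \<open>j \<in> I\<close> by simp
  ultimately show ?thesis
    using additive_subgroup.a_closed[OF ideal.axioms(1)[OF ideal_I], of i "(- 1) * j"] by simp
qed

lemma quotient_add_in:
  "f \<in> r \<Longrightarrow> g \<in> s \<Longrightarrow> f + g \<in> r \<oplus>\<^bsub>ring_of_type_algebra Quot I\<^esub> s"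
  by (auto simp: FactRing_def set_add_def set_mult_def)

lemma quotient_mult_in:
  "f \<in> r \<Longrightarrow> g \<in> s \<Longrightarrow> f * g \<in> r \<otimes>\<^bsub>ring_of_type_algebra Quot I\<^esub> s"
  using additive_subgroup.zero_closed[OF ideal.axioms(1)[OF ideal_I]]
  by (force simp: FactRing_def rcoset_mult_def a_r_coset_def r_coset_def)

lemma quotient_one_in: "1 \<in> \<one>\<^bsub>ring_of_type_algebra Quot I\<^esub>"
  using additive_subgroup.zero_closed[OF ideal.axioms(1)[OF ideal_I]]
  by (force simp: FactRing_def a_r_coset_def r_coset_def)

text \<open>Sums, products and the unit of cosets contain the sums, products and unit of
  representatives, so each module axiom is inherited from \<open>act\<close>. The last hypothesis
  says that all representatives of a coset act alike.\<close>

lemma diff_module_quotient: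
  fixes act :: "'a \<Rightarrow> ('g \<Rightarrow> bit) \<Rightarrow> 'g \<Rightarrow> bit"
  assumes C: "chain_complex V d"
    and lin: "\<And>f. linear_map V V (act f)"
    and add: "\<And>f g y. y \<in> V \<Longrightarrow> act (f + g) y = act f y + act g y"
    and mult: "\<And>f g y. y \<in> V \<Longrightarrow> act (f * g) y = act f (act g y)"
    and one: "\<And>y. y \<in> V \<Longrightarrow> act 1 y = y"
    and d: "\<And>f y. y \<in> V \<Longrightarrow> act f (d y) = d (act f y)"
    and sm: "\<And>r f y. r \<in> carrier (ring_of_type_algebra Quot I) \<Longrightarrow> f \<in> r \<Longrightarrow> y \<in> V \<Longrightarrow> sm r y = act f y"
  shows "diff_module (ring_of_type_algebra Quot I) (dmod V sm d)"
proof -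
  interpret R: cring "ring_of_type_algebra Quot I" by (rule cring_quotient)
  have V: "subspace_F2 V" and ld: "linear_map V V d" using C by (auto simp: chain_complex_def)
  have "Module.module (ring_of_type_algebra Quot I) (dmod V sm d)"
  proof (intro moduleI)
    show "cring (ring_of_type_algebra Quot I)" by (rule cring_quotient)
    show "abelian_group (dmod V sm d)" by (rule abelian_group_dmod[OF V])
  next
    fix a y assume "a \<in> carrier (ring_of_type_algebra Quot I)" "y \<in> carrier (dmod V sm d)"
    then show "a \<odot>\<^bsub>dmod V sm d\<^esub> y \<in> carrier (dmod V sm d)"
      by (metis dmod_simps(1) quotient_nonempty sm linear_map_in[OF lin] dmod_simps(4))
  next
    fix a b y assume ab: "a \<in> carrier (ring_of_type_algebra Quot I)"
      "b \<in> carrier (ring_of_type_algebra Quot I)" and y: "y \<in> carrier (dmod V sm d)"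
    obtain f g where fg: "f \<in> a" "g \<in> b" using ab by (meson quotient_nonempty)
    show "(a \<oplus>\<^bsub>ring_of_type_algebra Quot I\<^esub> b) \<odot>\<^bsub>dmod V sm d\<^esub> y =
        a \<odot>\<^bsub>dmod V sm d\<^esub> y \<oplus>\<^bsub>dmod V sm d\<^esub> b \<odot>\<^bsub>dmod V sm d\<^esub> y"
      using ab y fg sm[OF R.add.m_closed[OF ab] quotient_add_in[OF fg]] by (simp add: add sm)
    show "(a \<otimes>\<^bsub>ring_of_type_algebra Quot I\<^esub> b) \<odot>\<^bsub>dmod V sm d\<^esub> y =
        a \<odot>\<^bsub>dmod V sm d\<^esub> (b \<odot>\<^bsub>dmod V sm d\<^esub> y)"
      using ab y fg sm[OF R.m_closed[OF ab] quotient_mult_in[OF fg]]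
      by (simp add: mult sm linear_map_in[OF lin])
  next
    fix a y z assume "a \<in> carrier (ring_of_type_algebra Quot I)"
      "y \<in> carrier (dmod V sm d)" "z \<in> carrier (dmod V sm d)"
    then show "a \<odot>\<^bsub>dmod V sm d\<^esub> (y \<oplus>\<^bsub>dmod V sm d\<^esub> z) =
        a \<odot>\<^bsub>dmod V sm d\<^esub> y \<oplus>\<^bsub>dmod V sm d\<^esub> a \<odot>\<^bsub>dmod V sm d\<^esub> z"
      by (metis dmod_simps(1,3,4) quotient_nonempty sm linear_map_add[OF lin] subspace_F2_add[OF V])
  next
    fix y assume "y \<in> carrier (dmod V sm d)"
    then show "\<one>\<^bsub>ring_of_type_algebra Quot I\<^esub> \<odot>\<^bsub>dmod V sm d\<^esub> y = y"
      using sm[OF R.one_closed quotient_one_in] by (simp add: one)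
  qed
  moreover have "d \<in> module_hom (ring_of_type_algebra Quot I) (dmod V sm d) (dmod V sm d)"
    unfolding module_hom_dmod_iff
    using ld by (metis linear_map_in d sm quotient_nonempty)
  ultimately show ?thesis using C by (simp add: diff_module_def chain_complex_def)
qed

end


section \<open>Truncated polynomials acting through square-zero operators\<close>

definition scale :: "bit \<Rightarrow> ('g \<Rightarrow> bit) \<Rightarrow> 'g \<Rightarrow> bit"
  where "scale c y = (\<lambda>g. c * y g)"

lemma scale_simps [simp]: "scale 0 y = 0" "scale 1 y = y" "scale c 0 = 0"
  by (auto simp: scale_def fun_eq_iff)

lemma scale_distribs:
  "scale c (y + z) = scale c y + scale c z"
  "scale (a + b) y = scale a y + scale b y"
  "scale (a * b) y = scale a (scale b y)"
  by (auto simp: scale_def fun_eq_iff algebra_simps)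

lemma scale_left_commute: "scale a (scale b y) = scale b (scale a y)"
  by (auto simp: scale_def fun_eq_iff)

lemma scale_commute:
  assumes "subspace_F2 V" "linear_map V W f"
  shows "f (scale c y) = scale c (f y)"
  using linear_map_0[OF assms] by (cases c) auto

lemma scale_in: "subspace_F2 V \<Longrightarrow> y \<in> V \<Longrightarrow> scale c y \<in> V"
  by (cases c) (auto simp: subspace_F2_0)

text \<open>Closed form of \<open>poly_act\<close> for an operator of square zero. No summation
  range depends on the degree of \<open>f\<close>, so additivity in \<open>f\<close> is immediate,
  and only \<open>f\<close> modulo X^2 enters.\<close>

definition act1 :: "(('g \<Rightarrow> bit) \<Rightarrow> 'g \<Rightarrow> bit) \<Rightarrow> bit poly \<Rightarrow> ('g \<Rightarrow> bit) \<Rightarrow> 'g \<Rightarrow> bit"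
  where "act1 x f y = scale (Polynomial.coeff f 0) y + scale (Polynomial.coeff f 1) (x y)"

definition act2 ::
    "(('g \<Rightarrow> bit) \<Rightarrow> 'g \<Rightarrow> bit) \<Rightarrow> (('g \<Rightarrow> bit) \<Rightarrow> 'g \<Rightarrow> bit) \<Rightarrow>
     bit poly poly \<Rightarrow> ('g \<Rightarrow> bit) \<Rightarrow> 'g \<Rightarrow> bit"
  where "act2 w x f y = act1 w (Polynomial.coeff f 0) y + act1 w (Polynomial.coeff f 1) (x y)"

lemma iterate_eq_0:
  assumes "x (x y) = 0" "x 0 = 0" "2 \<le> i"
  shows "(x ^^ i) y = 0"
proof -
  obtain j where j: "i = Suc (Suc j)" using assms(3) by (metis add_2_eq_Suc le_Suc_ex)
  have "(x ^^ j) 0 = 0" by (induction j) (auto simp: assms)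
  then show ?thesis by (simp only: j funpow_Suc_right o_apply assms)
qed

text \<open>The bound \<open>n\<close> will be the degree of a polynomial and may be 0; the second
  hypothesis then makes the absent term \<open>h 1\<close> vanish.\<close>

lemma sum_low_terms:
  fixes h :: "nat \<Rightarrow> bit"
  assumes "\<And>i. 2 \<le> i \<Longrightarrow> h i = 0" "\<And>i. n < i \<Longrightarrow> h i = 0"
  shows "(\<Sum>i\<le>n. h i) = h 0 + h 1"
proof -
  have "(\<Sum>i\<le>n. h i) = (\<Sum>i\<in>{0, 1}. h i)"
    using assms by (intro sum.mono_neutral_cong) (auto simp: not_le less_2_cases_iff intro!: assms(1))
  then show ?thesis by simp
qed

lemma poly_act_eq_act1:
  assumes "x (x y) = 0" "x 0 = 0"
  shows "poly_act x f y = act1 x f y"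
proof
  fix g
  have "(\<Sum>i\<le>Polynomial.degree f. Polynomial.coeff f i * (x ^^ i) y g) =
      Polynomial.coeff f 0 * (x ^^ 0) y g + Polynomial.coeff f 1 * (x ^^ 1) y g"
    by (rule sum_low_terms) (auto simp: iterate_eq_0[OF assms] coeff_eq_0)
  then show "poly_act x f y g = act1 x f y g"
    by (simp add: poly_act_def act1_def scale_def)
qed

lemma poly2_act_eq_act2:
  assumes w: "\<And>y. y \<in> V \<Longrightarrow> w (w y) = 0" "w 0 = 0" and x: "x (x y) = 0" "x 0 = 0"
    and V: "y \<in> V" "x y \<in> V" "0 \<in> V"
  shows "poly2_act w x f y = act2 w x f y"
proof
  fix g
  have it: "(x ^^ i) y \<in> V" for i
  proof (cases "2 \<le> i")
    case False
    then have "i = 0 \<or> i = 1" by auto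
    then show ?thesis using V by auto
  qed (simp add: iterate_eq_0[OF x] V)
  have z: "poly_act w p 0 = 0" "u \<in> V \<Longrightarrow> poly_act w 0 u = 0" for p u
    using poly_act_eq_act1[OF w(1)[OF V(3)] w(2), of p] poly_act_eq_act1[OF w(1) w(2), of u 0]
    by (simp_all only: act1_def w(2) scale_simps coeff_0 add_0_left)
  have "(\<Sum>i\<le>Polynomial.degree f. poly_act w (Polynomial.coeff f i) ((x ^^ i) y) g) =
      poly_act w (Polynomial.coeff f 0) ((x ^^ 0) y) g + poly_act w (Polynomial.coeff f 1) ((x ^^ 1) y) g"
    by (rule sum_low_terms) (simp_all only: iterate_eq_0[OF x] coeff_eq_0 z zero_fun_apply it)
  then show "poly2_act w x f y g = act2 w x f y g"
    by (simp add: poly2_act_def act2_def poly_act_eq_act1[OF w(1) w(2)] V)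
qed

lemma coeff_mult_low:
  fixes f g :: "'a :: comm_semiring_0 poly"
  shows "Polynomial.coeff (f * g) 0 = Polynomial.coeff f 0 * Polynomial.coeff g 0"
    "Polynomial.coeff (f * g) (Suc 0) =
      Polynomial.coeff f 0 * Polynomial.coeff g (Suc 0) + Polynomial.coeff f (Suc 0) * Polynomial.coeff g 0"
  by (auto simp: coeff_mult)

context
  fixes V :: "('g \<Rightarrow> bit) set" and x :: "('g \<Rightarrow> bit) \<Rightarrow> 'g \<Rightarrow> bit"
  assumes V: "subspace_F2 V" and x: "linear_map V V x"
begin

lemma act1_linear: "linear_map V V (act1 x f)"
  unfolding linear_map_def act1_def
  by (auto simp: linear_map_add[OF x] scale_distribs ac_simps
      intro!: subspace_F2_add[OF V] scale_in[OF V] linear_map_in[OF x])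

lemma act1_add: "y \<in> V \<Longrightarrow> act1 x (f + g) y = act1 x f y + act1 x g y"
  by (simp add: act1_def scale_distribs ac_simps)

lemma act1_mult:
  assumes "y \<in> V" "x (x y) = 0"
  shows "act1 x (f * g) y = act1 x f (act1 x g y)"
  using assms
  by (simp add: act1_def scale_distribs coeff_mult_low linear_map_add[OF x] linear_map_in[OF x] scale_in[OF V]
      scale_commute[OF V x] scale_left_commute ac_simps)

lemma act1_left_commute:
  assumes "y \<in> V" "x (x y) = 0"
  shows "act1 x f (act1 x g y) = act1 x g (act1 x f y)"
  by (metis act1_mult assms mult.commute)

lemma act1_commute:
  assumes f: "linear_map V W f" and "f (x y) = x' (f y)" "y \<in> V"
  shows "f (act1 x p y) = act1 x' p (f y)"
  using assms by (simp add: act1_def linear_map_add[OF f] linear_map_in[OF x] scale_in[OF V]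
      scale_commute[OF V f])

end

lemma act1_1: "act1 x 1 y = y"
  by (simp add: act1_def)

text \<open>Being an ideal that contains X^2, this set contains the ideal generated by X^2. Hence
  polynomials in one coset agree in the two coefficients that \<open>act1\<close> reads, and the
  choice of representative in \<open>F2X_smult\<close> is immaterial.\<close>

lemma ideal_low_coeffs: "ideal {f :: bit poly. Polynomial.coeff f 0 = 0 \<and> Polynomial.coeff f 1 = 0} ring_of_type_algebra"
  by (rule ideal_ring_of_type_algebraI) (auto simp: coeff_mult_low)

lemma ideal_low_coeffs2:
  "ideal {f :: bit poly poly. \<forall>i<2. \<forall>j<2. Polynomial.coeff (Polynomial.coeff f i) j = 0} ring_of_type_algebra"
  by (rule ideal_ring_of_type_algebraI) (auto simp: coeff_mult_low less_2_cases_iff)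

interpretation F2X: type_algebra_quotient F2X_ideal
  unfolding F2X_ideal_def
  by (rule type_algebra_quotient.intro, rule ring.genideal_ideal[OF ring_from_type_algebra]) simp

interpretation F2WX: type_algebra_quotient F2WX_ideal
  unfolding F2WX_ideal_def
  by (rule type_algebra_quotient.intro, rule ring.genideal_ideal[OF ring_from_type_algebra]) simp

lemma F2X_ideal_coeffs:
  assumes "f \<in> F2X_ideal" shows "Polynomial.coeff f 0 = 0" "Polynomial.coeff f 1 = 0"
  using assms ring.genideal_minimal[OF ring_from_type_algebra ideal_low_coeffs, of "{[:0, 0, 1:]}"]
  by (auto simp: F2X_ideal_def)

lemma F2WX_ideal_coeffs:
  assumes "f \<in> F2WX_ideal" "i < 2" "j < 2"
  shows "Polynomial.coeff (Polynomial.coeff f i) j = 0"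
proof -
  have "{[:[:0, 0, 1:]:], [:0, 0, 1:]} \<subseteq>
      {f :: bit poly poly. \<forall>i<2. \<forall>j<2. Polynomial.coeff (Polynomial.coeff f i) j = 0}"
    by (auto simp: less_2_cases_iff)
  from ring.genideal_minimal[OF ring_from_type_algebra ideal_low_coeffs2 this] assms show ?thesis
    by (auto simp: F2WX_ideal_def)
qed

lemma F2X_smult_eq:
  assumes V: "subspace_F2 V" and x: "square_zero_action V d x"
    and r: "r \<in> carrier F2X" "f \<in> r" and y: "y \<in> V"
  shows "F2X_smult x r y = act1 x f y"
proof -
  have lin: "linear_map V V x" using x by (simp add: square_zero_action_def)
  have s: "(SOME f. f \<in> r) \<in> r" using r(2) by (rule someI)
  have "(SOME f. f \<in> r) - f \<in> F2X_ideal"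
    using r s unfolding F2X_def by (intro F2X.quotient_diff_in)
  from F2X_ideal_coeffs[OF this]
  have "act1 x (SOME f. f \<in> r) y = act1 x f y" by (simp add: act1_def bit_add_eq_0_iff)
  moreover have "poly_act x (SOME f. f \<in> r) y = act1 x (SOME f. f \<in> r) y"
    using x y by (intro poly_act_eq_act1 linear_map_0[OF V lin]) (auto simp: square_zero_action_def)
  ultimately show ?thesis by (simp add: F2X_smult_def)
qed

lemma F2WX_smult_eq:
  assumes V: "subspace_F2 V" and w: "square_zero_action V d w" and x: "square_zero_action V d x"
    and r: "r \<in> carrier F2WX" "f \<in> r" and y: "y \<in> V"
  shows "F2WX_smult w x r y = act2 w x f y"
proof -
  have lin: "linear_map V V x" "linear_map V V w" using w x by (auto simp: square_zero_action_def)
  have s: "(SOME f. f \<in> r) \<in> r" using r(2) by (rule someI)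
  have "(SOME f. f \<in> r) - f \<in> F2WX_ideal"
    using r s unfolding F2WX_def by (intro F2WX.quotient_diff_in)
  from F2WX_ideal_coeffs[OF this]
  have "Polynomial.coeff (Polynomial.coeff (SOME f. f \<in> r) i) j = Polynomial.coeff (Polynomial.coeff f i) j"
    if "i < 2" "j < 2" for i j
    using that by (simp add: bit_add_eq_0_iff)
  then have "act2 w x (SOME f. f \<in> r) y = act2 w x f y" by (simp add: act2_def act1_def)
  moreover have "poly2_act w x (SOME f. f \<in> r) y = act2 w x (SOME f. f \<in> r) y"
    using w x y by (intro poly2_act_eq_act2[of V] linear_map_0[OF V lin(1)] linear_map_0[OF V lin(2)])
      (auto simp: square_zero_action_def linear_map_in subspace_F2_0[OF V])
  ultimately show ?thesis by (simp add: F2WX_smult_def)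
qed

lemma diff_module_F2X:
  assumes C: "chain_complex V d" and x: "square_zero_action V d x"
  shows "diff_module F2X (dmod V (F2X_smult x) d)"
proof -
  have V: "subspace_F2 V" and d: "linear_map V V d" using C by (auto simp: chain_complex_def)
  have lin: "linear_map V V x" using x by (simp add: square_zero_action_def)
  show ?thesis
    unfolding F2X_def
  proof (rule F2X.diff_module_quotient[OF C])
    show "act1 x f (d y) = d (act1 x f y)" if "y \<in> V" for f y
      using x that by (intro act1_commute[OF V lin d, symmetric]) (auto simp: square_zero_action_def)
    show "F2X_smult x r y = act1 x f y"
      if "r \<in> carrier (ring_of_type_algebra Quot F2X_ideal)" "f \<in> r" "y \<in> V" for r f y
      using F2X_smult_eq[OF V x] that by (simp add: F2X_def)
  qed (use x in \<open>auto simp: act1_linear[OF V lin] act1_add[OF V lin] act1_mult[OF V lin] act1_1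
      square_zero_action_def\<close>)
qed

lemma diff_module_F2WX:
  assumes C: "chain_complex V d" and w: "square_zero_action V d w" and x: "square_zero_action V d x"
    and wx: "\<And>y. y \<in> V \<Longrightarrow> w (x y) = x (w y)"
  shows "diff_module F2WX (dmod V (F2WX_smult w x) d)"
proof -
  have V: "subspace_F2 V" and d: "linear_map V V d" using C by (auto simp: chain_complex_def)
  have lw: "linear_map V V w" and lx: "linear_map V V x" using w x by (auto simp: square_zero_action_def)
  note a1 = act1_linear[OF V lw]
  have xa: "x (act1 w p y) = act1 w p (x y)" if "y \<in> V" for p y
    using that wx by (intro act1_commute[OF V lw lx]) auto
  have da: "d (act1 w p y) = act1 w p (d y)" if "y \<in> V" for p y
    using that w by (intro act1_commute[OF V lw d]) (auto simp: square_zero_action_def)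
  note simps = linear_map_in[OF a1] linear_map_in[OF lx] linear_map_in[OF d] linear_map_add[OF a1]
    linear_map_add[OF lx] linear_map_add[OF d] subspace_F2_add[OF V] linear_map_0[OF V a1]
  show ?thesis
    unfolding F2WX_def
  proof (rule F2WX.diff_module_quotient[OF C])
    show "linear_map V V (act2 w x f)" for f
      by (auto simp: linear_map_def act2_def simps ac_simps)
    show "act2 w x (f + g) y = act2 w x f y + act2 w x g y" if "y \<in> V" for f g y
      using that by (simp add: act2_def act1_add[OF V lw] simps ac_simps)
    show "act2 w x (f * g) y = act2 w x f (act2 w x g y)" if "y \<in> V" for f g y
    proof -
      have "w (w y) = 0" "x (x y) = 0" "w (w (x y)) = 0"
        using w x that by (auto simp: square_zero_action_def simps)
      then show ?thesis
        using that
        by (simp add: act2_def act1_add[OF V lw] act1_mult[OF V lw] simps coeff_mult_low xa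
            act1_left_commute[OF V lw] ac_simps)
    qed
    show "act2 w x 1 y = y" if "y \<in> V" for y
      by (simp add: act2_def act1_def)
    show "act2 w x f (d y) = d (act2 w x f y)" if "y \<in> V" for f y
    proof -
      have "x (d y) = d (x y)" using x that by (simp add: square_zero_action_def)
      then show ?thesis using that by (simp add: act2_def da simps)
    qed
    show "F2WX_smult w x r y = act2 w x f y"
      if "r \<in> carrier (ring_of_type_algebra Quot F2WX_ideal)" "f \<in> r" "y \<in> V" for r f y
      using F2WX_smult_eq[OF V w x] that by (simp add: F2WX_def)
  qed
qed

text \<open>Commuting with the operator of the variable is enough for equivariance over the whole
  ring, since a coset acts as \<open>act1\<close> of any representative.\<close>

lemma quasi_iso_F2X:
  assumes C: "chain_complex V d" "chain_complex V' d'"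
    and x: "square_zero_action V d x" "square_zero_action V' d' x'"
    and f: "quasi_iso_map V d V' d' f" and fx: "\<And>y. y \<in> V \<Longrightarrow> f (x y) = x' (f y)"
  shows "quasi_iso F2X f (dmod V (F2X_smult x) d) (dmod V' (F2X_smult x') d')"
proof (rule quasi_iso_dmod[OF C f])
  fix r y assume r: "r \<in> carrier F2X" and y: "y \<in> V"
  then obtain p where p: "p \<in> r" unfolding F2X_def by (elim F2X.quotient_nonempty)
  have V: "subspace_F2 V" "subspace_F2 V'" and lx: "linear_map V V x" and lf: "linear_map V V' f"
    using C x f by (auto simp: chain_complex_def square_zero_action_def quasi_iso_map_def)
  show "f (F2X_smult x r y) = F2X_smult x' r (f y)"
    unfolding F2X_smult_eq[OF V(1) x(1) r p y] F2X_smult_eq[OF V(2) x(2) r p linear_map_in[OF lf y]]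
    using act1_commute[OF V(1) lx lf, of y x'] fx y by blast
qed

lemma quasi_iso_F2WX:
  assumes C: "chain_complex V d" "chain_complex V' d'"
    and w: "square_zero_action V d w" "square_zero_action V' d' w'"
    and x: "square_zero_action V d x" "square_zero_action V' d' x'"
    and f: "quasi_iso_map V d V' d' f"
    and fw: "\<And>y. y \<in> V \<Longrightarrow> f (w y) = w' (f y)" and fx: "\<And>y. y \<in> V \<Longrightarrow> f (x y) = x' (f y)"
  shows "quasi_iso F2WX f (dmod V (F2WX_smult w x) d) (dmod V' (F2WX_smult w' x') d')"
proof (rule quasi_iso_dmod[OF C f])
  fix r y assume r: "r \<in> carrier F2WX" and y: "y \<in> V"
  then obtain p where p: "p \<in> r" unfolding F2WX_def by (elim F2WX.quotient_nonempty)
  have V: "subspace_F2 V" "subspace_F2 V'" and lw: "linear_map V V w" and lx: "linear_map V V x"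
    and lf: "linear_map V V' f"
    using C w x f by (auto simp: chain_complex_def square_zero_action_def quasi_iso_map_def)
  have fa: "f (act1 w q z) = act1 w' q (f z)" if "z \<in> V" for q z
    using act1_commute[OF V(1) lw lf, of z w'] fw that by blast
  show "f (F2WX_smult w x r y) = F2WX_smult w' x' r (f y)"
    unfolding F2WX_smult_eq[OF V(1) w(1) x(1) r p y]
      F2WX_smult_eq[OF V(2) w(2) x(2) r p linear_map_in[OF lf y]]
    using y by (simp add: act2_def fa fx linear_map_add[OF lf] linear_map_in[OF lx]
        linear_map_in[OF act1_linear[OF V(1) lw]])
qed

section \<open>Zig-zags\<close>

lemma quasi_isomorphic_refl: "diff_module R M \<Longrightarrow> quasi_isomorphic R M M"
  by (simp add: quasi_isomorphic_def reflpD)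

lemma quasi_isomorphic_sym: "quasi_isomorphic R M N \<Longrightarrow> quasi_isomorphic R N M"
  by (auto simp: quasi_isomorphic_def intro: equivclp_sym)

lemma quasi_isomorphic_trans:
  "quasi_isomorphic R M N \<Longrightarrow> quasi_isomorphic R N P \<Longrightarrow> quasi_isomorphic R M P"
  by (auto simp: quasi_isomorphic_def intro: equivclp_trans)

lemma quasi_iso_imp_quasi_isomorphic:
  "diff_module R M \<Longrightarrow> diff_module R N \<Longrightarrow> quasi_iso R f M N \<Longrightarrow> quasi_isomorphic R M N"
  by (auto simp: quasi_isomorphic_def intro!: r_into_equivclp)

lemma quasi_isomorphic_F2X:
  assumes "chain_complex V d" "chain_complex V' d'"
    and "square_zero_action V d x" "square_zero_action V' d' x'"
    and "quasi_iso_map V d V' d' f" and "\<And>y. y \<in> V \<Longrightarrow> f (x y) = x' (f y)"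
  shows "quasi_isomorphic F2X (dmod V (F2X_smult x) d) (dmod V' (F2X_smult x') d')"
  by (rule quasi_iso_imp_quasi_isomorphic[where f = f])
    (blast intro!: diff_module_F2X quasi_iso_F2X assms)+

lemma quasi_isomorphic_F2WX:
  assumes "chain_complex V d" "chain_complex V' d'"
    and "square_zero_action V d w" "square_zero_action V' d' w'"
    and "square_zero_action V d x" "square_zero_action V' d' x'"
    and "\<And>y. y \<in> V \<Longrightarrow> w (x y) = x (w y)" "\<And>y. y \<in> V' \<Longrightarrow> w' (x' y) = x' (w' y)"
    and "quasi_iso_map V d V' d' f"
    and "\<And>y. y \<in> V \<Longrightarrow> f (w y) = w' (f y)" and "\<And>y. y \<in> V \<Longrightarrow> f (x y) = x' (f y)"
  shows "quasi_isomorphic F2WX (dmod V (F2WX_smult w x) d) (dmod V' (F2WX_smult w' x') d')"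
  by (rule quasi_iso_imp_quasi_isomorphic[where f = f])
    (blast intro!: diff_module_F2WX quasi_iso_F2WX assms)+

section \<open>Sequences of chains, encoded as chains\<close>

text \<open>The intermediate modules of a zig-zag have to live in the type of chains again.\<close>

definition tag :: "nat \<times> generator \<Rightarrow> generator"
  where "tag = (\<lambda>(n, v, S). (insert (2 * n) ((\<lambda>k. 2 * k + 1) ` v), S))"

text \<open>The index is read off from the only even member of the first component, the resolution
  from the odd members.\<close>

lemma inj_tag: "inj tag"
proof (rule injI)
  fix x y :: "nat \<times> generator"
  obtain n v S where x: "x = (n, v, S)" by (cases x)
  obtain m u T where y: "y = (m, u, T)" by (cases y)
  have even: "{k \<in> insert (2 * i) ((\<lambda>k. 2 * k + 1) ` A). even k} = {2 * i}" for i :: nat and A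
    by auto
  have odd: "{k \<in> insert (2 * i) ((\<lambda>k. 2 * k + 1) ` A). odd k} = (\<lambda>k. 2 * k + 1) ` A" for i :: nat and A
    by auto
  assume "tag x = tag y"
  then have eq: "insert (2 * n) ((\<lambda>k. 2 * k + 1) ` v) = insert (2 * m) ((\<lambda>k. 2 * k + 1) ` u)" "S = T"
    by (auto simp: tag_def x y)
  have "{2 * n} = {2 * m}"
    using arg_cong[OF eq(1), of "\<lambda>A. {k \<in> A. even k}"] by (simp only: even)
  then have "n = m" by simp
  moreover have "(\<lambda>k. 2 * k + 1) ` v = (\<lambda>k. 2 * k + 1) ` u"
    using arg_cong[OF eq(1), of "\<lambda>A. {k \<in> A. odd k}"] by (simp only: odd)
  then have "v = u" by (subst (asm) inj_image_eq_iff) (auto intro: injI)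
  ultimately show "x = y" by (simp add: x y eq)
qed

text \<open>The value 0 off the range of \<open>tag\<close> makes the encoding additive.
  \<open>unpack\<close> is a left inverse only: it forgets the values off that range.\<close>

definition pack :: "(nat \<Rightarrow> chain) \<Rightarrow> chain"
  where "pack s = (\<lambda>g. if g \<in> range tag then case_prod s (inv_into UNIV tag g) else 0)"

definition unpack :: "chain \<Rightarrow> nat \<Rightarrow> chain"
  where "unpack c = (\<lambda>n h. c (tag (n, h)))"

lemma unpack_pack [simp]: "unpack (pack s) = s"
  by (simp add: unpack_def pack_def inv_f_f[OF inj_tag])

lemma pack_eq_iff [simp]: "pack s = pack t \<longleftrightarrow> s = t"
  by (metis unpack_pack)

lemma pack_add: "pack s + pack t = pack (\<lambda>n. s n + t n)"
  by (auto simp: pack_def fun_eq_iff split: prod.splits)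

lemma pack_0: "pack (\<lambda>n. 0) = 0"
  by (auto simp: pack_def fun_eq_iff split: prod.splits)

lemma pack_eq_0_iff: "pack s = 0 \<longleftrightarrow> s = (\<lambda>n. 0)"
  by (metis pack_0 pack_eq_iff)

section \<open>The cone construction\<close>

definition triple :: "chain \<Rightarrow> chain \<Rightarrow> chain \<Rightarrow> chain"
  where "triple a b c = pack (\<lambda>n. if n = 0 then a else if n = 1 then b else if n = 2 then c else 0)"

lemma unpack_triple [simp]:
  "unpack (triple a b c) 0 = a" "unpack (triple a b c) (Suc 0) = b" "unpack (triple a b c) 2 = c"
  by (auto simp: triple_def)

lemma triple_eq_iff [simp]: "triple a b c = triple a' b' c' \<longleftrightarrow> a = a' \<and> b = b' \<and> c = c'"
  by (metis unpack_triple)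

lemma triple_add: "triple a b c + triple a' b' c' = triple (a + a') (b + b') (c + c')"
  unfolding triple_def pack_add by (rule arg_cong[of _ _ pack]) auto

lemma triple_0: "triple 0 0 0 = 0"
  unfolding triple_def by (simp add: pack_0 cong: if_cong)

lemma triple_eq_0_iff: "triple a b c = 0 \<longleftrightarrow> a = 0 \<and> b = 0 \<and> c = 0"
  by (metis triple_0 triple_eq_iff)

definition triples :: "chain set \<Rightarrow> chain set"
  where "triples V = {triple a b c | a b c. a \<in> V \<and> b \<in> V \<and> c \<in> V}"

text \<open>
  \<open>triple a b c\<close> stands for $1 \otimes a + W \otimes b + uc$ in a quotient of the truncated bar resolution:
  the differential sends $uc$ to $W \otimes c + 1 \otimes wc + u\,dc$, and $W$ sends $uc$ to $u\,wc$.
\<close>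

definition triple_map :: "(chain \<Rightarrow> chain) \<Rightarrow> chain \<Rightarrow> chain"
  where "triple_map x t = triple (x (unpack t 0)) (x (unpack t 1)) (x (unpack t 2))"

definition cone_diff :: "(chain \<Rightarrow> chain) \<Rightarrow> (chain \<Rightarrow> chain) \<Rightarrow> chain \<Rightarrow> chain"
  where "cone_diff d w t =
    triple (d (unpack t 0) + w (unpack t 2)) (d (unpack t 1) + unpack t 2) (d (unpack t 2))"

definition cone_act :: "(chain \<Rightarrow> chain) \<Rightarrow> chain \<Rightarrow> chain"
  where "cone_act w t = triple 0 (unpack t 0) (w (unpack t 2))"

definition cone_map :: "(chain \<Rightarrow> chain) \<Rightarrow> (chain \<Rightarrow> chain) \<Rightarrow> chain \<Rightarrow> chain"
  where "cone_map w H t = unpack t 0 + w (unpack t 1) + H (unpack t 2)"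

lemma triplesE:
  assumes "t \<in> triples V"
  obtains a b c where "t = triple a b c" "a \<in> V" "b \<in> V" "c \<in> V"
  using assms by (auto simp: triples_def)

lemma triple_in_triples [simp]: "triple a b c \<in> triples V \<longleftrightarrow> a \<in> V \<and> b \<in> V \<and> c \<in> V"
  by (auto simp: triples_def)

lemma zero_in_triples: "0 \<in> V \<Longrightarrow> 0 \<in> triples V"
  by (metis triple_0 triple_in_triples)

context
  fixes V :: "chain set" and d w
  assumes C: "chain_complex V d" and w: "square_zero_action V d w"
begin

private lemma V_subspace: "subspace_F2 V" and d_linear: "linear_map V V d" and d_d: "y \<in> V \<Longrightarrow> d (d y) = 0"
  using C by (auto simp: chain_complex_def)

private lemma w_linear: "linear_map V V w" and w_w: "y \<in> V \<Longrightarrow> w (w y) = 0" and w_d: "y \<in> V \<Longrightarrow> w (d y) = d (w y)"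
  using w by (auto simp: square_zero_action_def)

private lemmas cone_simps = linear_map_in[OF d_linear] linear_map_in[OF w_linear] linear_map_add[OF d_linear] linear_map_add[OF w_linear]
  subspace_F2_add[OF V_subspace] subspace_F2_0[OF V_subspace] linear_map_0[OF V_subspace d_linear] linear_map_0[OF V_subspace w_linear] d_d w_w w_d

lemma chain_complex_cone: "chain_complex (triples V) (cone_diff d w)"
  unfolding chain_complex_def subspace_F2_def linear_map_def
  by (auto elim!: triplesE simp: triple_add cone_diff_def cone_simps ac_simps triple_eq_0_iff zero_in_triples)

lemma square_zero_action_cone_act: "square_zero_action (triples V) (cone_diff d w) (cone_act w)"
  unfolding square_zero_action_def linear_map_def
  by (auto elim!: triplesE simp: triple_add cone_diff_def cone_act_def cone_simps ac_simps triple_eq_0_iff zero_in_triples)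

lemma square_zero_action_triple_map:
  assumes x: "square_zero_action V d x" and wx: "\<And>y. y \<in> V \<Longrightarrow> w (x y) = x (w y)"
  shows "square_zero_action (triples V) (cone_diff d w) (triple_map x)"
    and "\<And>t. t \<in> triples V \<Longrightarrow> cone_act w (triple_map x t) = triple_map x (cone_act w t)"
proof -
  have lx: "linear_map V V x" and xx: "\<And>y. y \<in> V \<Longrightarrow> x (x y) = 0" and xd: "\<And>y. y \<in> V \<Longrightarrow> x (d y) = d (x y)"
    using x by (auto simp: square_zero_action_def)
  note s = cone_simps linear_map_in[OF lx] linear_map_add[OF lx] linear_map_0[OF V_subspace lx] xx xd wx
  show "square_zero_action (triples V) (cone_diff d w) (triple_map x)"
    unfolding square_zero_action_def linear_map_def
    by (auto elim!: triplesE simp: triple_add cone_diff_def triple_map_def s ac_simps triple_eq_0_iff zero_in_triples)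
  show "cone_act w (triple_map x t) = triple_map x (cone_act w t)" if "t \<in> triples V" for t
    using that by (auto elim!: triplesE simp: cone_act_def triple_map_def s)
qed

context
  fixes w' H
  assumes w': "square_zero_action V d w'" and H: "linear_map V V H"
    and Hw: "\<And>y. y \<in> V \<Longrightarrow> H (w y) = w' (H y)"
    and homotopy: "\<And>y. y \<in> V \<Longrightarrow> w' y = w y + d (H y) + H (d y)"
begin

private lemma w'_linear: "linear_map V V w'" and w'_w': "y \<in> V \<Longrightarrow> w' (w' y) = 0"
  and w'_d: "y \<in> V \<Longrightarrow> w' (d y) = d (w' y)"
  using w' by (auto simp: square_zero_action_def)

private lemmas cone_simps_homotopy = cone_simps linear_map_in[OF H] linear_map_add[OF H] linear_map_0[OF V_subspace H]
   linear_map_in[OF w'_linear] linear_map_add[OF w'_linear] linear_map_0[OF V_subspace w'_linear] w'_w' w'_d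

text \<open>On the component uc the two sides differ by wc + w'c + dHc + Hdc, which vanishes by the
  homotopy relation; the other components only use that d commutes with w'.\<close>

private lemma cone_map_diff: "t \<in> triples V \<Longrightarrow> cone_map w' H (cone_diff d w t) = d (cone_map w' H t)"
  using homotopy
  by (auto elim!: triplesE simp: cone_diff_def cone_map_def cone_simps_homotopy ac_simps)

text \<open>On the component uc this is Hw = w'H, and on the component of W it is the square of w'
  being zero.\<close>

lemma cone_map_act: "t \<in> triples V \<Longrightarrow> cone_map w' H (cone_act w t) = w' (cone_map w' H t)"
  by (auto elim!: triplesE simp: cone_act_def cone_map_def cone_simps_homotopy Hw ac_simps)

lemma cone_map_triple_map:
  assumes x: "linear_map V V x" and w'x: "\<And>y. y \<in> V \<Longrightarrow> w' (x y) = x (w' y)"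
    and Hx: "\<And>y. y \<in> V \<Longrightarrow> H (x y) = x (H y)" and t: "t \<in> triples V"
  shows "cone_map w' H (triple_map x t) = x (cone_map w' H t)"
  using t by (auto elim!: triplesE simp: triple_map_def cone_map_def cone_simps_homotopy linear_map_add[OF x] w'x Hx)

text \<open>
  The inclusion of the first summand is a section of the map, and \<open>triple a b c \<mapsto> triple 0 0 b\<close>
  is a homotopy from its composite with the projection \<open>triple a b c \<mapsto> a + w b\<close> to the identity.
\<close>

lemma quasi_iso_cone_map: "quasi_iso_map (triples V) (cone_diff d w) V d (cone_map w' H)"
  unfolding quasi_iso_map_def
proof (intro conjI ballI impI)
  show "linear_map (triples V) V (cone_map w' H)"
    by (auto simp: linear_map_def elim!: triplesE simp: cone_map_def triple_add cone_simps_homotopy ac_simps)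
next
  fix z assume "z \<in> V" "d z = 0"
  then show "\<exists>t\<in>triples V. cone_diff d w t = 0 \<and> (\<exists>b\<in>V. z = cone_map w' H t + d b)"
    by (intro bexI[of _ "triple z 0 0"] conjI bexI[of _ 0])
      (auto simp: cone_diff_def cone_map_def cone_simps_homotopy triple_eq_0_iff zero_in_triples)
next
  fix t e assume t: "t \<in> triples V" and e: "e \<in> V" and z: "cone_diff d w t = 0 \<and> cone_map w' H t = d e"
  then obtain a b c where abc: "t = triple a b c" "a \<in> V" "b \<in> V" "c \<in> V" by (elim triplesE)
  have c: "c = d b" "d a = w c"
    using z abc by (auto simp: cone_diff_def fun_bit_add_eq_0_iff triple_eq_0_iff zero_in_triples)
  \<comment> \<open>The homotopy relation at \<open>b\<close> trades w'b for wb; its term H(db)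
    cancels the term Hc of \<open>cone_map\<close> because c = db.\<close>
  have "a + w b = d (e + H b)"
  proof -
    have "d e = a + w' b + H (d b)" using z abc c by (simp add: cone_map_def)
    also have "\<dots> = a + w b + d (H b)" using homotopy[of b] abc by (simp add: ac_simps)
    finally show ?thesis using e abc by (simp add: cone_simps_homotopy ac_simps)
  qed
  then have "a = w b + d (e + H b)" by (metis add.commute fun_bit_add_left_self)
  \<comment> \<open>Putting \<open>b\<close> in the slot of u produces \<open>b\<close> in the slot
    of W and c = db in the slot of u, together with wb in the first slot, for which e + Hb
    compensates.\<close>
  then have "t = cone_diff d w (triple (e + H b) 0 b)"
    using abc c e by (simp add: cone_diff_def cone_simps_homotopy ac_simps)
  then show "\<exists>s\<in>triples V. t = cone_diff d w s"
    using e abc by (intro bexI[of _ "triple (e + H b) 0 b"]) (auto simp: cone_simps_homotopy)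
qed (use cone_map_diff in auto)

end

end

text \<open>One cone, built from \<open>w\<close> alone, maps to both sides: with H = 0 to the
  module where W acts by \<open>w\<close>, and with the given H to the module where it acts by
  \<open>w'\<close>. In the second part \<open>x\<close> acts componentwise on the cone; both orders
  of the two actions are covered because either basepoint may be the one that moves.\<close>

lemma homotopic_actions:
  fixes V :: "chain set"
  assumes C: "chain_complex V d" and w: "square_zero_action V d w" "square_zero_action V d w'"
    and H: "linear_map V V H"
    and Hw: "\<And>y. y \<in> V \<Longrightarrow> H (w y) = w' (H y)"
    and homotopy: "\<And>y. y \<in> V \<Longrightarrow> w' y = w y + d (H y) + H (d y)"
  shows "quasi_isomorphic F2X (dmod V (F2X_smult w) d) (dmod V (F2X_smult w') d)"
    and "square_zero_action V d x \<Longrightarrow> (\<And>y. y \<in> V \<Longrightarrow> w (x y) = x (w y)) \<Longrightarrow>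
      (\<And>y. y \<in> V \<Longrightarrow> w' (x y) = x (w' y)) \<Longrightarrow> (\<And>y. y \<in> V \<Longrightarrow> H (x y) = x (H y)) \<Longrightarrow>
      quasi_isomorphic F2WX (dmod V (F2WX_smult w x) d) (dmod V (F2WX_smult w' x) d) \<and>
      quasi_isomorphic F2WX (dmod V (F2WX_smult x w) d) (dmod V (F2WX_smult x w') d)"
proof -
  have V: "subspace_F2 V" and d: "linear_map V V d" using C by (auto simp: chain_complex_def)
  have H0: "linear_map V V (\<lambda>_. 0)" by (auto simp: linear_map_def subspace_F2_0[OF V])
  let ?V = "triples V" and ?d = "cone_diff d w" and ?w = "cone_act w"
  let ?f = "cone_map w (\<lambda>_. 0)" and ?f' = "cone_map w' H"
  note cone = chain_complex_cone[OF C w(1)] square_zero_action_cone_act[OF C w(1)]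
  \<comment> \<open>These are the two relations for H in the degenerate case w' = w, H = 0.\<close>
  have hyp0: "0 = w 0" "w y = w y + d 0 + 0" for y
    using w(1) by (auto simp: linear_map_0[OF V] linear_map_0[OF V d] square_zero_action_def)
  have f: "quasi_iso_map ?V ?d V d ?f" by (rule quasi_iso_cone_map[OF C w(1) w(1) H0 hyp0])
  have fw: "\<And>t. t \<in> ?V \<Longrightarrow> ?f (?w t) = w (?f t)" by (rule cone_map_act[OF C w(1) w(1) H0 hyp0])
  have f': "quasi_iso_map ?V ?d V d ?f'" by (rule quasi_iso_cone_map[OF C w(1) w(2) H Hw homotopy])
  have f'w: "\<And>t. t \<in> ?V \<Longrightarrow> ?f' (?w t) = w' (?f' t)" by (rule cone_map_act[OF C w(1) w(2) H Hw homotopy])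
  let ?Q1 = "dmod ?V (F2X_smult ?w) ?d"
  have "quasi_isomorphic F2X ?Q1 (dmod V (F2X_smult w) d)"
    by (rule quasi_isomorphic_F2X[where f = ?f]) (fact cone C w f fw)+
  moreover have "quasi_isomorphic F2X ?Q1 (dmod V (F2X_smult w') d)"
    by (rule quasi_isomorphic_F2X[where f = ?f']) (fact cone C w f' f'w)+
  ultimately show "quasi_isomorphic F2X (dmod V (F2X_smult w) d) (dmod V (F2X_smult w') d)"
    by (meson quasi_isomorphic_sym quasi_isomorphic_trans)
  assume x: "square_zero_action V d x" and wx: "\<And>y. y \<in> V \<Longrightarrow> w (x y) = x (w y)"
    and w'x: "\<And>y. y \<in> V \<Longrightarrow> w' (x y) = x (w' y)" and Hx: "\<And>y. y \<in> V \<Longrightarrow> H (x y) = x (H y)"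
  have lx: "linear_map V V x" using x by (simp add: square_zero_action_def)
  let ?x = "triple_map x"
  have xs: "square_zero_action ?V ?d ?x" "\<And>t. t \<in> ?V \<Longrightarrow> ?w (?x t) = ?x (?w t)"
    using square_zero_action_triple_map[of V d w x] C w(1) x wx by blast+
  have sym: "\<And>t. t \<in> ?V \<Longrightarrow> ?x (?w t) = ?w (?x t)" "\<And>y. y \<in> V \<Longrightarrow> x (w y) = w (x y)"
    "\<And>y. y \<in> V \<Longrightarrow> x (w' y) = w' (x y)"
    using xs(2) wx w'x by metis+
  have fx: "\<And>t. t \<in> ?V \<Longrightarrow> ?f (?x t) = x (?f t)"
    by (rule cone_map_triple_map[OF C w(1) w(1) H0 hyp0 lx wx]) (simp_all only: linear_map_0[OF V lx])
  have f'x: "\<And>t. t \<in> ?V \<Longrightarrow> ?f' (?x t) = x (?f' t)"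
    by (rule cone_map_triple_map[OF C w(1) w(2) H Hw homotopy lx w'x Hx])
  let ?Q = "dmod ?V (F2WX_smult ?w ?x) ?d" and ?Q' = "dmod ?V (F2WX_smult ?x ?w) ?d"
  have "quasi_isomorphic F2WX ?Q (dmod V (F2WX_smult w x) d)"
    by (rule quasi_isomorphic_F2WX[where f = ?f]) (fact cone C w x xs sym wx w'x f fw fx)+
  moreover have "quasi_isomorphic F2WX ?Q (dmod V (F2WX_smult w' x) d)"
    by (rule quasi_isomorphic_F2WX[where f = ?f']) (fact cone C w x xs sym wx w'x f' f'w f'x)+
  moreover have "quasi_isomorphic F2WX ?Q' (dmod V (F2WX_smult x w) d)"
    by (rule quasi_isomorphic_F2WX[where f = ?f]) (fact cone C w x xs sym wx w'x f fw fx)+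
  moreover have "quasi_isomorphic F2WX ?Q' (dmod V (F2WX_smult x w') d)"
    by (rule quasi_isomorphic_F2WX[where f = ?f']) (fact cone C w x xs sym wx w'x f' f'w f'x)+
  ultimately show "quasi_isomorphic F2WX (dmod V (F2WX_smult w x) d) (dmod V (F2WX_smult w' x) d) \<and>
      quasi_isomorphic F2WX (dmod V (F2WX_smult x w) d) (dmod V (F2WX_smult x w') d)"
    by (meson quasi_isomorphic_sym quasi_isomorphic_trans)
qed

section \<open>The Koszul tower\<close>

text \<open>
  A finitely supported sequence is a polynomial in a variable $t$ with coefficients in $V$, and
  \<open>seq_op f g\<close> is $f + tg$. When the kernel of $w$ is its image, the complex $(V[t], d + tw)$ resolves the
  subcomplex $wV$; the automorphism $1 + tH$ intertwines $d + tw$ with $d + tw'$.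
\<close>

definition finite_seqs :: "chain set \<Rightarrow> (nat \<Rightarrow> chain) set"
  where "finite_seqs V = {s. (\<forall>n. s n \<in> V) \<and> (\<exists>N. \<forall>n>N. s n = 0)}"

definition tower :: "chain set \<Rightarrow> chain set"
  where "tower V = pack ` finite_seqs V"

definition seq_op :: "(chain \<Rightarrow> chain) \<Rightarrow> (chain \<Rightarrow> chain) \<Rightarrow> (nat \<Rightarrow> chain) \<Rightarrow> nat \<Rightarrow> chain"
  where "seq_op f g s = (\<lambda>n. f (s n) + (case n of 0 \<Rightarrow> 0 | Suc m \<Rightarrow> g (s m)))"

definition tower_op :: "(chain \<Rightarrow> chain) \<Rightarrow> (chain \<Rightarrow> chain) \<Rightarrow> chain \<Rightarrow> chain"
  where "tower_op f g c = pack (seq_op f g (unpack c))"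

definition single :: "nat \<Rightarrow> chain \<Rightarrow> nat \<Rightarrow> chain"
  where "single N y = (\<lambda>n. if n = N then y else 0)"

lemma finite_seqs_add:
  assumes "subspace_F2 V" "s \<in> finite_seqs V" "t \<in> finite_seqs V"
  shows "(\<lambda>n. s n + t n) \<in> finite_seqs V"
proof -
  obtain N M where "\<forall>n>N. s n = 0" "\<forall>n>M. t n = 0" using assms by (auto simp: finite_seqs_def)
  then have "\<forall>n>max N M. s n + t n = 0" by auto
  moreover have "s n + t n \<in> V" for n using assms by (simp add: finite_seqs_def subspace_F2_add)
  ultimately show ?thesis unfolding finite_seqs_def by blast
qed

lemma seq_op_in:
  assumes V: "subspace_F2 V" and f: "linear_map V V f" and g: "linear_map V V g"
    and s: "s \<in> finite_seqs V"
  shows "seq_op f g s \<in> finite_seqs V"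
proof -
  obtain N where "\<forall>n>N. s n = 0" using s by (auto simp: finite_seqs_def)
  then have "\<forall>n>Suc N. seq_op f g s n = 0"
    by (auto simp: seq_op_def linear_map_0[OF V f] linear_map_0[OF V g] split: nat.splits)
  moreover have "seq_op f g s n \<in> V" for n
    using s by (auto simp: seq_op_def finite_seqs_def linear_map_in[OF f] linear_map_in[OF g]
        subspace_F2_0[OF V] split: nat.splits intro!: subspace_F2_add[OF V])
  ultimately show ?thesis unfolding finite_seqs_def by blast
qed

lemma seq_op_add:
  assumes f: "linear_map V V f" and g: "linear_map V V g"
    and s: "s \<in> finite_seqs V" "t \<in> finite_seqs V"
  shows "seq_op f g (\<lambda>n. s n + t n) = (\<lambda>n. seq_op f g s n + seq_op f g t n)"
proof
  fix n
  have "s n \<in> V" "t n \<in> V" for n using s by (auto simp: finite_seqs_def)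
  then show "seq_op f g (\<lambda>n. s n + t n) n = seq_op f g s n + seq_op f g t n"
    by (cases n) (simp_all add: seq_op_def linear_map_add[OF f] linear_map_add[OF g] add_ac)
qed

lemma tower_op_linear:
  assumes V: "subspace_F2 V" and f: "linear_map V V f" and g: "linear_map V V g"
  shows "linear_map (tower V) (tower V) (tower_op f g)"
  by (auto simp: linear_map_def tower_def tower_op_def seq_op_in[OF assms])
    (simp add: pack_add seq_op_add[OF f g])

lemma zero_in_finite_seqs: "subspace_F2 V \<Longrightarrow> (\<lambda>n. 0) \<in> finite_seqs V"
  unfolding finite_seqs_def using subspace_F2_0 by blast

lemma subspace_F2_tower:
  assumes V: "subspace_F2 V"
  shows "subspace_F2 (tower V)"
proof -
  have "pack (\<lambda>n. 0) \<in> tower V"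
    unfolding tower_def by (rule imageI[OF zero_in_finite_seqs[OF V]])
  then have "0 \<in> tower V" by (simp only: pack_0)
  then show ?thesis
    by (auto simp: subspace_F2_def[of "tower V"]) (auto simp: tower_def pack_add finite_seqs_add[OF V])
qed

text \<open>Comparison of (f + tg)(f' + tg') with (h + tk)(h' + tk') by coefficients: the three
  equations belong to 1, t^2 and t, in this order. The operator identities on the tower below are
  instances, with zero or identity maps filled in where needed.\<close>

lemma seq_op_seq_op_eq:
  assumes V: "subspace_F2 V" and f: "linear_map V V f" and g: "linear_map V V g"
    and f': "linear_map V V f'" and g': "linear_map V V g'"
    and h: "linear_map V V h" and k: "linear_map V V k"
    and h': "linear_map V V h'" and k': "linear_map V V k'"
    and eq: "\<And>y. y \<in> V \<Longrightarrow> f (f' y) = h (h' y)" "\<And>y. y \<in> V \<Longrightarrow> g (g' y) = k (k' y)"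
      "\<And>y. y \<in> V \<Longrightarrow> f (g' y) + g (f' y) = h (k' y) + k (h' y)"
    and s: "s \<in> finite_seqs V"
  shows "seq_op f g (seq_op f' g' s) = seq_op h k (seq_op h' k' s)"
proof
  fix n
  have s: "s n \<in> V" for n using s by (simp add: finite_seqs_def)
  note simps = linear_map_in[OF f'] linear_map_in[OF g'] linear_map_in[OF h'] linear_map_in[OF k']
    linear_map_add[OF f] linear_map_add[OF g] linear_map_add[OF h] linear_map_add[OF k]
    linear_map_0[OF V f] linear_map_0[OF V g] linear_map_0[OF V h] linear_map_0[OF V k]
    subspace_F2_0[OF V] s eq(1,2)
  consider "n = 0" | "n = 1" | m where "n = Suc (Suc m)" by (metis One_nat_def not0_implies_Suc)
  then show "seq_op f g (seq_op f' g' s) n = seq_op h k (seq_op h' k' s) n"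
  proof cases
    case 2
    then show ?thesis using eq(3)[OF s, of 0] by (simp add: seq_op_def simps add.assoc)
  next
    case 3
    have "f (f' (s n)) + (f (g' (s (Suc m))) + g (f' (s (Suc m)))) + g (g' (s m)) =
      h (h' (s n)) + (h (k' (s (Suc m))) + k (h' (s (Suc m)))) + k (k' (s m))"
      using eq s by simp
    then show ?thesis using 3 by (simp add: seq_op_def simps add.assoc)
  qed (simp add: seq_op_def simps)
qed

lemma zero_linear_map: "subspace_F2 V \<Longrightarrow> linear_map V V (\<lambda>_. 0)"
  and id_linear_map: "linear_map V V (\<lambda>y. y)"
  by (auto simp: linear_map_def subspace_F2_0)

lemma seq_op_id: "seq_op (\<lambda>y. y) (\<lambda>_. 0) s = s"
  by (auto simp: seq_op_def split: nat.splits)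

lemma seq_op_zero: "seq_op (\<lambda>_. 0) (\<lambda>_. 0) s = (\<lambda>_. 0)"
  by (auto simp: seq_op_def split: nat.splits)

context
  fixes V :: "chain set" and d w
  assumes C: "chain_complex V d" and w: "square_zero_action V d w"
begin

private lemma V: "subspace_F2 V" and d: "linear_map V V d" and dd: "y \<in> V \<Longrightarrow> d (d y) = 0"
  using C by (auto simp: chain_complex_def)

private lemma lw: "linear_map V V w" and ww: "y \<in> V \<Longrightarrow> w (w y) = 0" and wd: "y \<in> V \<Longrightarrow> w (d y) = d (w y)"
  using w by (auto simp: square_zero_action_def)

private lemma seq_diff_diff: "s \<in> finite_seqs V \<Longrightarrow> seq_op d w (seq_op d w s) = (\<lambda>_. 0)"
  using seq_op_seq_op_eq[OF V d lw d lw zero_linear_map[OF V] zero_linear_map[OF V]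
      zero_linear_map[OF V] zero_linear_map[OF V]]
  by (simp add: dd ww wd seq_op_zero)

lemma chain_complex_tower: "chain_complex (tower V) (tower_op d w)"
  using subspace_F2_tower[OF V] tower_op_linear[OF V d lw]
  by (auto simp: chain_complex_def tower_def tower_op_def seq_diff_diff pack_0)

lemma square_zero_action_tower:
  assumes x: "square_zero_action V d x" and wx: "\<And>y. y \<in> V \<Longrightarrow> w (x y) = x (w y)"
  shows "square_zero_action (tower V) (tower_op d w) (tower_op x (\<lambda>_. 0))"
proof -
  have lx: "linear_map V V x" and xx: "\<And>y. y \<in> V \<Longrightarrow> x (x y) = 0" and xd: "\<And>y. y \<in> V \<Longrightarrow> x (d y) = d (x y)"
    using x by (auto simp: square_zero_action_def)
  note Z = zero_linear_map[OF V]
  have "seq_op x (\<lambda>_. 0) (seq_op x (\<lambda>_. 0) s) = (\<lambda>_. 0)" if "s \<in> finite_seqs V" for s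
    using seq_op_seq_op_eq[OF V lx Z lx Z Z Z Z Z _ _ _ that]
    by (simp add: xx linear_map_0[OF V lx] seq_op_zero)
  moreover have "seq_op x (\<lambda>_. 0) (seq_op d w s) = seq_op d w (seq_op x (\<lambda>_. 0) s)"
    if "s \<in> finite_seqs V" for s
    by (rule seq_op_seq_op_eq[OF V lx Z d lw d lw lx Z _ _ _ that])
      (auto simp: xd wx linear_map_0[OF V d] linear_map_0[OF V lw])
  ultimately show ?thesis
    using tower_op_linear[OF V lx Z]
    by (auto simp: square_zero_action_def tower_def tower_op_def pack_0)
qed

context
  fixes w' H
  assumes w': "square_zero_action V d w'" and H: "linear_map V V H"
    and HH: "\<And>y. y \<in> V \<Longrightarrow> H (H y) = 0"
    and Hw: "\<And>y. y \<in> V \<Longrightarrow> H (w y) = w' (H y)"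
    and homotopy: "\<And>y. y \<in> V \<Longrightarrow> w' y = w y + d (H y) + H (d y)"
begin

private lemma lw': "linear_map V V w'" using w' by (simp add: square_zero_action_def)

text \<open>Since H^2 = 0 in characteristic two, 1 + tH is its own inverse. In (1 + tH)(d + tw) = (d
  + tw')(1 + tH) the coefficient of t is the homotopy relation and that of t^2 is Hw = w'H. So the
  map is an isomorphism of complexes.\<close>

lemma quasi_iso_tower_shift:
  "quasi_iso_map (tower V) (tower_op d w) (tower V) (tower_op d w') (tower_op (\<lambda>y. y) H)"
  unfolding quasi_iso_map_def
proof (intro conjI ballI impI)
  note I = id_linear_map[of V]
  note Z = zero_linear_map[OF V]
  let ?f = "tower_op (\<lambda>y. y) H"
  show lf: "linear_map (tower V) (tower V) ?f" by (rule tower_op_linear[OF V I H])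
  have "seq_op (\<lambda>y. y) H (seq_op (\<lambda>y. y) H s) = s" if "s \<in> finite_seqs V" for s
    using seq_op_seq_op_eq[OF V I H I H I Z I Z _ _ _ that] by (simp add: HH seq_op_id)
  then have ff: "?f (?f t) = t" if "t \<in> tower V" for t
    using that by (auto simp: tower_def tower_op_def)
  have "seq_op (\<lambda>y. y) H (seq_op d w s) = seq_op d w' (seq_op (\<lambda>y. y) H s)"
    if "s \<in> finite_seqs V" for s
    by (rule seq_op_seq_op_eq[OF V I H d lw d lw' I H _ _ _ that])
      (auto simp: Hw homotopy ac_simps)
  then show fd: "?f (tower_op d w t) = tower_op d w' (?f t)" if "t \<in> tower V" for t
    using that by (auto simp: tower_def tower_op_def)
  have ld: "linear_map (tower V) (tower V) (tower_op d w)" "linear_map (tower V) (tower V) (tower_op d w')"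
    by (intro tower_op_linear V d lw lw')+
  have df: "?f (tower_op d w' t) = tower_op d w (?f t)" if "t \<in> tower V" for t
    using fd[of "?f t"] ff that linear_map_in[OF lf] linear_map_in[OF ld(1)] by metis
  have 0: "?f 0 = 0" "tower_op d w' 0 = 0"
    using linear_map_0 lf ld subspace_F2_tower[OF V] by blast+
  show "\<exists>y\<in>tower V. tower_op d w y = 0 \<and> (\<exists>b\<in>tower V. z = ?f y + tower_op d w' b)"
    if "z \<in> tower V" "tower_op d w' z = 0" for z
    using that 0 subspace_F2_0[OF subspace_F2_tower[OF V]]
    by (intro bexI[of _ "?f z"] conjI bexI[of _ 0])
      (auto simp: ff df[symmetric] linear_map_in[OF lf])
  show "\<exists>a\<in>tower V. y = tower_op d w a" if "y \<in> tower V" "b \<in> tower V"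
    "tower_op d w y = 0 \<and> ?f y = tower_op d w' b" for y b
    using that df[of b] ff[of y] by (intro bexI[of _ "?f b"]) (auto simp: linear_map_in[OF lf])
qed

lemma tower_shift_commute:
  assumes x: "linear_map V V x" and Hx: "\<And>y. y \<in> V \<Longrightarrow> H (x y) = x (H y)" and t: "t \<in> tower V"
  shows "tower_op (\<lambda>y. y) H (tower_op x (\<lambda>_. 0) t) = tower_op x (\<lambda>_. 0) (tower_op (\<lambda>y. y) H t)"
proof -
  note I = id_linear_map[of V]
  note Z = zero_linear_map[OF V]
  have "seq_op (\<lambda>y. y) H (seq_op x (\<lambda>_. 0) s) = seq_op x (\<lambda>_. 0) (seq_op (\<lambda>y. y) H s)"
    if "s \<in> finite_seqs V" for s
    by (rule seq_op_seq_op_eq[OF V I H x Z x Z I H _ _ _ that])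
      (auto simp: Hx linear_map_0[OF V H])
  then show ?thesis using t by (auto simp: tower_def tower_op_def)
qed

end

section \<open>The tower as a resolution of the image of an exact action\<close>

context
  assumes exact: "{y \<in> V. w y = 0} = w ` V"
begin

text \<open>Descending induction on the degree: the coefficient of (d + tw)s just above the top one
  of s is w applied to that top coefficient, so by exactness the top coefficient lies in the image
  of w and can be removed by a boundary. Only positive degrees of (d + tw)s are assumed to vanish,
  so that the lemma serves for cycles and also for elements whose boundary sits in degree 0.\<close>

lemma tower_reduce:
  assumes "s \<in> finite_seqs V" "\<forall>n>N. s n = 0" "\<And>n. seq_op d w s (Suc n) = 0"
  shows "\<exists>a\<in>finite_seqs V. \<exists>y\<in>w ` V. (\<lambda>n. s n + seq_op d w a n) = single 0 y"
  using assms
proof (induction N arbitrary: s)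
  case 0
  have s0: "s 0 \<in> V" using 0(1) by (simp add: finite_seqs_def)
  have "seq_op d w s (Suc 0) = d (s (Suc 0)) + w (s 0)" by (simp add: seq_op_def)
  moreover have "s (Suc 0) = 0" using 0(2) by blast
  ultimately have "w (s 0) = 0" using 0(3)[of 0] linear_map_0[OF V d] by (metis add_0_left)
  then have "s 0 \<in> w ` V" using s0 exact by blast
  moreover have "(\<lambda>n. s n + seq_op d w (\<lambda>_. 0) n) = single 0 (s 0)"
  proof
    fix n
    have "seq_op d w (\<lambda>_. 0) n = 0"
      using linear_map_0[OF V d] linear_map_0[OF V lw] by (cases n) (simp_all add: seq_op_def)
    moreover have "s n = single 0 (s 0) n"
      unfolding single_def using 0(2) by (cases "n = 0") auto
    ultimately show "s n + seq_op d w (\<lambda>_. 0) n = single 0 (s 0) n" by simp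
  qed
  ultimately show ?case using zero_in_finite_seqs[OF V] by blast
next
  case (Suc N)
  have sV: "s n \<in> V" for n using Suc(2) by (simp add: finite_seqs_def)
  have "seq_op d w s (Suc (Suc N)) = d (s (Suc (Suc N))) + w (s (Suc N))" by (simp add: seq_op_def)
  moreover have "s (Suc (Suc N)) = 0" using Suc(3) by blast
  ultimately have "w (s (Suc N)) = 0" using Suc(4)[of "Suc N"] linear_map_0[OF V d] by (metis add_0_left)
  then obtain b where b: "b \<in> V" "s (Suc N) = w b" using sV exact by blast
  \<comment> \<open>The correction sits one degree below the term to be removed, because tw raises
    the degree by one.\<close>
  have a0: "single N b \<in> finite_seqs V" using b by (auto simp: single_def finite_seqs_def subspace_F2_0[OF V])
  let ?s = "\<lambda>n. s n + seq_op d w (single N b) n"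
  have s: "?s \<in> finite_seqs V" by (intro finite_seqs_add V Suc.prems seq_op_in d lw a0)
  have "seq_op d w ?s = (\<lambda>n. seq_op d w s n + seq_op d w (seq_op d w (single N b)) n)"
    by (rule seq_op_add[OF d lw Suc.prems(1) seq_op_in[OF V d lw a0]])
  then have "seq_op d w ?s (Suc n) = 0" for n by (simp only: Suc(4) seq_diff_diff[OF a0] add_0_left)
  moreover have "?s n = 0" if "n > N" for n
  proof (cases "n = Suc N")
    case True
    then have "seq_op d w (single N b) n = w b"
      using linear_map_0[OF V d] by (simp add: seq_op_def single_def)
    then show ?thesis using True b(2) by (simp only: fun_bit_add_self)
  next
    case False
    with that obtain m where m: "n = Suc m" "m \<noteq> N" by (cases n) auto
    then have "seq_op d w (single N b) n = 0"
      using linear_map_0[OF V d] linear_map_0[OF V lw] that by (simp add: seq_op_def single_def)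
    moreover have "s n = 0" using Suc(3) that False by (meson not_less_eq linorder_neqE_nat)
    ultimately show ?thesis by (simp only: add_0_left)
  qed
  ultimately obtain a y where a: "a \<in> finite_seqs V" "y \<in> w ` V"
    "(\<lambda>n. ?s n + seq_op d w a n) = single 0 y" using Suc.IH[OF s] by blast
  have "(\<lambda>n. s n + seq_op d w (\<lambda>n. single N b n + a n) n) = single 0 y"
    unfolding a(3)[symmetric] seq_op_add[OF d lw a0 a(1)] by (simp add: ac_simps)
  then show ?case using a finite_seqs_add[OF V a0 a(1)] by blast
qed

text \<open>On constants killed by w the differential d + tw is d. For surjectivity a cycle is
  reduced to degree 0. For injectivity, an element with boundary y in degree 0 is reduced to a
  constant u in the image of w; adding a boundary does not change the boundary, so du = y.\<close>

lemma quasi_iso_tower_inclusion: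
  "quasi_iso_map (w ` V) d (tower V) (tower_op d w) (\<lambda>y. pack (single 0 y))"
  unfolding quasi_iso_map_def
proof (intro conjI ballI impI)
  have wV: "y \<in> V \<and> w y = 0" if "y \<in> w ` V" for y using that exact by blast
  have single_in: "single 0 y \<in> finite_seqs V" if "y \<in> w ` V" for y
    using wV[OF that] by (auto simp: single_def finite_seqs_def subspace_F2_0[OF V])
  show "linear_map (w ` V) (tower V) (\<lambda>y. pack (single 0 y))"
    using single_in by (auto simp: linear_map_def tower_def pack_add single_def intro!: ext)
  have diff_single: "seq_op d w (single 0 y) = single 0 (d y)" if "y \<in> w ` V" for y
    using wV[OF that]
    by (auto simp: seq_op_def single_def linear_map_0[OF V d] linear_map_0[OF V lw] split: nat.splits intro!: ext)
  then show "pack (single 0 (d y)) = tower_op d w (pack (single 0 y))" if "y \<in> w ` V" for y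
    using that by (simp add: tower_op_def)
  show "\<exists>y\<in>w ` V. d y = 0 \<and> (\<exists>b\<in>tower V. z = pack (single 0 y) + tower_op d w b)"
    if z: "z \<in> tower V" "tower_op d w z = 0" for z
  proof -
    obtain s where s: "s \<in> finite_seqs V" "z = pack s" using z by (auto simp: tower_def)
    have ds: "seq_op d w s n = 0" for n
      using z(2) s(2) by (simp add: tower_op_def pack_eq_0_iff)
    obtain N where "\<forall>n>N. s n = 0" using s by (auto simp: finite_seqs_def)
    then obtain a y where a: "a \<in> finite_seqs V" "y \<in> w ` V" "(\<lambda>n. s n + seq_op d w a n) = single 0 y"
      using tower_reduce[OF s(1)] ds by blast
    have "single 0 (d y) = (\<lambda>n. seq_op d w s n + seq_op d w (seq_op d w a) n)"
      unfolding diff_single[OF a(2), symmetric] a(3)[symmetric]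
      by (rule seq_op_add[OF d lw s(1) seq_op_in[OF V d lw a(1)]])
    then have "single 0 (d y) 0 = seq_op d w s 0 + seq_op d w (seq_op d w a) 0" by (rule fun_cong)
    then have "d y = 0" by (simp only: ds seq_diff_diff[OF a(1)] single_def refl if_True add_0_left)
    moreover have "z = pack (single 0 y) + tower_op d w (pack a)"
      unfolding a(3)[symmetric] s tower_op_def pack_add by (simp add: ac_simps)
    ultimately show ?thesis using a by (auto simp: tower_def)
  qed
  show "\<exists>a\<in>w ` V. y = d a" if y: "y \<in> w ` V" "b \<in> tower V"
    "d y = 0 \<and> pack (single 0 y) = tower_op d w b" for y b
  proof -
    obtain s where s: "s \<in> finite_seqs V" "b = pack s" using y by (auto simp: tower_def)
    have ds: "seq_op d w s = single 0 y" using y s by (simp add: tower_op_def)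
    obtain N where "\<forall>n>N. s n = 0" using s by (auto simp: finite_seqs_def)
    moreover have "seq_op d w s (Suc n) = 0" for n by (simp add: ds single_def)
    ultimately obtain a u where a: "a \<in> finite_seqs V" "u \<in> w ` V" "(\<lambda>n. s n + seq_op d w a n) = single 0 u"
      using tower_reduce[OF s(1)] by blast
    have "single 0 (d u) = (\<lambda>n. seq_op d w s n + seq_op d w (seq_op d w a) n)"
      unfolding diff_single[OF a(2), symmetric] a(3)[symmetric]
      by (rule seq_op_add[OF d lw s(1) seq_op_in[OF V d lw a(1)]])
    then have "single 0 (d u) 0 = seq_op d w s 0 + seq_op d w (seq_op d w a) 0" by (rule fun_cong)
    then have "d u = y" by (simp only: ds seq_diff_diff[OF a(1)] single_def refl if_True add_0_right)
    then show ?thesis using a(2) by blast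
  qed
qed

end

end

text \<open>The zig-zag consists of the inclusion into the tower of \<open>w\<close>, the map 1 +
  tH, and the inclusion into the tower of \<open>w'\<close> read backwards. As \<open>x\<close> acts
  on the towers coefficientwise, all three commute with it.\<close>

lemma homotopic_reductions:
  fixes V :: "chain set"
  assumes C: "chain_complex V d" and w: "square_zero_action V d w" "square_zero_action V d w'"
    and x: "square_zero_action V d x"
    and H: "linear_map V V H" "\<And>y. y \<in> V \<Longrightarrow> H (H y) = 0"
    and Hw: "\<And>y. y \<in> V \<Longrightarrow> H (w y) = w' (H y)"
    and homotopy: "\<And>y. y \<in> V \<Longrightarrow> w' y = w y + d (H y) + H (d y)"
    and wx: "\<And>y. y \<in> V \<Longrightarrow> w (x y) = x (w y)" "\<And>y. y \<in> V \<Longrightarrow> w' (x y) = x (w' y)"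
    and Hx: "\<And>y. y \<in> V \<Longrightarrow> H (x y) = x (H y)"
    and exact: "{y \<in> V. w y = 0} = w ` V" "{y \<in> V. w' y = 0} = w' ` V"
    and red: "chain_complex (w ` V) d" "chain_complex (w' ` V) d"
      "square_zero_action (w ` V) d x" "square_zero_action (w' ` V) d x"
  shows "quasi_isomorphic F2X (dmod (w ` V) (F2X_smult x) d) (dmod (w' ` V) (F2X_smult x) d)"
proof -
  have V: "subspace_F2 V" using C by (simp add: chain_complex_def)
  have lx: "linear_map V V x" using x by (simp add: square_zero_action_def)
  let ?x = "tower_op x (\<lambda>_. 0)"
  let ?T = "dmod (tower V) (F2X_smult ?x) (tower_op d w)"
  let ?T' = "dmod (tower V) (F2X_smult ?x) (tower_op d w')"
  note T = chain_complex_tower[OF C w(1)] chain_complex_tower[OF C w(2)]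
  have Tx1: "square_zero_action (tower V) (tower_op d w) ?x"
    by (rule square_zero_action_tower[OF C w(1) x]) (fact wx)
  have Tx2: "square_zero_action (tower V) (tower_op d w') ?x"
    by (rule square_zero_action_tower[OF C w(2) x]) (fact wx)
  have incl: "pack (single 0 (x y)) = ?x (pack (single 0 y))" for y
    by (auto simp: tower_op_def seq_op_def single_def linear_map_0[OF V lx] split: nat.splits intro!: ext)
  have shift: "quasi_iso_map (tower V) (tower_op d w) (tower V) (tower_op d w') (tower_op (\<lambda>y. y) H)"
    by (rule quasi_iso_tower_shift[where V = V and d = d and w = w and w' = w' and H = H])
      (fact C w H Hw homotopy)+
  have shift_x: "tower_op (\<lambda>y. y) H (?x t) = ?x (tower_op (\<lambda>y. y) H t)" if "t \<in> tower V" for t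
    by (rule tower_shift_commute[where V = V and d = d and w = w and w' = w' and H = H and x = x])
      (fact C w H Hw homotopy lx Hx that)+
  note tower_incl = quasi_iso_tower_inclusion[OF C w(1) exact(1)] quasi_iso_tower_inclusion[OF C w(2) exact(2)]
  have "quasi_isomorphic F2X (dmod (w ` V) (F2X_smult x) d) ?T"
    by (rule quasi_isomorphic_F2X[where f = "\<lambda>y. pack (single 0 y)"]) (fact red T Tx1 Tx2 tower_incl | rule incl)+
  moreover have "quasi_isomorphic F2X (dmod (w' ` V) (F2X_smult x) d) ?T'"
    by (rule quasi_isomorphic_F2X[where f = "\<lambda>y. pack (single 0 y)"]) (fact red T Tx1 Tx2 tower_incl | rule incl)+
  moreover have "quasi_isomorphic F2X ?T ?T'"
    by (rule quasi_isomorphic_F2X[where f = "tower_op (\<lambda>y. y) H"]) (fact T Tx1 Tx2 shift shift_x)+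
  ultimately show ?thesis by (meson quasi_isomorphic_sym quasi_isomorphic_trans)
qed

section \<open>Resolutions\<close>

lemma eq_closure_refl [simp]: "(x, x) \<in> eq_closure r"
  by (simp add: eq_closure_def)

lemma eq_closure_trans: "(x, y) \<in> eq_closure r \<Longrightarrow> (y, z) \<in> eq_closure r \<Longrightarrow> (x, z) \<in> eq_closure r"
  by (simp add: eq_closure_def)

lemma eq_closure_sym: "(x, y) \<in> eq_closure r \<Longrightarrow> (y, x) \<in> eq_closure r"
  unfolding eq_closure_def by (meson sym_Un_converse sym_rtrancl symD)

lemma eq_closure_base: "(x, y) \<in> r \<Longrightarrow> (x, y) \<in> eq_closure r"
  by (auto simp: eq_closure_def)

lemma eq_closure_least:
  assumes "r \<subseteq> E" "refl E" "sym E" "trans E"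
  shows "eq_closure r \<subseteq> E"
proof -
  have "r \<union> r\<inverse> \<subseteq> E" using assms(1,3) by (auto dest: symD)
  then have "(r \<union> r\<inverse>)\<^sup>* \<subseteq> E\<^sup>*" by (rule rtrancl_mono)
  also have "E\<^sup>* = E" using assms(2,4)
    by (metis UNIV_I refl_on_def rtrancl_trancl_reflcl sup.absorb1 trancl_id subrelI pair_in_Id_conv)
  finally show ?thesis by (simp add: eq_closure_def)
qed

lemma eq_closure_mono: "r \<subseteq> eq_closure r' \<Longrightarrow> eq_closure r \<subseteq> eq_closure r'"
  by (rule eq_closure_least)
    (auto intro!: reflI symI transI intro: eq_closure_sym eq_closure_trans)

lemma eq_closure_trans': "(x, y) \<in> eq_closure r \<Longrightarrow> (x, z) \<in> eq_closure r \<Longrightarrow> (y, z) \<in> eq_closure r"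
  by (meson eq_closure_sym eq_closure_trans)

abbreviation same_circle :: "pd_code \<Rightarrow> nat set \<Rightarrow> (nat \<times> nat) set"
  where "same_circle D v \<equiv> eq_closure (glue D v)"

definition ccw_arc :: "pd_code \<Rightarrow> nat \<Rightarrow> nat \<Rightarrow> nat"
  where "ccw_arc D k j = arc_at D (k, j)"

text \<open>In either resolution of the crossing, arcs 0 and 2 are on different local strands. The
  condition therefore says that the two strands at \<open>k\<close> lie on different circles,
  whether or not \<open>k\<close> belongs to \<open>v\<close>.\<close>

definition separated :: "pd_code \<Rightarrow> nat set \<Rightarrow> nat \<Rightarrow> bool"
  where "separated D v k \<longleftrightarrow> (ccw_arc D k 0, ccw_arc D k 2) \<notin> same_circle D v"

definition crossing_pairs :: "pd_code \<Rightarrow> nat set \<Rightarrow> nat \<Rightarrow> (nat \<times> nat) set"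
  where "crossing_pairs D v k = (if k \<notin> v
    then {(ccw_arc D k 0, ccw_arc D k 1), (ccw_arc D k 2, ccw_arc D k 3)}
    else {(ccw_arc D k 0, ccw_arc D k 3), (ccw_arc D k 1, ccw_arc D k 2)})"

lemma glue_eq: "glue D v = (\<Union>k<length (crossings D). crossing_pairs D v k)"
  by (auto simp: glue_def crossing_pairs_def ccw_arc_def)

locale diagram =
  fixes D :: pd_code
  assumes link: "link_diagram D"
begin

abbreviation n :: nat where "n \<equiv> length (crossings D)"

lemma ccw_arc_in_arcs: "k < n \<Longrightarrow> j < 4 \<Longrightarrow> ccw_arc D k j \<in> arcs D"
  by (auto simp: ccw_arc_def arcs_def arc_ends_def)

lemma finite_arcs: "finite (arcs D)"
  using link by (auto simp: arcs_def link_diagram_def arc_ends_def)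

lemma glue_in_arcs: "(x, y) \<in> glue D v \<Longrightarrow> x \<in> arcs D \<and> y \<in> arcs D"
  by (auto simp: glue_eq crossing_pairs_def ccw_arc_in_arcs split: if_splits)

lemma same_circle_in_arcs:
  assumes "(x, y) \<in> same_circle D v" "x \<in> arcs D"
  shows "y \<in> arcs D"
  using assms(1) unfolding eq_closure_def
  by (induction rule: rtrancl_induct) (use assms(2) glue_in_arcs in auto)

lemma crossing_pairs_same_circle: "k < n \<Longrightarrow> crossing_pairs D v k \<subseteq> same_circle D v"
  by (auto simp: glue_eq intro!: eq_closure_base)

lemma not_separated_all:
  assumes "k < n" "\<not> separated D v k" "i < 4" "j < 4"
  shows "(ccw_arc D k i, ccw_arc D k j) \<in> same_circle D v"
proof -
  have 02: "(ccw_arc D k 0, ccw_arc D k 2) \<in> same_circle D v"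
    using assms(2) by (simp add: separated_def)
  have "(ccw_arc D k 0, ccw_arc D k 1) \<in> same_circle D v \<and> (ccw_arc D k 0, ccw_arc D k 3) \<in> same_circle D v"
    using crossing_pairs_same_circle[OF assms(1), of v] 02
    by (auto simp: crossing_pairs_def split: if_splits intro: eq_closure_trans eq_closure_sym)
  then have "(ccw_arc D k 0, ccw_arc D k i) \<in> same_circle D v" if "i < 4" for i
    using that 02 by (auto simp: less_Suc_eq numeral_eq_Suc)
  then show ?thesis using assms(3,4) by (meson eq_closure_sym eq_closure_trans)
qed

lemma sum_lessThan_4: "(\<Sum>j<4. f j) = f 0 + f 1 + f 2 + f 3" for f :: "nat \<Rightarrow> nat"
  by (simp add: numeral_eq_Suc)

text \<open>Handshake count: every arc that meets a crossing has two ends, so the ends with arcs in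
  \<open>K\<close> are even in number. A crossing other than \<open>k\<close> contributes an even
  number of them, as its arcs are glued in pairs and \<open>K\<close> respects the gluing; this
  leaves an even contribution at \<open>k\<close>.\<close>

lemma even_ends:
  assumes closed: "\<And>c x y. c < n \<Longrightarrow> c \<noteq> k \<Longrightarrow> (x, y) \<in> crossing_pairs D v c \<Longrightarrow> x \<in> K \<longleftrightarrow> y \<in> K"
    and k: "k < n"
  shows "even (\<Sum>j<4. of_bool (ccw_arc D k j \<in> K) :: nat)"
proof -
  let ?T = "{e \<in> arc_ends D. arc_at D e \<in> K}"
  have fin: "finite (arc_ends D)" by (simp add: arc_ends_def)
  have "card ?T = (\<Sum>a\<in>arc_at D ` ?T. \<Sum>e | e \<in> ?T \<and> arc_at D e = a. 1 :: nat)"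
    using fin by (subst sum.image_gen[of _ _ "arc_at D", symmetric]) auto
  also have "\<dots> = (\<Sum>a\<in>arc_at D ` ?T. 2)"
  proof (intro sum.cong refl)
    fix a assume "a \<in> arc_at D ` ?T"
    then have "{e. e \<in> ?T \<and> arc_at D e = a} = {e \<in> arc_ends D. arc_at D e = a}"
      "a \<in> arc_at D ` arc_ends D" by auto
    then show "(\<Sum>e | e \<in> ?T \<and> arc_at D e = a. 1 :: nat) = 2"
      using link by (auto simp: link_diagram_def)
  qed
  finally have even: "even (card ?T)" by simp
  have "card ?T = (\<Sum>e\<in>arc_ends D. of_bool (arc_at D e \<in> K))"
    using fin by (simp add: sum.inter_filter[symmetric] of_bool_def flip: card_eq_sum)
  also have "\<dots> = (\<Sum>c<n. \<Sum>j<4. of_bool (ccw_arc D c j \<in> K))"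
    unfolding arc_ends_def ccw_arc_def sum.cartesian_product by (rule sum.cong) auto
  also have "\<dots> = (\<Sum>j<4. of_bool (ccw_arc D k j \<in> K)) +
      (\<Sum>c\<in>{..<n} - {k}. \<Sum>j<4. of_bool (ccw_arc D c j \<in> K))"
    using k by (subst sum.remove[of _ k]) auto
  finally have "card ?T = \<dots>" .
  moreover have "even (\<Sum>c\<in>{..<n} - {k}. \<Sum>j<4. of_bool (ccw_arc D c j \<in> K) :: nat)"
  proof (rule dvd_sum)
    fix c assume "c \<in> {..<n} - {k}"
    then show "even (\<Sum>j<4. of_bool (ccw_arc D c j \<in> K) :: nat)"
      using closed[of c "ccw_arc D c 0" "ccw_arc D c 1"] closed[of c "ccw_arc D c 2" "ccw_arc D c 3"]
        closed[of c "ccw_arc D c 0" "ccw_arc D c 3"] closed[of c "ccw_arc D c 1" "ccw_arc D c 2"]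
      unfolding sum_lessThan_4 by (cases "c \<in> v") (auto simp: crossing_pairs_def)
  qed
  ultimately show ?thesis using even by simp
qed

lemma crossing_pairs_eq: "v - {k} = v' - {k} \<Longrightarrow> c \<noteq> k \<Longrightarrow> crossing_pairs D v c = crossing_pairs D v' c"
  by (auto simp: crossing_pairs_def)

text \<open>The relation does not tell which of the two resolutions contains \<open>k\<close>, so
  that each fact about an edge applies to both directions of the cube.\<close>

definition adjacent :: "nat \<Rightarrow> nat set \<Rightarrow> nat set \<Rightarrow> bool"
  where "adjacent k v v' \<longleftrightarrow> k < n \<and> v - {k} = v' - {k} \<and> v \<noteq> v'"

lemma adjacent_sym: "adjacent k v v' \<Longrightarrow> adjacent k v' v"
  by (auto simp: adjacent_def)

text \<open>Let K be the class of arc 0 when nothing is glued at \<open>k\<close>. If the strands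
  were separated in both resolutions, K would contain neither arc 2 nor arc 3, because these are
  glued in the 0-resolution, and not arc 1, which is glued to arc 2 in the 1-resolution. Then
  exactly one end at \<open>k\<close> would lie in K, against parity.\<close>

lemma not_separated_both:
  assumes "adjacent k v v'"
  shows "\<not> (separated D v k \<and> separated D v' k)"
proof -
  have *: False if k: "k < n" "v - {k} = v' - {k}" "k \<notin> v" "k \<in> v'"
    and sep: "separated D v k" "separated D v' k" for v v'
  proof -
    let ?R = "eq_closure (\<Union>c\<in>{..<n} - {k}. crossing_pairs D v c)"
    let ?K = "?R `` {ccw_arc D k 0}"
    have Rv: "?R \<subseteq> same_circle D v"
      by (rule eq_closure_mono) (use crossing_pairs_same_circle in blast)
    have Rv': "?R \<subseteq> same_circle D v'"
      by (rule eq_closure_mono) (use crossing_pairs_same_circle crossing_pairs_eq[OF k(2)] in blast)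
    have cl: "x \<in> ?K \<longleftrightarrow> y \<in> ?K" if "c < n" "c \<noteq> k" "(x, y) \<in> crossing_pairs D v c" for c x y
    proof -
      have "(x, y) \<in> ?R" using that by (intro eq_closure_base) blast
      then show ?thesis by (auto intro: eq_closure_trans eq_closure_sym)
    qed
    have "ccw_arc D k 2 \<notin> ?K" using sep(1) Rv by (auto simp: separated_def)
    moreover have "ccw_arc D k 3 \<notin> ?K"
    proof
      assume "ccw_arc D k 3 \<in> ?K"
      then have "(ccw_arc D k 0, ccw_arc D k 3) \<in> same_circle D v" using Rv by auto
      moreover have "(ccw_arc D k 2, ccw_arc D k 3) \<in> same_circle D v"
        using crossing_pairs_same_circle[OF k(1), of v] k by (auto simp: crossing_pairs_def)
      ultimately show False using sep(1) unfolding separated_def by (meson eq_closure_sym eq_closure_trans)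
    qed
    moreover have "ccw_arc D k 1 \<notin> ?K"
    proof
      assume "ccw_arc D k 1 \<in> ?K"
      then have "(ccw_arc D k 0, ccw_arc D k 1) \<in> same_circle D v'" using Rv' by auto
      moreover have "(ccw_arc D k 1, ccw_arc D k 2) \<in> same_circle D v'"
        using crossing_pairs_same_circle[OF k(1), of v'] k by (auto simp: crossing_pairs_def)
      ultimately show False using sep(2) unfolding separated_def by (meson eq_closure_trans)
    qed
    moreover have "ccw_arc D k 0 \<in> ?K" by simp
    ultimately have "(\<Sum>j<4. of_bool (ccw_arc D k j \<in> ?K) :: nat) = 1"
      unfolding sum_lessThan_4 by simp
    then show False using even_ends[of k v ?K, OF cl k(1)] by simp
  qed
  show ?thesis using *[of v v'] *[of v' v] assms unfolding adjacent_def by blast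
qed

text \<open>If the strands are not separated, all four arcs at \<open>k\<close> already lie on one
  circle, so the other gluing at \<open>k\<close> adds no identification.\<close>

lemma same_circle_mono:
  assumes adj: "adjacent k v v'" and "\<not> separated D v k"
  shows "same_circle D v' \<subseteq> same_circle D v"
proof (rule eq_closure_mono, rule subrelI)
  fix x y assume "(x, y) \<in> glue D v'"
  then obtain c where c: "c < n" "(x, y) \<in> crossing_pairs D v' c" by (auto simp: glue_eq)
  show "(x, y) \<in> same_circle D v"
  proof (cases "c = k")
    case True
    then show ?thesis using c not_separated_all[OF c(1)] assms(2)
      by (auto simp: crossing_pairs_def split: if_splits)
  next
    case False
    then have "crossing_pairs D v' c = crossing_pairs D v c"
      using crossing_pairs_eq[of v' k v c] adj by (auto simp: adjacent_def)
    then show ?thesis using c crossing_pairs_same_circle by blast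
  qed
qed

lemma same_circle_eq:
  assumes "adjacent k v v'" "\<not> separated D v k" "\<not> separated D v' k"
  shows "same_circle D v = same_circle D v'"
  using same_circle_mono assms adjacent_sym by blast

text \<open>The right-hand side is an equivalence relation because \<open>C\<close> is a union of
  classes, and it contains all gluings of \<open>v'\<close>. The converse holds because the strands
  at \<open>k\<close> cannot be separated in \<open>v'\<close> as well.\<close>

lemma same_circle_join:
  assumes adj: "adjacent k v v'" and sep: "separated D v k"
  defines "C \<equiv> same_circle D v `` {ccw_arc D k 0} \<union> same_circle D v `` {ccw_arc D k 2}"
  shows "same_circle D v' = same_circle D v \<union> C \<times> C"
proof
  have k: "k < n" using adj by (simp add: adjacent_def)
  have nsep: "\<not> separated D v' k" using not_separated_both[OF adj] sep by blast
  then have sub: "same_circle D v \<subseteq> same_circle D v'" by (rule same_circle_mono[OF adjacent_sym[OF adj]])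
  have "(ccw_arc D k 0, x) \<in> same_circle D v'" if "x \<in> C" for x
  proof -
    have "(ccw_arc D k 0, ccw_arc D k 2) \<in> same_circle D v'" using nsep by (simp add: separated_def)
    then show ?thesis using that sub unfolding C_def by (auto intro: eq_closure_trans)
  qed
  then show "same_circle D v \<union> C \<times> C \<subseteq> same_circle D v'"
    using sub by (auto intro: eq_closure_trans')
  have Cclosed: "y \<in> C" if "x \<in> C" "(x, y) \<in> same_circle D v" for x y
    using that unfolding C_def by (auto intro: eq_closure_trans)
  show "same_circle D v' \<subseteq> same_circle D v \<union> C \<times> C"
  proof (rule eq_closure_least)
    show "refl (same_circle D v \<union> C \<times> C)" by (auto intro: reflI)
    show "sym (same_circle D v \<union> C \<times> C)" by (auto intro!: symI intro: eq_closure_sym)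
    show "trans (same_circle D v \<union> C \<times> C)"
    proof (rule transI)
      fix x y z
      assume "(x, y) \<in> same_circle D v \<union> C \<times> C" "(y, z) \<in> same_circle D v \<union> C \<times> C"
      then show "(x, z) \<in> same_circle D v \<union> C \<times> C"
        using Cclosed[of y x] Cclosed[of y z] eq_closure_trans[of x y _ z] eq_closure_sym[of x y] by blast
    qed
    \<comment> \<open>Arcs 1 and 3 are glued in \<open>v\<close> to arcs 0 and 2 in one order or the
      other.\<close>
    have arcsC: "ccw_arc D k j \<in> C" if "j < 4" for j
    proof -
      have "j = 0 \<or> j = 1 \<or> j = 2 \<or> j = 3" using that by auto
      then show ?thesis
        using crossing_pairs_same_circle[OF k, of v] unfolding C_def crossing_pairs_def
        by (auto split: if_splits intro: eq_closure_sym)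
    qed
    show "glue D v' \<subseteq> same_circle D v \<union> C \<times> C"
    proof (rule subrelI)
      fix x y assume "(x, y) \<in> glue D v'"
      then obtain c where c: "c < n" "(x, y) \<in> crossing_pairs D v' c" by (auto simp: glue_eq)
      show "(x, y) \<in> same_circle D v \<union> C \<times> C"
      proof (cases "c = k")
        case True
        then show ?thesis using c arcsC by (auto simp: crossing_pairs_def split: if_splits)
      next
        case False
        then have "crossing_pairs D v' c = crossing_pairs D v c"
          using crossing_pairs_eq[of v' k v c] adj by (auto simp: adjacent_def)
        then show ?thesis using c crossing_pairs_same_circle by blast
      qed
    qed
  qed
qed

section \<open>Circles before and after the change of one crossing\<close>

lemma circles_eq_image: "circles D v = circle_at D v ` arcs D"
  by (auto simp: circles_def circle_at_def quotient_def)

lemma in_circle_at: "y \<in> circle_at D v x \<longleftrightarrow> (x, y) \<in> same_circle D v"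
  by (simp add: circle_at_def)

lemma circle_at_eq_iff: "circle_at D v x = circle_at D v y \<longleftrightarrow> (x, y) \<in> same_circle D v"
proof
  assume "circle_at D v x = circle_at D v y"
  then have "y \<in> circle_at D v x" by (simp add: in_circle_at)
  then show "(x, y) \<in> same_circle D v" by (simp add: in_circle_at)
qed (auto simp: in_circle_at intro: eq_closure_trans eq_closure_trans')

lemma circle_eq_circle_at: "Z \<in> circles D v \<Longrightarrow> x \<in> Z \<Longrightarrow> Z = circle_at D v x"
  by (metis circle_at_eq_iff in_circle_at circles_eq_image imageE)

lemma circle_subset_arcs: "Z \<in> circles D v \<Longrightarrow> Z \<subseteq> arcs D"
  by (auto simp: circles_eq_image in_circle_at intro: same_circle_in_arcs)

lemma circle_nonempty: "Z \<in> circles D v \<Longrightarrow> Z \<noteq> {}"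
  by (metis in_circle_at eq_closure_refl empty_iff circles_eq_image imageE)

lemma circle_at_in_circles [simp]: "x \<in> arcs D \<Longrightarrow> circle_at D v x \<in> circles D v"
  by (auto simp: circles_eq_image)

lemma finite_circles: "finite (circles D v)"
  by (simp add: circles_eq_image finite_arcs)

text \<open>The two differences are those that \<open>edge_term\<close> inspects, so this identifies
  the circles to which the merge rule applies; exchanging \<open>v\<close> and \<open>v'\<close>
  gives the circles of a split.\<close>

lemma circles_join:
  assumes adj: "adjacent k v v'" and sep: "separated D v k"
  defines "A \<equiv> circle_at D v (ccw_arc D k 0)" and "B \<equiv> circle_at D v (ccw_arc D k 2)"
  shows "circles D v - circles D v' = {A, B}" "circles D v' - circles D v = {A \<union> B}"
    "A \<noteq> B" "A \<inter> B = {}" "A \<in> circles D v" "B \<in> circles D v" "A \<union> B \<in> circles D v'"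
proof -
  let ?a = "ccw_arc D k 0" and ?b = "ccw_arc D k 2"
  have k: "k < n" using adj by (simp add: adjacent_def)
  have ab: "?a \<in> arcs D" "?b \<in> arcs D" using k by (simp_all add: ccw_arc_in_arcs)
  have nab: "(?a, ?b) \<notin> same_circle D v" using sep by (simp add: separated_def)
  have join: "same_circle D v' = same_circle D v \<union> (A \<union> B) \<times> (A \<union> B)"
    using same_circle_join[OF adj sep] by (simp add: A_def B_def circle_at_def)
  show AB: "A \<noteq> B" using nab by (simp add: A_def B_def circle_at_eq_iff)
  show "A \<inter> B = {}"
    using nab unfolding A_def B_def by (auto simp: in_circle_at) (meson eq_closure_sym eq_closure_trans)
  show A: "A \<in> circles D v" and B: "B \<in> circles D v" using ab by (auto simp: A_def B_def)
  have a: "?a \<in> A" and b: "?b \<in> B" by (simp_all add: A_def B_def in_circle_at)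
  have ABcl: "y \<in> A \<union> B" if "x \<in> A \<union> B" "(x, y) \<in> same_circle D v" for x y
    using that unfolding A_def B_def by (auto simp: in_circle_at intro: eq_closure_trans)
  \<comment> \<open>The remaining claims are read off from this pointwise description.\<close>
  have at': "circle_at D v' x = (if x \<in> A \<union> B then A \<union> B else circle_at D v x)" for x
  proof (cases "x \<in> A \<union> B")
    case True
    then have "y \<in> circle_at D v' x \<longleftrightarrow> y \<in> A \<union> B" for y
      using ABcl[OF True, of y] unfolding in_circle_at join by blast
    then show ?thesis using True by auto
  next
    case False
    then show ?thesis by (auto simp: circle_at_def join)
  qed
  show U: "A \<union> B \<in> circles D v'" using at'[of ?a] a ab circle_at_in_circles[of ?a v'] by simp
  have nU: "A \<union> B \<notin> circles D v"
  proof
    assume "A \<union> B \<in> circles D v"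
    then have "A \<union> B = A" using circle_eq_circle_at[of "A \<union> B" v ?a] a by (auto simp: A_def)
    with b nab show False by (auto simp: A_def in_circle_at)
  qed
  have AB': "A \<notin> circles D v'" "B \<notin> circles D v'"
  proof -
    show "A \<notin> circles D v'"
    proof
      assume "A \<in> circles D v'"
      then have "A = A \<union> B" using circle_eq_circle_at[of A v' ?a] a at'[of ?a] by auto
      with nU A show False by simp
    qed
    show "B \<notin> circles D v'"
    proof
      assume "B \<in> circles D v'"
      then have "B = A \<union> B" using circle_eq_circle_at[of B v' ?b] b at'[of ?b] by auto
      with nU B show False by simp
    qed
  qed
  have "Z \<in> circles D v'" if Z: "Z \<in> circles D v" "Z \<noteq> A" "Z \<noteq> B" for Z
  proof -
    obtain x where x: "x \<in> arcs D" "Z = circle_at D v x" using Z(1) by (auto simp: circles_eq_image)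
    then have "x \<notin> A \<union> B"
      using Z unfolding A_def B_def by (auto simp: in_circle_at circle_at_eq_iff intro: eq_closure_sym)
    then show ?thesis using at'[of x] x circle_at_in_circles[of x v'] by simp
  qed
  then show "circles D v - circles D v' = {A, B}" using A B AB' by blast
  have "Z \<in> circles D v" if Z: "Z \<in> circles D v'" "Z \<noteq> A \<union> B" for Z
    using Z at' by (auto simp: circles_eq_image)
  then show "circles D v' - circles D v = {A \<union> B}" using U nU by blast
qed

lemma circles_eq:
  assumes "adjacent k v v'" "\<not> separated D v k" "\<not> separated D v' k"
  shows "circles D v = circles D v'"
  using same_circle_eq[OF assms] by (simp add: circles_def)

text \<open>The resolution in which the strands are separated has one more circle. Stated
  additively, this covers merges, splits and unchanged circles at once, and the counts can later be
  eliminated by linear arithmetic.\<close>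

lemma card_circles:
  assumes adj: "adjacent k v v'"
  shows "card (circles D v') + of_bool (separated D v k) = card (circles D v) + of_bool (separated D v' k)"
proof -
  have *: "card (circles D v) = Suc (card (circles D v'))" if "adjacent k v v'" "separated D v k" for v v'
  proof -
    note J = circles_join[OF that]
    have "card (circles D v) = card (circles D v \<inter> circles D v') + card (circles D v - circles D v')"
      by (rule card_Int_Diff[OF finite_circles])
    moreover have "card (circles D v') = card (circles D v \<inter> circles D v') + card (circles D v' - circles D v)"
      using card_Int_Diff[OF finite_circles, of v' "circles D v"] by (simp add: Int_commute)
    ultimately show ?thesis using J(1-3) by simp
  qed
  consider "separated D v k" "\<not> separated D v' k" | "\<not> separated D v k" "separated D v' k"
    | "\<not> separated D v k" "\<not> separated D v' k"
    using not_separated_both[OF adj] by blast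
  then show ?thesis
  proof cases
    case 1
    then show ?thesis using *[OF adj 1(1)] by simp
  next
    case 2
    then show ?thesis using *[OF adjacent_sym[OF adj] 2(2)] by simp
  next
    case 3
    then show ?thesis using circles_eq[OF adj 3] by simp
  qed
qed

end

section \<open>Chains as functions of markings\<close>

text \<open>
  Let $E$ be the exterior algebra over the field with two elements on the arcs. The chains over a
  resolution $v$ embed into $E$ as the ideal generated by $\prod (X_a + X_b)$ over a spanning forest of
  the pairs $(a, b)$ glued in $v$: a circle labelled $X$ contributes the product of all its arcs, a circle
  labelled 1 the sum of all products omitting one of its arcs. \<open>marked D c v U\<close> is the coefficient of the
  monomial omitting exactly the arcs in \<open>U\<close>, and \<open>xop a\<close> is multiplication by $X_a$. In this picture a split
  is the inclusion of ideals and a merge is multiplication by $X_a + X_b$, for $a$, $b$ on the two merged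
  circles. As the latter
  vanishes unless the crossing merges, \<open>edge_op\<close> covers both cases.
\<close>

definition partial_transversal :: "pd_code \<Rightarrow> nat set \<Rightarrow> nat set \<Rightarrow> bool"
  where "partial_transversal D v U \<longleftrightarrow> (\<forall>x\<in>U. \<forall>y\<in>U. (x, y) \<in> same_circle D v \<longrightarrow> x = y)"

definition avoided :: "pd_code \<Rightarrow> nat set \<Rightarrow> nat set \<Rightarrow> nat set set"
  where "avoided D v U = {Z \<in> circles D v. Z \<inter> U = {}}"

definition marked :: "pd_code \<Rightarrow> chain \<Rightarrow> nat set \<Rightarrow> nat set \<Rightarrow> bit"
  where "marked D c v U = (if partial_transversal D v U then c (v, avoided D v U) else 0)"

definition xop :: "nat \<Rightarrow> (nat set \<Rightarrow> bit) \<Rightarrow> nat set \<Rightarrow> bit"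
  where "xop a f U = (if a \<in> U then 0 else f (insert a U))"

definition delta :: "pd_code \<Rightarrow> nat \<Rightarrow> (nat set \<Rightarrow> bit) \<Rightarrow> nat set \<Rightarrow> bit"
  where "delta D k f U = xop (ccw_arc D k 0) f U + xop (ccw_arc D k 2) f U"

definition edge_op :: "pd_code \<Rightarrow> nat \<Rightarrow> nat set \<Rightarrow> (nat set \<Rightarrow> bit) \<Rightarrow> nat set \<Rightarrow> bit"
  where "edge_op D k v' f U = delta D k f U + (if separated D v' k then f U else 0)"

definition edge_term :: "pd_code \<Rightarrow> nat set \<Rightarrow> nat set \<Rightarrow> nat set set \<Rightarrow> nat set set \<Rightarrow> bool"
  where "edge_term D v v' S S' \<longleftrightarrow>
    (\<forall>Z \<in> circles D v \<inter> circles D v'. Z \<in> S \<longleftrightarrow> Z \<in> S') \<and>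
    ((\<exists>A B C. A \<noteq> B \<and> circles D v - circles D v' = {A, B} \<and> circles D v' - circles D v = {C} \<and>
        merge_term S S' A B C) \<or>
     (\<exists>A B C. A \<noteq> B \<and> circles D v - circles D v' = {C} \<and> circles D v' - circles D v = {A, B} \<and>
        split_term S S' C A B))"

definition edge :: "pd_code \<Rightarrow> nat set \<Rightarrow> nat set \<Rightarrow> chain \<Rightarrow> nat set set \<Rightarrow> bit"
  where "edge D v v' c S' = (\<Sum>S\<in>Pow (circles D v). if edge_term D v v' S S' then c (v, S) else 0)"

text \<open>\<open>edge_term\<close> looks only at the circles, not at which end is the
  1-resolution, so the same rule defines the edge map against its direction in the cube.\<close>

definition reverse_edge :: "pd_code \<Rightarrow> nat \<Rightarrow> chain \<Rightarrow> chain"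
  where "reverse_edge D k = linear_ext (generators D)
    (\<lambda>(v, S) (v', S'). k \<in> v \<and> v' = v - {k} \<and> edge_term D v v' S S')"

lemma bit_add_self [simp]: "b + b = 0" for b :: bit
  by (cases b) simp_all

lemma bit_add_left_self [simp]: "b + (b + c) = c" for b c :: bit
  by (simp flip: add.assoc)

lemma xop_commute: "xop a (xop b f) U = xop b (xop a f) U"
  by (auto simp: xop_def insert_commute)

lemma xop_xop: "xop a (xop a f) U = 0"
  by (auto simp: xop_def)

lemma xop_add: "xop a (\<lambda>U. f U + g U) U = xop a f U + xop a g U"
  by (simp add: xop_def)

lemma xop_0: "xop a (\<lambda>U. 0) U = 0"
  by (simp add: xop_def)

lemma xop_if: "xop a (\<lambda>U. if P then f U else 0) U = (if P then xop a f U else 0)"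
  by (simp add: xop_def)

lemma xop_edge_op: "edge_op D k v' (xop a f) U = xop a (edge_op D k v' f) U"
  by (simp add: edge_op_def[abs_def] delta_def xop_add xop_if xop_commute[of a])

lemma edge_op_add: "edge_op D k v' (\<lambda>U. f U + g U) U = edge_op D k v' f U + edge_op D k v' g U"
  by (simp add: edge_op_def delta_def xop_add ac_simps)

lemma edge_op_0: "edge_op D k v' (\<lambda>U. 0) U = 0"
  by (simp add: edge_op_def delta_def xop_0)

lemma edge_op_sum: "finite I \<Longrightarrow> edge_op D k v' (\<lambda>U. \<Sum>i\<in>I. f i U) U = (\<Sum>i\<in>I. edge_op D k v' (f i) U)"
  by (induction I rule: finite_induct) (simp_all add: edge_op_add edge_op_0)

lemma edge_op_edge_op:
  "edge_op D l v2 (edge_op D k v1 f) U =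
    delta D l (delta D k f) U + (if separated D v1 k then delta D l f U else 0) +
    (if separated D v2 l then delta D k f U + (if separated D v1 k then f U else 0) else 0)"
  by (simp add: edge_op_def[abs_def] delta_def[abs_def] xop_add xop_if ac_simps)

lemma delta_commute: "delta D l (delta D k f) U = delta D k (delta D l f) U"
  unfolding delta_def[of _ _ "delta _ _ _"]
  by (simp add: delta_def[abs_def] xop_add xop_commute[of _ "ccw_arc D k _"] ac_simps)

lemma delta_delta: "delta D k (delta D k f) U = 0"
  by (simp add: delta_def[abs_def] xop_add xop_xop xop_commute[of _ "ccw_arc D k 0"])

context diagram
begin

text \<open>The formulas for edge maps are available only for markings by arcs of the diagram;
  \<open>edge_op\<close> stays within these because the arcs at a crossing belong to the
  diagram.\<close>

lemma edge_op_cong: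
  assumes "\<And>W. W \<subseteq> arcs D \<Longrightarrow> f W = g W" "U \<subseteq> arcs D" "k < n"
  shows "edge_op D k v' f U = edge_op D k v' g U"
  using assms by (simp add: edge_op_def delta_def xop_def ccw_arc_in_arcs)

text \<open>Adding \<open>a\<close> to \<open>U\<close> either meets a circle twice, which gives 0,
  or removes the circle through \<open>a\<close> from the avoided ones.\<close>

lemma xop_marked:
  "xop a (marked D c v) U =
    (if partial_transversal D v U \<and> (\<forall>x\<in>U. (a, x) \<notin> same_circle D v)
     then c (v, {Z \<in> avoided D v U. a \<notin> Z}) else 0)"
proof (cases "a \<in> U")
  case True
  then show ?thesis by (auto simp: xop_def)
next
  case False
  have "partial_transversal D v (insert a U) \<longleftrightarrow>
      partial_transversal D v U \<and> (\<forall>x\<in>U. (a, x) \<notin> same_circle D v)"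
    using False eq_closure_sym unfolding partial_transversal_def by fast
  moreover have "avoided D v (insert a U) = {Z \<in> avoided D v U. a \<notin> Z}"
    by (auto simp: avoided_def)
  ultimately show ?thesis using False by (simp add: xop_def marked_def)
qed

text \<open>In the exterior algebra, X_a + X_b is a sum of factors X_x + X_y of the generator of the
  ideal of \<open>v\<close>, along a path from a to b. Each of these squares to zero and so kills
  the ideal. In terms of markings, adding a or b to \<open>U\<close> marks the same circle.\<close>

lemma xop_marked_same_circle:
  assumes "(a, b) \<in> same_circle D v"
  shows "xop a (marked D c v) U = xop b (marked D c v) U"
proof -
  have "(a, x) \<in> same_circle D v \<longleftrightarrow> (b, x) \<in> same_circle D v" for x
    using assms by (meson eq_closure_sym eq_closure_trans)
  moreover have "a \<in> Z \<longleftrightarrow> b \<in> Z" if "Z \<in> circles D v" for Z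
    using assms that circle_eq_circle_at[OF that] by (metis eq_closure_sym in_circle_at)
  then have "{Z \<in> avoided D v U. a \<notin> Z} = {Z \<in> avoided D v U. b \<notin> Z}"
    by (auto simp: avoided_def)
  ultimately show ?thesis by (simp add: xop_marked)
qed

lemma delta_marked_eq_0: "\<not> separated D v k \<Longrightarrow> delta D k (marked D c v) U = 0"
  using xop_marked_same_circle by (simp add: delta_def separated_def)

lemma marked_add: "marked D (c + c') v U = marked D c v U + marked D c' v U"
  by (simp add: marked_def)

lemma generators_eq: "generators D = Sigma (Pow {..<n}) (\<lambda>v. Pow (circles D v))"
  by (auto simp: generators_def)

lemma finite_generators: "finite (generators D)"
  by (simp add: generators_eq finite_circles)

text \<open>This is the injectivity of the embedding into the exterior algebra. To recover the
  coefficient of (v, S), mark one chosen arc on each circle outside \<open>S\<close>: the avoided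
  circles are then exactly those of \<open>S\<close>.\<close>

lemma chain_eqI:
  assumes c: "c \<in> chains_on (generators D)" "c' \<in> chains_on (generators D)"
    and eq: "\<And>v U. v \<subseteq> {..<n} \<Longrightarrow> U \<subseteq> arcs D \<Longrightarrow> marked D c v U = marked D c' v U"
  shows "c = c'"
proof
  fix g :: generator
  obtain v S where g: "g = (v, S)" by (cases g)
  show "c g = c' g"
  proof (cases "g \<in> generators D")
    case True
    then have v: "v \<subseteq> {..<n}" and S: "S \<subseteq> circles D v" by (auto simp: g generators_def)
    define r where "r Z = (SOME x. x \<in> Z)" for Z :: "nat set"
    have r: "r Z \<in> Z" if "Z \<in> circles D v" for Z
      using circle_nonempty[OF that] unfolding r_def by (meson ex_in_conv someI)
    define U where "U = r ` (circles D v - S)"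
    have "U \<subseteq> arcs D" using r circle_subset_arcs by (auto simp: U_def)
    moreover have "partial_transversal D v U"
      unfolding partial_transversal_def
    proof (intro ballI impI)
      fix x y assume "x \<in> U" "y \<in> U" and xy: "(x, y) \<in> same_circle D v"
      then obtain Y Z where YZ: "Y \<in> circles D v" "x = r Y" "Z \<in> circles D v" "y = r Z"
        by (auto simp: U_def)
      then have "Y = circle_at D v x" "Z = circle_at D v y"
        using circle_eq_circle_at[OF YZ(1) r] circle_eq_circle_at[OF YZ(3) r] by auto
      then have "Y = Z" using xy by (simp add: circle_at_eq_iff)
      then show "x = y" using YZ by simp
    qed
    moreover have "Z \<inter> U = {} \<longleftrightarrow> Z \<in> S" if Z: "Z \<in> circles D v" for Z
    proof
      assume "Z \<inter> U = {}"
      then show "Z \<in> S" using r[OF Z] Z by (auto simp: U_def)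
    next
      assume "Z \<in> S"
      show "Z \<inter> U = {}"
      proof (rule ccontr)
        assume "Z \<inter> U \<noteq> {}"
        then obtain Y where Y: "Y \<in> circles D v" "Y \<notin> S" "r Y \<in> Z" by (auto simp: U_def)
        then have "Y = Z"
          using circle_eq_circle_at[OF Y(1) r[OF Y(1)]] circle_eq_circle_at[OF Z Y(3)] by simp
        with Y \<open>Z \<in> S\<close> show False by simp
      qed
    qed
    then have "avoided D v U = S" using S by (auto simp: avoided_def)
    ultimately show ?thesis using eq[OF v, of U] by (simp add: marked_def g)
  next
    case False
    then show ?thesis
      using c[unfolded chains_on_def, THEN CollectD, THEN spec, of g] by simp
  qed
qed

section \<open>Basepoint actions and edge maps evaluated on labels\<close>

lemma linear_ext_in_chains: "linear_ext G T c \<in> chains_on G"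
  by (simp add: linear_ext_def chains_on_def)

lemma linear_ext_add: "linear_ext G T (c + c') = linear_ext G T c + linear_ext G T c'"
  by (auto simp: linear_ext_def fun_eq_iff simp flip: sum.distrib intro!: sum.cong)

lemma basepoint_act_eq:
  assumes q: "q \<in> arcs D" and vS: "(v, S') \<in> generators D"
  shows "basepoint_act D q c (v, S') =
    (if circle_at D v q \<in> S' then c (v, S' - {circle_at D v q}) else 0)"
proof -
  let ?C = "circle_at D v q"
  have "dot_term D q g (v, S') \<longleftrightarrow> ?C \<in> S' \<and> g = (v, S' - {?C})" for g
    by (cases g) (auto simp: dot_term_def)
  then have "basepoint_act D q c (v, S') =
      (\<Sum>g\<in>generators D. if g = (v, S' - {?C}) then if ?C \<in> S' then c g else 0 else 0)"
    unfolding basepoint_act_def linear_ext_def by (intro sum.cong refl) (auto simp: vS)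
  also have "\<dots> = (if ?C \<in> S' then c (v, S' - {?C}) else 0)"
    using vS by (subst sum.delta[OF finite_generators]) (auto simp: generators_def)
  finally show ?thesis .
qed

lemma marked_basepoint_act:
  assumes q: "q \<in> arcs D" and v: "v \<subseteq> {..<n}"
  shows "marked D (basepoint_act D q c) v U = xop q (marked D c v) U"
proof -
  let ?C = "circle_at D v q"
  have gen: "(v, avoided D v U) \<in> generators D" using v by (auto simp: generators_def avoided_def)
  have "?C \<in> avoided D v U \<longleftrightarrow> (\<forall>x\<in>U. (q, x) \<notin> same_circle D v)"
    using q by (auto simp: avoided_def in_circle_at)
  moreover have "Z = ?C \<longleftrightarrow> q \<in> Z" if "Z \<in> circles D v" for Z
    using circle_eq_circle_at[OF that, of q] by (auto simp: in_circle_at)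
  then have "avoided D v U - {?C} = {Z \<in> avoided D v U. q \<notin> Z}"
    by (auto simp: avoided_def)
  ultimately show ?thesis unfolding xop_marked by (simp add: marked_def basepoint_act_eq[OF q gen])
qed

text \<open>\<open>P\<close> selects edges of the cube: all forward ones for the differential, the
  backward ones at a single crossing for the homotopy.\<close>

lemma linear_ext_edges:
  assumes vS: "(v', S') \<in> generators D"
  shows "linear_ext (generators D) (\<lambda>(v, S) (v', S'). P v v' \<and> edge_term D v v' S S') c (v', S') =
    (\<Sum>v | v \<subseteq> {..<n} \<and> P v v'. edge D v v' c S')"
proof -
  have "linear_ext (generators D) (\<lambda>(v, S) (v', S'). P v v' \<and> edge_term D v v' S S') c (v', S') =
      (\<Sum>(v, S)\<in>generators D. if P v v' \<and> edge_term D v v' S S' then c (v, S) else 0)"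
    unfolding linear_ext_def by (intro sum.cong refl) (simp add: vS split: prod.split)
  also have "\<dots> = (\<Sum>v\<in>Pow {..<n}. \<Sum>S\<in>Pow (circles D v).
      if P v v' \<and> edge_term D v v' S S' then c (v, S) else 0)"
    unfolding generators_eq by (subst sum.Sigma) (auto simp: finite_circles)
  also have "\<dots> = (\<Sum>v\<in>Pow {..<n}. if P v v' then edge D v v' c S' else 0)"
    by (intro sum.cong refl) (simp add: edge_def)
  also have "\<dots> = (\<Sum>v | v \<subseteq> {..<n} \<and> P v v'. edge D v v' c S')"
    by (simp add: sum.inter_filter[symmetric])
  finally show ?thesis .
qed

lemma khovanov_diff_eq:
  assumes vS: "(v', S') \<in> generators D"
  shows "khovanov_diff D c (v', S') = (\<Sum>k\<in>v'. edge D (v' - {k}) v' c S')"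
proof -
  have "khovanov_term D =
      (\<lambda>(v, S) (v', S'). (\<exists>k<n. k \<notin> v \<and> v' = insert k v) \<and> edge_term D v v' S S')"
    by (auto simp: khovanov_term_def edge_term_def fun_eq_iff)
  then have "khovanov_diff D c (v', S') =
      (\<Sum>v | v \<subseteq> {..<n} \<and> (\<exists>k<n. k \<notin> v \<and> v' = insert k v). edge D v v' c S')"
    unfolding khovanov_diff_def by (simp only: linear_ext_edges[OF vS])
  also have "{v. v \<subseteq> {..<n} \<and> (\<exists>k<n. k \<notin> v \<and> v' = insert k v)} = (\<lambda>k. v' - {k}) ` v'"
    using vS by (auto simp: generators_def image_iff)
  also have "(\<Sum>v\<in>\<dots>. edge D v v' c S') = (\<Sum>k\<in>v'. edge D (v' - {k}) v' c S')"
    by (subst sum.reindex) (auto simp: inj_on_def)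
  finally show ?thesis .
qed

lemma reverse_edge_eq:
  assumes vS: "(v', S') \<in> generators D" and k: "k < n"
  shows "reverse_edge D k c (v', S') = (if k \<notin> v' then edge D (insert k v') v' c S' else 0)"
proof -
  have "reverse_edge D k c (v', S') = (\<Sum>v | v \<subseteq> {..<n} \<and> k \<in> v \<and> v' = v - {k}. edge D v v' c S')"
    unfolding reverse_edge_def using linear_ext_edges[OF vS, of "\<lambda>v v'. k \<in> v \<and> v' = v - {k}"] by simp
  moreover have "{v. v \<subseteq> {..<n} \<and> k \<in> v \<and> v' = v - {k}} = (if k \<notin> v' then {insert k v'} else {})"
    using vS k by (auto simp: generators_def)
  ultimately show ?thesis by simp
qed

text \<open>Multiplication read from the target: X arises from X tensor 1 and from 1 tensor X, while
  1 arises only from 1 tensor 1. The labels \<open>S0\<close> of the untouched circles are the same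
  on both sides.\<close>

lemma edge_merge:
  assumes adj: "adjacent k v v'" and sep: "separated D v k" and S': "S' \<subseteq> circles D v'"
  defines "A \<equiv> circle_at D v (ccw_arc D k 0)" and "B \<equiv> circle_at D v (ccw_arc D k 2)"
  defines "S0 \<equiv> S' \<inter> circles D v"
  shows "edge D v v' c S' =
    (if A \<union> B \<in> S' then c (v, insert A S0) + c (v, insert B S0) else c (v, S0))"
proof -
  note J = circles_join[OF adj sep, folded A_def B_def]
  \<comment> \<open>The existential names in \<open>edge_term\<close> determine the two merged
    circles only up to order, and the merge rule is symmetric in them.\<close>
  have mt: "merge_term S S' A' B' C' \<longleftrightarrow> merge_term S S' A B (A \<union> B)"
    if "{A, B} = {A', B'}" "{A \<union> B} = {C'}" for S A' B' C'
    using that by (auto simp: merge_term_def doubleton_eq_iff)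
  have et: "edge_term D v v' S S' \<longleftrightarrow>
      (\<forall>Z \<in> circles D v \<inter> circles D v'. Z \<in> S \<longleftrightarrow> Z \<in> S') \<and> merge_term S S' A B (A \<union> B)" for S
  proof -
    have "\<not> (\<exists>A' B' C'. A' \<noteq> B' \<and> {A, B} = {C'} \<and> {A \<union> B} = {A', B'} \<and> split_term S S' C' A' B')"
      using J(3) by (metis insertI1 insertI2 singletonD)
    moreover have "(\<exists>A' B' C'. A' \<noteq> B' \<and> {A, B} = {A', B'} \<and> {A \<union> B} = {C'} \<and>
        merge_term S S' A' B' C') \<longleftrightarrow> merge_term S S' A B (A \<union> B)" (is "?l \<longleftrightarrow> ?r")
    proof
      assume ?r
      with J(3) show ?l by (intro exI[of _ A] exI[of _ B] exI[of _ "A \<union> B"]) simp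
    next
      assume ?l
      then obtain A' B' C' where *: "{A, B} = {A', B'}" "{A \<union> B} = {C'}" and t: "merge_term S S' A' B' C'"
        by (elim exE conjE) (rule that)
      from t show ?r by (rule mt[OF *, THEN iffD1])
    qed
    ultimately show ?thesis unfolding edge_term_def J(1,2) by (simp only: simp_thms)
  qed
  have cA: "A \<notin> circles D v'" "B \<notin> circles D v'" "A \<union> B \<notin> circles D v" using J(1,2) by auto
  then have S0: "A \<notin> S0" "B \<notin> S0" "S0 \<subseteq> circles D v \<inter> circles D v'" using S' by (auto simp: S0_def)
  have split: "S = S0 \<union> (S \<inter> {A, B})"
    if "S \<subseteq> circles D v" "\<forall>Z \<in> circles D v \<inter> circles D v'. Z \<in> S \<longleftrightarrow> Z \<in> S'" for S
    using that J(1) S' unfolding S0_def by blast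
  have "{S \<in> Pow (circles D v). edge_term D v v' S S'} =
      (if A \<union> B \<in> S' then {insert A S0, insert B S0} else {S0})" (is "?L = ?R")
  proof
    show "?L \<subseteq> ?R"
    proof
      fix S assume "S \<in> ?L"
      then have S: "S = S0 \<union> (S \<inter> {A, B})" "merge_term S S' A B (A \<union> B)"
        using split[of S] by (auto simp: et)
      show "S \<in> ?R" using S by (cases "A \<in> S"; cases "B \<in> S") (auto simp: merge_term_def)
    qed
    show "?R \<subseteq> ?L" using S0 J(3,5,6) cA by (auto simp: et merge_term_def S0_def)
  qed
  moreover have "insert A S0 \<noteq> insert B S0" using S0 J(3) by blast
  ultimately show ?thesis
    by (simp add: edge_def sum.inter_filter[symmetric] finite_circles)
qed

text \<open>Comultiplication read from the target: X tensor X arises from X, each of X tensor 1 and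
  1 tensor X arises from 1, and 1 tensor 1 is never hit.\<close>

lemma edge_split:
  assumes adj: "adjacent k v v'" and sep: "separated D v' k" and S': "S' \<subseteq> circles D v'"
  defines "A \<equiv> circle_at D v' (ccw_arc D k 0)" and "B \<equiv> circle_at D v' (ccw_arc D k 2)"
  defines "S0 \<equiv> S' \<inter> circles D v"
  shows "edge D v v' c S' =
    (if A \<in> S' \<and> B \<in> S' then c (v, insert (A \<union> B) S0)
     else if A \<in> S' \<or> B \<in> S' then c (v, S0) else 0)"
proof -
  note J = circles_join[OF adjacent_sym[OF adj] sep, folded A_def B_def]
  have st: "split_term S S' C' A' B' \<longleftrightarrow> split_term S S' (A \<union> B) A B"
    if "{A, B} = {A', B'}" "{A \<union> B} = {C'}" for S A' B' C'
    using that by (auto simp: split_term_def doubleton_eq_iff)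
  have et: "edge_term D v v' S S' \<longleftrightarrow>
      (\<forall>Z \<in> circles D v \<inter> circles D v'. Z \<in> S \<longleftrightarrow> Z \<in> S') \<and> split_term S S' (A \<union> B) A B" for S
  proof -
    have "\<not> (\<exists>A' B' C'. A' \<noteq> B' \<and> {A \<union> B} = {A', B'} \<and> {A, B} = {C'} \<and> merge_term S S' A' B' C')"
      using J(3) by (metis insertI1 insertI2 singletonD)
    moreover have "(\<exists>A' B' C'. A' \<noteq> B' \<and> {A \<union> B} = {C'} \<and> {A, B} = {A', B'} \<and>
        split_term S S' C' A' B') \<longleftrightarrow> split_term S S' (A \<union> B) A B" (is "?l \<longleftrightarrow> ?r")
    proof
      assume ?r
      with J(3) show ?l by (intro exI[of _ A] exI[of _ B] exI[of _ "A \<union> B"]) simp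
    next
      assume ?l
      then obtain A' B' C' where *: "{A, B} = {A', B'}" "{A \<union> B} = {C'}" and t: "split_term S S' C' A' B'"
        by (elim exE conjE) (rule that)
      from t show ?r by (rule st[OF *, THEN iffD1])
    qed
    ultimately show ?thesis unfolding edge_term_def J(1,2) by (simp only: simp_thms)
  qed
  have cA: "A \<notin> circles D v" "B \<notin> circles D v" "A \<union> B \<notin> circles D v'" "A \<union> B \<in> circles D v"
    using J(1,2) by auto
  then have S0: "A \<union> B \<notin> S0" "S0 \<subseteq> circles D v \<inter> circles D v'" using S' by (auto simp: S0_def)
  have split: "S = S0 \<union> (S \<inter> {A \<union> B})"
    if "S \<subseteq> circles D v" "\<forall>Z \<in> circles D v \<inter> circles D v'. Z \<in> S \<longleftrightarrow> Z \<in> S'" for S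
    using that J(2) S' unfolding S0_def by blast
  have "{S \<in> Pow (circles D v). edge_term D v v' S S'} =
      (if A \<in> S' \<and> B \<in> S' then {insert (A \<union> B) S0} else if A \<in> S' \<or> B \<in> S' then {S0} else {})"
    (is "?L = ?R")
  proof
    show "?L \<subseteq> ?R"
    proof
      fix S assume "S \<in> ?L"
      then have S: "S = S0 \<union> (S \<inter> {A \<union> B})" "split_term S S' (A \<union> B) A B"
        using split[of S] by (auto simp: et)
      show "S \<in> ?R" using S by (cases "A \<union> B \<in> S") (auto simp: split_term_def split: if_splits)
    qed
    show "?R \<subseteq> ?L" using S0 cA by (auto simp: et split_term_def S0_def split: if_splits)
  qed
  then show ?thesis
    by (simp add: edge_def sum.inter_filter[symmetric] finite_circles)
qed

lemma edge_zero:
  assumes "adjacent k v v'" "\<not> separated D v k" "\<not> separated D v' k"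
  shows "edge D v v' c S' = 0"
  using circles_eq[OF assms] by (simp add: edge_def edge_term_def)

end

section \<open>Commuting faces and the homotopy\<close>

text \<open>The content of a face with corners v00, v10, v01, v11. The flags \<open>sa\<close>,
  \<open>sb\<close>, \<open>sc\<close>, \<open>sd\<close> say that crossing k is separated at these
  corners, and \<open>ta\<close>, \<open>tb\<close>, \<open>tc\<close>, \<open>td\<close> say the
  same for l; \<open>na\<close> to \<open>nd\<close> are the numbers of circles. For a marked chain
  \<open>z\<close>, the values \<open>x\<close>, \<open>y\<close> and \<open>w\<close> stand for
  delta at k, delta at l, and both.\<close>

lemma face_arith:
  fixes w x y z :: bit and na nb nc nd :: nat
  assumes "\<not> (sa \<and> sb)" "\<not> (sc \<and> sd)" "\<not> (ta \<and> tc)" "\<not> (tb \<and> td)"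
    and b: "\<not> sa \<Longrightarrow> x = 0" "\<not> ta \<Longrightarrow> y = 0" and xy: "sa \<Longrightarrow> ta \<Longrightarrow> \<not> sc \<Longrightarrow> x = y"
    and "sa \<Longrightarrow> \<not> ta \<Longrightarrow> \<not> tb" "ta \<Longrightarrow> \<not> sa \<Longrightarrow> \<not> sc"
    and "\<not> ta \<Longrightarrow> \<not> tc \<Longrightarrow> sa = sc" "\<not> sa \<Longrightarrow> \<not> sb \<Longrightarrow> ta = tb"
    and c: "nb + of_bool sa = na + of_bool sb" "nd + of_bool sc = nc + of_bool sd"
     "nc + of_bool ta = na + of_bool tc" "nd + of_bool tb = nb + of_bool td"
  shows "w + (if sb then y else 0) + (if td then x + (if sb then z else 0) else 0) =
    w + (if tc then x else 0) + (if sd then y + (if tc then z else 0) else 0)"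
proof -
  \<comment> \<open>Both ways around the face end with the same number of circles; eliminating the
    four counts leaves this relation between the flags.\<close>
  have c': "of_bool sb + of_bool sc + of_bool td + of_bool ta =
      (of_bool tc + of_bool sd + of_bool sa + of_bool tb :: nat)" using c by linarith
  note B = assms(1-4,8-11)
  \<comment> \<open>The cases are by which crossings are separated at the starting corner; when both
    are, \<open>sc\<close> tells whether the change at l leaves k separated.\<close>
  consider "sa" "ta" "\<not> sc" | "sa" "ta" "sc" | "sa" "\<not> ta" | "\<not> sa" "ta" | "\<not> sa" "\<not> ta" by blast
  then show ?thesis
  proof cases
    case 1
    then have "\<not> sb" "\<not> tc" "td = sd" using B c' by (auto simp: of_bool_def split: if_splits)
    then show ?thesis using xy[OF 1] by simp
  next
    case 2
    then have "\<not> sb" "\<not> tc" "\<not> sd" "\<not> td" using B c' by (auto simp: of_bool_def split: if_splits)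
    then show ?thesis by simp
  next
    case 3
    then have "\<not> sb" "td = tc" "\<not> (sd \<and> tc)" using B c' by (auto simp: of_bool_def split: if_splits)
    then show ?thesis using b 3 by auto
  next
    case 4
    then have "\<not> tc" "sd = sb" "\<not> (td \<and> sb)" using B c' by (auto simp: of_bool_def split: if_splits)
    then show ?thesis using b 4 by auto
  next
    case 5
    then have "(td \<and> sb) = (sd \<and> tc)" using B c' by (auto simp: of_bool_def split: if_splits)
    then show ?thesis using b 5 by auto
  qed
qed

text \<open>The entries at (l, k) and (k, l) cancel in characteristic two.\<close>

lemma sum_off_diagonal_eq_0:
  fixes g :: "'a \<Rightarrow> 'a \<Rightarrow> bit"
  assumes "finite A" "\<And>l k. l \<in> A \<Longrightarrow> k \<in> A \<Longrightarrow> l \<noteq> k \<Longrightarrow> g l k = g k l"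
  shows "(\<Sum>l\<in>A. \<Sum>k\<in>A - {l}. g l k) = 0"
  using assms
proof (induction A rule: finite_induct)
  case (insert a A)
  have "(\<Sum>k\<in>insert a A - {l}. g l k) = g l a + (\<Sum>k\<in>A - {l}. g l k)" if "l \<in> A" for l
  proof -
    have "insert a A - {l} = insert a (A - {l})" using that insert(2) by auto
    then show ?thesis using insert(1,2) by simp
  qed
  then have "(\<Sum>l\<in>A. \<Sum>k\<in>insert a A - {l}. g l k) = (\<Sum>l\<in>A. g l a) + (\<Sum>l\<in>A. \<Sum>k\<in>A - {l}. g l k)"
    by (simp add: sum.distrib)
  moreover have "(\<Sum>l\<in>A. \<Sum>k\<in>A - {l}. g l k) = 0" using insert by simp
  moreover have "(\<Sum>k\<in>insert a A - {a}. g a k) = (\<Sum>l\<in>A. g l a)"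
    using insert(2) by (intro sum.cong) (auto intro!: insert.prems)
  ultimately show ?case using insert(1,2) by simp
qed simp

context diagram
begin

lemma eq_circle_at_iff: "Z \<in> circles D v \<Longrightarrow> Z = circle_at D v a \<longleftrightarrow> a \<in> Z"
  using circle_eq_circle_at[of Z v a] in_circle_at[of a v a] by (metis eq_closure_refl)

text \<open>A transversal meets each circle at most once. After the merge it may therefore meet at
  most one of the two old circles, and the new circle is avoided when both old ones are.\<close>

lemma join_markings:
  assumes adj: "adjacent k v v'" and sep: "separated D v k" and U: "U \<subseteq> arcs D"
  defines "A \<equiv> circle_at D v (ccw_arc D k 0)" and "B \<equiv> circle_at D v (ccw_arc D k 2)"
  shows "partial_transversal D v' U \<longleftrightarrow> partial_transversal D v U \<and> (U \<inter> A = {} \<or> U \<inter> B = {})"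
    and "avoided D v' U \<inter> circles D v = avoided D v U - {A, B}"
    and "avoided D v U \<inter> circles D v' = avoided D v U - {A, B}"
    and "avoided D v' U = (avoided D v U - {A, B}) \<union> (if U \<inter> A = {} \<and> U \<inter> B = {} then {A \<union> B} else {})"
    and "A \<in> avoided D v U \<longleftrightarrow> U \<inter> A = {}" "B \<in> avoided D v U \<longleftrightarrow> U \<inter> B = {}"
    and "A \<union> B \<in> avoided D v' U \<longleftrightarrow> U \<inter> A = {} \<and> U \<inter> B = {}"
proof -
  note J = circles_join[OF adj sep, folded A_def B_def]
  have join: "same_circle D v' = same_circle D v \<union> (A \<union> B) \<times> (A \<union> B)"
    using same_circle_join[OF adj sep] by (simp add: A_def B_def circle_at_def)
  have A: "(x, y) \<in> same_circle D v" if "x \<in> A" "y \<in> A" for x y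
    using that unfolding A_def in_circle_at by (rule eq_closure_trans')
  have B: "(x, y) \<in> same_circle D v" if "x \<in> B" "y \<in> B" for x y
    using that unfolding B_def in_circle_at by (rule eq_closure_trans')
  show "partial_transversal D v' U \<longleftrightarrow> partial_transversal D v U \<and> (U \<inter> A = {} \<or> U \<inter> B = {})"
  proof
    assume pt: "partial_transversal D v' U"
    have "U \<inter> A = {} \<or> U \<inter> B = {}"
    proof (rule ccontr)
      assume "\<not> (U \<inter> A = {} \<or> U \<inter> B = {})"
      then obtain x y where xy: "x \<in> U" "x \<in> A" "y \<in> U" "y \<in> B" by blast
      then have "x = y" using pt join unfolding partial_transversal_def by blast
      with xy J(4) show False by blast
    qed
    then show "partial_transversal D v U \<and> (U \<inter> A = {} \<or> U \<inter> B = {})"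
      using pt join unfolding partial_transversal_def by blast
  next
    assume pt: "partial_transversal D v U \<and> (U \<inter> A = {} \<or> U \<inter> B = {})"
    show "partial_transversal D v' U"
      unfolding partial_transversal_def
    proof (intro ballI impI)
      fix x y assume xy: "x \<in> U" "y \<in> U" "(x, y) \<in> same_circle D v'"
      then have "(x, y) \<in> same_circle D v" using pt A B unfolding join by blast
      then show "x = y" using xy pt unfolding partial_transversal_def by blast
    qed
  qed
  have sub: "circles D v = (circles D v \<inter> circles D v') \<union> {A, B}"
    "circles D v' = (circles D v \<inter> circles D v') \<union> {A \<union> B}"
    "A \<notin> circles D v'" "B \<notin> circles D v'" "A \<union> B \<notin> circles D v"
    using J(1,2) by blast+
  show "avoided D v' U \<inter> circles D v = avoided D v U - {A, B}"
    "avoided D v U \<inter> circles D v' = avoided D v U - {A, B}"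
    using sub unfolding avoided_def by blast+
  show "A \<in> avoided D v U \<longleftrightarrow> U \<inter> A = {}" "B \<in> avoided D v U \<longleftrightarrow> U \<inter> B = {}"
    "A \<union> B \<in> avoided D v' U \<longleftrightarrow> U \<inter> A = {} \<and> U \<inter> B = {}"
    using J(5-7) unfolding avoided_def by blast+
  show "avoided D v' U = (avoided D v U - {A, B}) \<union> (if U \<inter> A = {} \<and> U \<inter> B = {} then {A \<union> B} else {})"
  proof (cases "U \<inter> A = {} \<and> U \<inter> B = {}")
    case True
    then have "A \<union> B \<in> avoided D v' U" using J(7) unfolding avoided_def by blast
    then have "avoided D v' U = (avoided D v U - {A, B}) \<union> {A \<union> B}"
      using sub unfolding avoided_def by blast
    then show ?thesis using True by simp
  next
    case False
    then have "A \<union> B \<notin> avoided D v' U" unfolding avoided_def by blast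
    then have "avoided D v' U = avoided D v U - {A, B}"
      using sub unfolding avoided_def by blast
    then show ?thesis using False by auto
  qed
qed

text \<open>For a merge, if \<open>U\<close> avoids both circles, the two preimages of X give the
  terms of X_a and X_b; if \<open>U\<close> meets one of them, only the term of the other survives;
  if it meets both, everything is 0. For a split, delta vanishes on the source and the coefficient
  is unchanged, since marking at most one of the two new circles marks the old circle at most
  once.\<close>

lemma marked_edge:
  assumes adj: "adjacent k v v'" and U: "U \<subseteq> arcs D"
  shows "(if partial_transversal D v' U then edge D v v' c (avoided D v' U) else 0) =
    edge_op D k v' (marked D c v) U"
proof -
  let ?a = "ccw_arc D k 0" and ?b = "ccw_arc D k 2"
  have av: "avoided D v' U \<subseteq> circles D v'" by (auto simp: avoided_def)
  consider "separated D v k" "\<not> separated D v' k" | "\<not> separated D v k" "separated D v' k"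
    | "\<not> separated D v k" "\<not> separated D v' k"
    using not_separated_both[OF adj] by blast
  then show ?thesis
  proof cases
    case 1
    define A where "A = circle_at D v ?a"
    define B where "B = circle_at D v ?b"
    note J = join_markings[OF adj 1(1) U, folded A_def B_def]
    note AB = circles_join[OF adj 1(1), folded A_def B_def]
    have xa: "xop ?a (marked D c v) U =
        (if partial_transversal D v U \<and> U \<inter> A = {} then c (v, avoided D v U - {A}) else 0)"
    proof -
      have "{Z \<in> avoided D v U. ?a \<notin> Z} = avoided D v U - {A}"
        unfolding A_def using eq_circle_at_iff[of _ v ?a] by (auto simp: avoided_def)
      moreover have "(\<forall>x\<in>U. (?a, x) \<notin> same_circle D v) \<longleftrightarrow> U \<inter> A = {}"
        by (auto simp: A_def in_circle_at)
      ultimately show ?thesis by (simp add: xop_marked)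
    qed
    have xb: "xop ?b (marked D c v) U =
        (if partial_transversal D v U \<and> U \<inter> B = {} then c (v, avoided D v U - {B}) else 0)"
    proof -
      have "{Z \<in> avoided D v U. ?b \<notin> Z} = avoided D v U - {B}"
        unfolding B_def using eq_circle_at_iff[of _ v ?b] by (auto simp: avoided_def)
      moreover have "(\<forall>x\<in>U. (?b, x) \<notin> same_circle D v) \<longleftrightarrow> U \<inter> B = {}"
        by (auto simp: B_def in_circle_at)
      ultimately show ?thesis by (simp add: xop_marked)
    qed
    have rhs: "edge_op D k v' (marked D c v) U =
        (if partial_transversal D v U \<and> U \<inter> A = {} then c (v, avoided D v U - {A}) else 0) +
        (if partial_transversal D v U \<and> U \<inter> B = {} then c (v, avoided D v U - {B}) else 0)"
      using 1(2) by (simp add: edge_op_def delta_def xa xb)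
    have lhs: "edge D v v' c (avoided D v' U) =
        (if U \<inter> A = {} \<and> U \<inter> B = {}
         then c (v, insert A (avoided D v U - {A, B})) + c (v, insert B (avoided D v U - {A, B}))
         else c (v, avoided D v U - {A, B}))"
      using edge_merge[OF adj 1(1) av, of c, folded A_def B_def] by (simp add: J(2,7))
    have "insert A (avoided D v U - {A, B}) = avoided D v U - {B}" if "U \<inter> A = {}"
      using J(5) that AB(3) by auto
    moreover have "insert B (avoided D v U - {A, B}) = avoided D v U - {A}" if "U \<inter> B = {}"
      using J(6) that AB(3) by auto
    moreover have "avoided D v U - {A, B} = avoided D v U - {A}" if "U \<inter> B \<noteq> {}"
      using J(6) that by auto
    moreover have "avoided D v U - {A, B} = avoided D v U - {B}" if "U \<inter> A \<noteq> {}"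
      using J(5) that by auto
    ultimately show ?thesis
      unfolding rhs lhs J(1)
      by (cases "U \<inter> A = {}"; cases "U \<inter> B = {}"; cases "partial_transversal D v U") (simp_all add: add.commute)
  next
    case 2
    define A where "A = circle_at D v' ?a"
    define B where "B = circle_at D v' ?b"
    note J = join_markings[OF adjacent_sym[OF adj] 2(2) U, folded A_def B_def]
    note AB = circles_join[OF adjacent_sym[OF adj] 2(2), folded A_def B_def]
    have rhs: "edge_op D k v' (marked D c v) U = marked D c v U"
      using 2 by (simp add: edge_op_def delta_marked_eq_0)
    have lhs: "edge D v v' c (avoided D v' U) =
        (if U \<inter> A = {} \<and> U \<inter> B = {} then c (v, insert (A \<union> B) (avoided D v' U - {A, B}))
         else if U \<inter> A = {} \<or> U \<inter> B = {} then c (v, avoided D v' U - {A, B}) else 0)"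
      using edge_split[OF adj 2(2) av, of c, folded A_def B_def] by (simp add: J(3,5,6))
    show ?thesis
      unfolding rhs lhs marked_def J(1) J(4) by (auto simp: Un_commute)
  next
    case 3
    then show ?thesis using edge_zero[OF adj 3] by (simp add: edge_op_def delta_marked_eq_0)
  qed
qed

text \<open>The change at \<open>l\<close> joins the strands at \<open>k\<close>, so the two circles
  that meet at \<open>l\<close> are the two that meet at \<open>k\<close>, possibly in the other
  order. Arcs on one circle act alike, so both deltas are the same sum.\<close>

lemma delta_marked_eq:
  assumes adj: "adjacent l v v'" and sep: "separated D v k" "separated D v l" "\<not> separated D v' k"
  shows "delta D k (marked D c v) U = delta D l (marked D c v) U"
proof -
  let ?k0 = "ccw_arc D k 0" and ?k2 = "ccw_arc D k 2" and ?l0 = "ccw_arc D l 0" and ?l2 = "ccw_arc D l 2"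
  have "(?k0, ?k2) \<in> same_circle D v'" "(?k0, ?k2) \<notin> same_circle D v"
    using sep by (auto simp: separated_def)
  then consider "(?l0, ?k0) \<in> same_circle D v" "(?l2, ?k2) \<in> same_circle D v"
    | "(?l2, ?k0) \<in> same_circle D v" "(?l0, ?k2) \<in> same_circle D v"
    unfolding same_circle_join[OF adj sep(2)] by (auto dest: eq_closure_trans')
  then show ?thesis
  proof cases
    case 1
    then show ?thesis unfolding delta_def using xop_marked_same_circle by metis
  next
    case 2
    then show ?thesis unfolding delta_def using xop_marked_same_circle add.commute by metis
  qed
qed

lemma separated_mono: "adjacent k v v' \<Longrightarrow> separated D v k \<Longrightarrow> \<not> separated D v l \<Longrightarrow> \<not> separated D v' l"
  using same_circle_mono[OF adjacent_sym, of k v v'] not_separated_both[of k v v']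
  by (auto simp: separated_def)

lemma separated_cong:
  "adjacent k v v' \<Longrightarrow> \<not> separated D v k \<Longrightarrow> \<not> separated D v' k \<Longrightarrow> separated D v l = separated D v' l"
  using same_circle_eq[of k v v'] by (simp add: separated_def)

text \<open>The composite of the two deltas is symmetric, and the other terms of the expansions are
  governed by the separation flags and the circle counts alone. Only adjacency of the corners is
  assumed, so the edges at \<open>k\<close> may run against the cube, as they do in the
  homotopy.\<close>

lemma face_commute:
  assumes "adjacent k v00 v10" "adjacent l v00 v01" "adjacent l v10 v11" "adjacent k v01 v11"
  shows "edge_op D l v11 (edge_op D k v10 (marked D c v00)) U =
    edge_op D k v11 (edge_op D l v01 (marked D c v00)) U"
proof -
  note adj = assms
  show ?thesis
    unfolding edge_op_edge_op delta_commute[of D k l]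
  proof (rule face_arith[where sa = "separated D v00 k" and sc = "separated D v01 k" and
        ta = "separated D v00 l" and tb = "separated D v10 l" and na = "card (circles D v00)" and
        nb = "card (circles D v10)" and nc = "card (circles D v01)" and nd = "card (circles D v11)"])
    show "\<not> (separated D v00 k \<and> separated D v10 k)" by (rule not_separated_both[OF adj(1)])
    show "\<not> (separated D v01 k \<and> separated D v11 k)" by (rule not_separated_both[OF adj(4)])
    show "\<not> (separated D v00 l \<and> separated D v01 l)" by (rule not_separated_both[OF adj(2)])
    show "\<not> (separated D v10 l \<and> separated D v11 l)" by (rule not_separated_both[OF adj(3)])
    show "delta D k (marked D c v00) U = 0" if "\<not> separated D v00 k"
      by (rule delta_marked_eq_0[OF that])
    show "delta D l (marked D c v00) U = 0" if "\<not> separated D v00 l"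
      by (rule delta_marked_eq_0[OF that])
    show "delta D k (marked D c v00) U = delta D l (marked D c v00) U"
      if "separated D v00 k" "separated D v00 l" "\<not> separated D v01 k"
      by (rule delta_marked_eq[OF adj(2) that])
    show "\<not> separated D v10 l" if "separated D v00 k" "\<not> separated D v00 l"
      by (rule separated_mono[OF adj(1) that])
    show "\<not> separated D v01 k" if "separated D v00 l" "\<not> separated D v00 k"
      by (rule separated_mono[OF adj(2) that])
    show "separated D v00 k = separated D v01 k" if "\<not> separated D v00 l" "\<not> separated D v01 l"
      by (rule separated_cong[OF adj(2) that])
    show "separated D v00 l = separated D v10 l" if "\<not> separated D v00 k" "\<not> separated D v10 k"
      by (rule separated_cong[OF adj(1) that])
  qed (fact card_circles[OF adj(1)] card_circles[OF adj(2)] card_circles[OF adj(3)] card_circles[OF adj(4)])+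
qed

text \<open>If \<open>v\<close> merges along the edge, the only surviving term is delta, which is
  the composite of product and coproduct. Otherwise delta vanishes on chains over \<open>v\<close>,
  and the round trip is 0 as well.\<close>

lemma edge_op_back:
  assumes adj: "adjacent k v v'"
  shows "edge_op D k v (edge_op D k v' (marked D c v)) U = delta D k (marked D c v) U"
  using not_separated_both[OF adj] delta_marked_eq_0[of v k c U]
  by (cases "separated D v k") (auto simp: edge_op_edge_op delta_delta)

text \<open>After a merge the square of delta appears; after a split or no change, delta already
  vanishes on the source. This is the identity (X_a + X_b) H = 0.\<close>

lemma delta_edge_op:
  assumes adj: "adjacent k v v'"
  shows "delta D k (edge_op D k v' (marked D c v)) U = 0"
proof -
  have "delta D k (edge_op D k v' f) U =
      delta D k (delta D k f) U + (if separated D v' k then delta D k f U else 0)" for f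
    by (simp add: edge_op_def[abs_def] delta_def[abs_def] xop_add xop_if ac_simps)
  then show ?thesis
    using not_separated_both[OF adj] delta_marked_eq_0[of v k c U] by (auto simp: delta_delta)
qed

lemma marked_khovanov_diff:
  assumes v: "v \<subseteq> {..<n}" and U: "U \<subseteq> arcs D"
  shows "marked D (khovanov_diff D c) v U = (\<Sum>k\<in>v. edge_op D k v (marked D c (v - {k})) U)"
proof -
  have gen: "(v, avoided D v U) \<in> generators D" using v by (auto simp: generators_def avoided_def)
  have "edge_op D k v (marked D c (v - {k})) U =
      (if partial_transversal D v U then edge D (v - {k}) v c (avoided D v U) else 0)" if "k \<in> v" for k
    by (rule marked_edge[OF _ U, symmetric]) (use v that in \<open>auto simp: adjacent_def\<close>)
  then show ?thesis by (simp add: marked_def[of _ "khovanov_diff D c"] khovanov_diff_eq[OF gen])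
qed

lemma marked_reverse_edge:
  assumes v: "v \<subseteq> {..<n}" and U: "U \<subseteq> arcs D" and k: "k < n"
  shows "marked D (reverse_edge D k c) v U =
    (if k \<notin> v then edge_op D k v (marked D c (insert k v)) U else 0)"
proof -
  have gen: "(v, avoided D v U) \<in> generators D" using v by (auto simp: generators_def avoided_def)
  have "edge_op D k v (marked D c (insert k v)) U =
      (if partial_transversal D v U then edge D (insert k v) v c (avoided D v U) else 0)" if "k \<notin> v"
    by (rule marked_edge[OF _ U, symmetric]) (use v that k in \<open>auto simp: adjacent_def\<close>)
  then show ?thesis by (simp add: marked_def[of _ "reverse_edge D k c"] reverse_edge_eq[OF gen k])
qed

lemma finite_resolution: "v \<subseteq> {..<n} \<Longrightarrow> finite v"
  by (rule finite_subset) auto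

lemma khovanov_diff_khovanov_diff: "khovanov_diff D (khovanov_diff D c) = 0"
proof (rule chain_eqI)
  show "khovanov_diff D (khovanov_diff D c) \<in> chains_on (generators D)"
    by (simp add: khovanov_diff_def linear_ext_in_chains)
  show "0 \<in> chains_on (generators D)" by (simp add: chains_on_def)
  fix v U assume v: "v \<subseteq> {..<n}" and U: "U \<subseteq> arcs D"
  let ?g = "\<lambda>l k. edge_op D l v (edge_op D k (v - {l}) (marked D c (v - {l} - {k}))) U"
  have "marked D (khovanov_diff D (khovanov_diff D c)) v U =
      (\<Sum>l\<in>v. edge_op D l v (marked D (khovanov_diff D c) (v - {l})) U)"
    by (rule marked_khovanov_diff[OF v U])
  also have "\<dots> = (\<Sum>l\<in>v. \<Sum>k\<in>v - {l}. ?g l k)"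
  proof (intro sum.cong refl)
    fix l assume l: "l \<in> v"
    have "edge_op D l v (marked D (khovanov_diff D c) (v - {l})) U =
        edge_op D l v (\<lambda>W. \<Sum>k\<in>v - {l}. edge_op D k (v - {l}) (marked D c (v - {l} - {k})) W) U"
      by (rule edge_op_cong[OF _ U]) (use v l in \<open>auto intro!: marked_khovanov_diff\<close>)
    also have "\<dots> = (\<Sum>k\<in>v - {l}. ?g l k)"
      by (rule edge_op_sum) (use finite_resolution[OF v] in simp)
    finally show "edge_op D l v (marked D (khovanov_diff D c) (v - {l})) U = (\<Sum>k\<in>v - {l}. ?g l k)" .
  qed
  also have "\<dots> = 0"
  proof (rule sum_off_diagonal_eq_0[OF finite_resolution[OF v]])
    fix l k assume lk: "l \<in> v" "k \<in> v" "l \<noteq> k"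
    have "v - {l} - {k} = v - {k} - {l}" by auto
    moreover have "?g l k = edge_op D k v (edge_op D l (v - {k}) (marked D c (v - {l} - {k}))) U"
      by (rule face_commute) (use lk v in \<open>auto simp: adjacent_def\<close>)
    ultimately show "?g l k = ?g k l" by simp
  qed
  finally show "marked D (khovanov_diff D (khovanov_diff D c)) v U = marked D 0 v U"
    by (simp add: marked_def)
qed

text \<open>The homotopy lands in resolutions without \<open>k\<close>. If \<open>k\<close> is in
  \<open>v\<close>, only the round trip along the edge at \<open>k\<close> remains, from dH. If not,
  dH and Hd contain the same faces, which cancel, and the round trip remains from Hd.\<close>

lemma reverse_edge_homotopy:
  assumes k: "k < n" and v: "v \<subseteq> {..<n}" and U: "U \<subseteq> arcs D"
  shows "marked D (khovanov_diff D (reverse_edge D k c)) v U +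
    marked D (reverse_edge D k (khovanov_diff D c)) v U = delta D k (marked D c v) U"
proof (cases "k \<in> v")
  case True
  have "marked D (khovanov_diff D (reverse_edge D k c)) v U =
      (\<Sum>l\<in>v. edge_op D l v (marked D (reverse_edge D k c) (v - {l})) U)"
    by (rule marked_khovanov_diff[OF v U])
  also have "\<dots> = edge_op D k v (marked D (reverse_edge D k c) (v - {k})) U +
      (\<Sum>l\<in>v - {k}. edge_op D l v (marked D (reverse_edge D k c) (v - {l})) U)"
    using True by (rule sum.remove[OF finite_resolution[OF v]])
  also have "(\<Sum>l\<in>v - {k}. edge_op D l v (marked D (reverse_edge D k c) (v - {l})) U) = 0"
  proof (intro sum.neutral ballI)
    fix l assume l: "l \<in> v - {k}"
    have "edge_op D l v (marked D (reverse_edge D k c) (v - {l})) U = edge_op D l v (\<lambda>W. 0) U"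
    proof (rule edge_op_cong[OF _ U])
      fix W assume "W \<subseteq> arcs D"
      moreover have "v - {l} \<subseteq> {..<n}" using v by auto
      ultimately show "marked D (reverse_edge D k c) (v - {l}) W = 0"
        using marked_reverse_edge[OF _ _ k] True l by simp
    qed (use v l in auto)
    then show "edge_op D l v (marked D (reverse_edge D k c) (v - {l})) U = 0" by (simp add: edge_op_0)
  qed
  also have "edge_op D k v (marked D (reverse_edge D k c) (v - {k})) U =
      edge_op D k v (edge_op D k (v - {k}) (marked D c v)) U"
  proof (rule edge_op_cong[OF _ U k])
    fix W assume "W \<subseteq> arcs D"
    then have "marked D (reverse_edge D k c) (v - {k}) W =
        edge_op D k (v - {k}) (marked D c (insert k (v - {k}))) W"
      using v by (subst marked_reverse_edge[OF _ _ k]) auto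
    then show "marked D (reverse_edge D k c) (v - {k}) W = edge_op D k (v - {k}) (marked D c v) W"
      using True by (simp add: insert_absorb)
  qed
  also have "\<dots> = delta D k (marked D c v) U"
    by (rule edge_op_back) (use True k in \<open>auto simp: adjacent_def\<close>)
  finally show ?thesis using True by (simp add: marked_reverse_edge[OF v U k])
next
  case False
  let ?u = "insert k v"
  have u: "?u \<subseteq> {..<n}" using v k by auto
  let ?g = "\<lambda>l. edge_op D l v (edge_op D k (v - {l}) (marked D c (insert k (v - {l})))) U"
  have "marked D (khovanov_diff D (reverse_edge D k c)) v U =
      (\<Sum>l\<in>v. edge_op D l v (marked D (reverse_edge D k c) (v - {l})) U)"
    by (rule marked_khovanov_diff[OF v U])
  also have "\<dots> = (\<Sum>l\<in>v. ?g l)"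
  proof (intro sum.cong refl edge_op_cong[OF _ U])
    fix l W assume "l \<in> v" "W \<subseteq> arcs D"
    then show "marked D (reverse_edge D k c) (v - {l}) W =
        edge_op D k (v - {l}) (marked D c (insert k (v - {l}))) W"
      using v False by (subst marked_reverse_edge[OF _ _ k]) auto
  qed (use v in auto)
  finally have 1: "marked D (khovanov_diff D (reverse_edge D k c)) v U = (\<Sum>l\<in>v. ?g l)" .
  have "marked D (reverse_edge D k (khovanov_diff D c)) v U =
      edge_op D k v (marked D (khovanov_diff D c) ?u) U"
    using False by (simp add: marked_reverse_edge[OF v U k])
  also have "\<dots> = edge_op D k v (\<lambda>W. \<Sum>l\<in>?u. edge_op D l ?u (marked D c (?u - {l})) W) U"
    by (rule edge_op_cong[OF _ U k]) (rule marked_khovanov_diff[OF u])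
  also have "\<dots> = (\<Sum>l\<in>?u. edge_op D k v (edge_op D l ?u (marked D c (?u - {l}))) U)"
    by (rule edge_op_sum[OF finite_resolution[OF u]])
  also have "\<dots> = edge_op D k v (edge_op D k ?u (marked D c v)) U +
      (\<Sum>l\<in>v. edge_op D k v (edge_op D l ?u (marked D c (?u - {l}))) U)"
    using False finite_resolution[OF v] by (simp add: insert_Diff_if)
  also have "(\<Sum>l\<in>v. edge_op D k v (edge_op D l ?u (marked D c (?u - {l}))) U) = (\<Sum>l\<in>v. ?g l)"
  proof (intro sum.cong refl)
    fix l assume l: "l \<in> v"
    have eq: "?u - {l} = insert k (v - {l})" using l False by auto
    show "edge_op D k v (edge_op D l ?u (marked D c (?u - {l}))) U = ?g l"
      unfolding eq by (rule face_commute) (use l False v k in \<open>auto simp: adjacent_def\<close>)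
  qed
  also have "edge_op D k v (edge_op D k ?u (marked D c v)) U = delta D k (marked D c v) U"
    by (rule edge_op_back) (use False k in \<open>auto simp: adjacent_def\<close>)
  finally have 2: "marked D (reverse_edge D k (khovanov_diff D c)) v U =
      delta D k (marked D c v) U + (\<Sum>l\<in>v. ?g l)" .
  show ?thesis unfolding 1 2 by (simp add: add.left_commute add.commute)
qed

end

section \<open>Moving a basepoint through a crossing\<close>

lemma chain_complex_image:
  assumes C: "chain_complex V d" and w: "square_zero_action V d w"
  shows "chain_complex (w ` V) d"
proof -
  have lw: "linear_map V V w" and ld: "linear_map V V d" and V: "subspace_F2 V"
    using C w by (auto simp: chain_complex_def square_zero_action_def)
  have "subspace_F2 (w ` V)"
    unfolding subspace_F2_def
  proof (intro conjI ballI)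
    show "0 \<in> w ` V" using linear_map_0[OF V lw] subspace_F2_0[OF V] by (metis imageI)
    show "x + y \<in> w ` V" if "x \<in> w ` V" "y \<in> w ` V" for x y
      using that linear_map_add[OF lw, symmetric] subspace_F2_add[OF V] by auto
  qed
  moreover have "linear_map (w ` V) (w ` V) d"
    unfolding linear_map_def
  proof (intro conjI ballI)
    show "d x \<in> w ` V" if x: "x \<in> w ` V" for x
    proof -
      obtain y where y: "y \<in> V" "x = w y" using x by blast
      then have "d x = w (d y)" using w by (simp add: square_zero_action_def)
      then show ?thesis using linear_map_in[OF ld y(1)] by simp
    qed
    show "d (x + y) = d x + d y" if "x \<in> w ` V" "y \<in> w ` V" for x y
      using that linear_map_add[OF ld] linear_map_in[OF lw] by auto
  qed
  moreover have "d (d y) = 0" if "y \<in> w ` V" for y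
    using that C linear_map_in[OF lw] by (auto simp: chain_complex_def)
  ultimately show ?thesis by (simp add: chain_complex_def)
qed

lemma linear_map_image:
  assumes w: "linear_map V V w" and f: "linear_map V V f" and fw: "\<And>y. y \<in> V \<Longrightarrow> f (w y) = w (f y)"
  shows "linear_map (w ` V) (w ` V) f"
  unfolding linear_map_def
proof (intro conjI ballI)
  show "f x \<in> w ` V" if x: "x \<in> w ` V" for x
  proof -
    obtain y where y: "y \<in> V" "x = w y" using x by blast
    then show ?thesis using fw[OF y(1)] linear_map_in[OF f y(1)] by simp
  qed
  show "f (x + y) = f x + f y" if "x \<in> w ` V" "y \<in> w ` V" for x y
    using that linear_map_add[OF f] linear_map_in[OF w] by auto
qed

lemma square_zero_action_image:
  assumes w: "square_zero_action V d w" and x: "square_zero_action V d x"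
    and xw: "\<And>y. y \<in> V \<Longrightarrow> x (w y) = w (x y)"
  shows "square_zero_action (w ` V) d x"
proof -
  have lw: "linear_map V V w" and lx: "linear_map V V x"
    using w x by (auto simp: square_zero_action_def)
  have "x (x y) = 0 \<and> x (d y) = d (x y)" if "y \<in> w ` V" for y
    using that x linear_map_in[OF lw] by (auto simp: square_zero_action_def)
  then show ?thesis using linear_map_image[OF lw lx xw] by (simp add: square_zero_action_def)
qed

section \<open>Basepoint actions and the homotopy on the Khovanov complex\<close>

context diagram
begin

abbreviation V :: "chain set" where "V \<equiv> chains_on (generators D)"

lemma subspace_V: "subspace_F2 V"
  by (simp add: subspace_F2_def chains_on_def)

lemma linear_map_linear_ext: "linear_map V V (linear_ext (generators D) T)"
  by (simp add: linear_map_def linear_ext_in_chains linear_ext_add)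

lemma linear_maps:
  "linear_map V V (khovanov_diff D)" "linear_map V V (basepoint_act D q)" "linear_map V V (reverse_edge D k)"
  by (simp_all only: khovanov_diff_def basepoint_act_def reverse_edge_def linear_map_linear_ext)

lemma images_in_V:
  "khovanov_diff D c \<in> V" "basepoint_act D q c \<in> V" "reverse_edge D k c \<in> V"
  by (simp_all only: khovanov_diff_def basepoint_act_def reverse_edge_def linear_ext_in_chains)

lemma chain_complex_khovanov: "chain_complex V (khovanov_diff D)"
  by (simp add: chain_complex_def subspace_V linear_maps khovanov_diff_khovanov_diff)

lemma xop_cong:
  assumes "\<And>W. W \<subseteq> arcs D \<Longrightarrow> f W = g W" "U \<subseteq> arcs D" "a \<in> arcs D"
  shows "xop a f U = xop a g U"
  using assms by (simp add: xop_def)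

lemma basepoint_act_commute:
  assumes "p \<in> arcs D" "q \<in> arcs D"
  shows "basepoint_act D p (basepoint_act D q c) = basepoint_act D q (basepoint_act D p c)"
proof (rule chain_eqI)
  fix v U assume v: "v \<subseteq> {..<n}"
  have "marked D (basepoint_act D r c) v = xop r (marked D c v)" if "r \<in> arcs D" for r c
    by (rule ext) (rule marked_basepoint_act[OF that v])
  then show "marked D (basepoint_act D p (basepoint_act D q c)) v U =
      marked D (basepoint_act D q (basepoint_act D p c)) v U"
    using assms by (simp add: xop_commute[of p])
qed (simp_all add: images_in_V)

lemma basepoint_act_square:
  assumes "q \<in> arcs D"
  shows "basepoint_act D q (basepoint_act D q c) = 0"
proof (rule chain_eqI)
  fix v U assume v: "v \<subseteq> {..<n}"
  have "marked D (basepoint_act D q c) v = xop q (marked D c v)" for c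
    by (rule ext) (rule marked_basepoint_act[OF assms v])
  then show "marked D (basepoint_act D q (basepoint_act D q c)) v U = marked D 0 v U"
    by (simp add: xop_xop marked_def[of D 0])
qed (simp_all add: images_in_V subspace_F2_0[OF subspace_V])

lemma basepoint_act_khovanov_diff:
  assumes q: "q \<in> arcs D"
  shows "basepoint_act D q (khovanov_diff D c) = khovanov_diff D (basepoint_act D q c)"
proof (rule chain_eqI)
  fix v U assume v: "v \<subseteq> {..<n}" and U: "U \<subseteq> arcs D"
  have "marked D (basepoint_act D q c) (v - {k}) = xop q (marked D c (v - {k}))" for k
    by (rule ext) (rule marked_basepoint_act[OF q], use v in auto)
  then have "marked D (khovanov_diff D (basepoint_act D q c)) v U =
      (\<Sum>k\<in>v. xop q (edge_op D k v (marked D c (v - {k}))) U)"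
    by (simp add: marked_khovanov_diff[OF v U] xop_edge_op)
  also have "\<dots> = xop q (\<lambda>W. \<Sum>k\<in>v. edge_op D k v (marked D c (v - {k})) W) U"
    by (simp add: xop_def)
  also have "\<dots> = xop q (marked D (khovanov_diff D c) v) U"
    by (rule xop_cong[OF _ U q]) (rule marked_khovanov_diff[OF v, symmetric])
  finally show "marked D (basepoint_act D q (khovanov_diff D c)) v U =
      marked D (khovanov_diff D (basepoint_act D q c)) v U"
    by (simp add: marked_basepoint_act[OF q v])
qed (simp_all add: images_in_V)

lemma reverse_edge_basepoint_act:
  assumes q: "q \<in> arcs D" and k: "k < n"
  shows "reverse_edge D k (basepoint_act D q c) = basepoint_act D q (reverse_edge D k c)"
proof (rule chain_eqI)
  fix v U assume v: "v \<subseteq> {..<n}" and U: "U \<subseteq> arcs D"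
  have "marked D (basepoint_act D q c) (insert k v) = xop q (marked D c (insert k v))"
    by (rule ext) (rule marked_basepoint_act[OF q], use v k in auto)
  then have "marked D (reverse_edge D k (basepoint_act D q c)) v U =
      xop q (\<lambda>W. if k \<notin> v then edge_op D k v (marked D c (insert k v)) W else 0) U"
    by (simp add: marked_reverse_edge[OF v U k] xop_edge_op xop_def)
  also have "\<dots> = xop q (marked D (reverse_edge D k c) v) U"
    by (rule xop_cong[OF _ U q]) (rule marked_reverse_edge[OF v _ k, symmetric])
  finally show "marked D (reverse_edge D k (basepoint_act D q c)) v U =
      marked D (basepoint_act D q (reverse_edge D k c)) v U"
    by (simp add: marked_basepoint_act[OF q v])
qed (simp_all add: images_in_V)

lemma reverse_edge_reverse_edge:
  assumes k: "k < n"
  shows "reverse_edge D k (reverse_edge D k c) = 0"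
proof (rule chain_eqI)
  fix v U assume v: "v \<subseteq> {..<n}" and U: "U \<subseteq> arcs D"
  have "edge_op D k v (marked D (reverse_edge D k c) (insert k v)) U = edge_op D k v (\<lambda>W. 0) U"
    by (rule edge_op_cong[OF _ U k]) (use v k in \<open>simp add: marked_reverse_edge\<close>)
  then show "marked D (reverse_edge D k (reverse_edge D k c)) v U = marked D 0 v U"
    by (simp add: marked_reverse_edge[OF v U k] edge_op_0 marked_def[of D 0])
qed (simp_all add: images_in_V subspace_F2_0[OF subspace_V])

text \<open>Each resolution glues arcs 1 and 3 to arcs 0 and 2 in some order, and glued arcs act
  alike. Hence both strands through the crossing share one homotopy.\<close>

lemma xop_strand:
  assumes k: "k < n" and j: "j < 4"
  shows "xop (ccw_arc D k j) (marked D c v) U + xop (ccw_arc D k ((j + 2) mod 4)) (marked D c v) U =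
    delta D k (marked D c v) U"
proof -
  have *: "xop (ccw_arc D k 1) (marked D c v) U + xop (ccw_arc D k 3) (marked D c v) U =
      delta D k (marked D c v) U"
  proof (cases "k \<in> v")
    case True
    then have "(ccw_arc D k 0, ccw_arc D k 3) \<in> same_circle D v" "(ccw_arc D k 1, ccw_arc D k 2) \<in> same_circle D v"
      using crossing_pairs_same_circle[OF k, of v] by (auto simp: crossing_pairs_def)
    from this[THEN xop_marked_same_circle] show ?thesis by (simp add: delta_def add.commute)
  next
    case False
    then have "(ccw_arc D k 0, ccw_arc D k 1) \<in> same_circle D v" "(ccw_arc D k 2, ccw_arc D k 3) \<in> same_circle D v"
      using crossing_pairs_same_circle[OF k, of v] by (auto simp: crossing_pairs_def)
    from this[THEN xop_marked_same_circle] show ?thesis by (simp add: delta_def)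
  qed
  have mod4: "((0::nat) + 2) mod 4 = 2" "((1::nat) + 2) mod 4 = 3" "((2::nat) + 2) mod 4 = 0"
    "((3::nat) + 2) mod 4 = 1"
    by simp_all
  consider "j = 0" | "j = 1" | "j = 2" | "j = 3" using j by linarith
  then show ?thesis
  proof cases
    case 1
    then show ?thesis by (simp only: mod4 delta_def)
  next
    case 2
    then show ?thesis using * by (simp only: mod4)
  next
    case 3
    then show ?thesis by (simp only: mod4 delta_def add.commute)
  next
    case 4
    show ?thesis unfolding 4 mod4(4) *[symmetric] by (rule add.commute)
  qed
qed

text \<open>The first identity is the round-trip formula, with delta rewritten as X_a + X_b. For the
  second, H commutes with X_a, so it remains to see that X_a + X_b vanishes on the image of
  H.\<close>

lemma strand_homotopy:
  assumes k: "k < n" and j: "j < 4"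
  defines "a \<equiv> ccw_arc D k j" and "b \<equiv> ccw_arc D k ((j + 2) mod 4)"
  shows "basepoint_act D b c = basepoint_act D a c + khovanov_diff D (reverse_edge D k c) +
      reverse_edge D k (khovanov_diff D c)"
    and "reverse_edge D k (basepoint_act D a c) = basepoint_act D b (reverse_edge D k c)"
proof -
  have ab: "a \<in> arcs D" "b \<in> arcs D" using k j by (simp_all add: a_def b_def ccw_arc_in_arcs)
  show "basepoint_act D b c = basepoint_act D a c + khovanov_diff D (reverse_edge D k c) +
      reverse_edge D k (khovanov_diff D c)"
  proof (rule chain_eqI)
    fix v U assume v: "v \<subseteq> {..<n}" and U: "U \<subseteq> arcs D"
    have "xop a (marked D c v) U + xop b (marked D c v) U = delta D k (marked D c v) U"
      unfolding a_def b_def by (rule xop_strand[OF k j])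
    then have "xop b (marked D c v) U = xop a (marked D c v) U + delta D k (marked D c v) U"
      by (metis bit_add_left_self)
    then show "marked D (basepoint_act D b c) v U = marked D (basepoint_act D a c +
        khovanov_diff D (reverse_edge D k c) + reverse_edge D k (khovanov_diff D c)) v U"
      by (simp only: marked_add marked_basepoint_act[OF ab(1) v] marked_basepoint_act[OF ab(2) v]
          reverse_edge_homotopy[OF k v U] add.assoc)
  qed (simp_all add: images_in_V subspace_F2_add[OF subspace_V])
  show "reverse_edge D k (basepoint_act D a c) = basepoint_act D b (reverse_edge D k c)"
    unfolding reverse_edge_basepoint_act[OF ab(1) k]
  proof (rule chain_eqI)
    fix v U assume v: "v \<subseteq> {..<n}" and U: "U \<subseteq> arcs D"
    let ?f = "marked D (reverse_edge D k c) v"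
    have "delta D k ?f U = 0"
    proof (cases "k \<in> v")
      case True
      then have "?f W = 0" if "W \<subseteq> arcs D" for W using marked_reverse_edge[OF v that k] by simp
      then show ?thesis using U k by (simp add: delta_def xop_def ccw_arc_in_arcs)
    next
      case False
      then have eq: "?f W = edge_op D k v (marked D c (insert k v)) W" if "W \<subseteq> arcs D" for W
        using marked_reverse_edge[OF v that k] by simp
      have "delta D k ?f U = delta D k (edge_op D k v (marked D c (insert k v))) U"
        using U k by (simp add: delta_def xop_def ccw_arc_in_arcs eq)
      also have "\<dots> = 0"
        by (rule delta_edge_op) (use False k in \<open>auto simp: adjacent_def\<close>)
      finally show ?thesis .
    qed
    then have "xop a ?f U + xop b ?f U = 0"
      unfolding a_def b_def xop_strand[OF k j] .
    then show "marked D (basepoint_act D a (reverse_edge D k c)) v U =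
        marked D (basepoint_act D b (reverse_edge D k c)) v U"
      by (simp add: marked_basepoint_act[OF ab(1) v] marked_basepoint_act[OF ab(2) v] bit_add_eq_0_iff)
  qed (simp_all add: images_in_V)
qed

lemma square_zero_action_basepoint: "q \<in> arcs D \<Longrightarrow> square_zero_action V (khovanov_diff D) (basepoint_act D q)"
  by (simp add: square_zero_action_def linear_maps basepoint_act_square basepoint_act_khovanov_diff)

text \<open>The complex is free over the ring generated by the action of \<open>p\<close>, so the
  kernel and the image of X coincide; both are spanned by the generators with label X at
  \<open>p\<close>. This is the exactness that the tower requires.\<close>

lemma chains_on_reduced_generators:
  assumes p: "p \<in> arcs D"
  shows "chains_on (reduced_generators D p) = {c \<in> V. basepoint_act D p c = 0}"
    and "chains_on (reduced_generators D p) = basepoint_act D p ` V"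
proof -
  let ?C = "\<lambda>v. circle_at D v p"
  let ?R = "chains_on (reduced_generators D p)"
  have R_iff: "c \<in> ?R \<longleftrightarrow> c \<in> V \<and> (\<forall>v S. ?C v \<notin> S \<longrightarrow> c (v, S) = 0)" for c
    by (auto simp: chains_on_def reduced_generators_def)
  have sub: "{c \<in> V. basepoint_act D p c = 0} \<subseteq> ?R"
  proof
    fix c assume "c \<in> {c \<in> V. basepoint_act D p c = 0}"
    then have c: "c \<in> V" "basepoint_act D p c = 0" by auto
    have "c (v, S) = 0" if nS: "?C v \<notin> S" for v S
    proof (cases "(v, S) \<in> generators D")
      case True
      then have "(v, insert (?C v) S) \<in> generators D" using p by (simp add: generators_def)
      from basepoint_act_eq[OF p this, of c] show ?thesis using c(2) nS by simp
    next
      case False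
      then show ?thesis using c(1) unfolding chains_on_def by blast
    qed
    then show "c \<in> ?R" using c R_iff by blast
  qed
  have img: "?R \<subseteq> basepoint_act D p ` V"
  proof
    fix c assume c: "c \<in> ?R"
    \<comment> \<open>The preimage moves each coefficient to the generator in which the label at
      \<open>p\<close> is changed from X to 1.\<close>
    define b where "b = (\<lambda>(v, S). if (v, S) \<in> generators D \<and> ?C v \<notin> S then c (v, insert (?C v) S) else 0)"
    have b: "b \<in> V" by (auto simp: b_def chains_on_def)
    have "basepoint_act D p b = c"
    proof
      fix g :: generator
      obtain v S where g: "g = (v, S)" by (cases g)
      show "basepoint_act D p b g = c g"
      proof (cases "g \<in> generators D")
        case True
        then have gen: "(v, S) \<in> generators D" "(v, S - {?C v}) \<in> generators D"
          by (auto simp: g generators_def)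
        show ?thesis
        proof (cases "?C v \<in> S")
          case True
          then have "b (v, S - {?C v}) = c (v, S)" using gen(2) by (simp add: b_def insert_absorb)
          then show ?thesis using True by (simp add: g basepoint_act_eq[OF p gen(1)])
        next
          case False
          then have "c (v, S) = 0" using c unfolding R_iff by blast
          then show ?thesis using False by (simp add: g basepoint_act_eq[OF p gen(1)])
        qed
      next
        case False
        have "c \<in> V" using c unfolding R_iff by blast
        then have "c g = 0" using False unfolding chains_on_def by (elim CollectE allE impE)
        moreover have "basepoint_act D p b g = 0"
          using images_in_V(2)[of p b] False unfolding chains_on_def by (elim CollectE allE impE)
        ultimately show ?thesis by simp
      qed
    qed
    with b show "c \<in> basepoint_act D p ` V" by blast
  qed
  have "basepoint_act D p ` V \<subseteq> {c \<in> V. basepoint_act D p c = 0}"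
    by (auto simp: images_in_V basepoint_act_square[OF p])
  then show "?R = {c \<in> V. basepoint_act D p c = 0}" "?R = basepoint_act D p ` V"
    using sub img by blast+
qed

section \<open>Zig-zags at one crossing and along a component\<close>

lemma CKh_eq: "CKh D p q = dmod V (F2WX_smult (basepoint_act D p) (basepoint_act D q)) (khovanov_diff D)"
  by (simp add: CKh_def dmod_def)

lemma reduced_CKh_eq:
  "p \<in> arcs D \<Longrightarrow>
    reduced_CKh D p q = dmod (basepoint_act D p ` V) (F2X_smult (basepoint_act D q)) (khovanov_diff D)"
  by (simp add: reduced_CKh_def dmod_def chains_on_reduced_generators(2))

lemma strand_stepE:
  assumes "(a, b) \<in> strand_step D"
  obtains k j where "k < n" "j < 4" "a = ccw_arc D k j" "b = ccw_arc D k ((j + 2) mod 4)"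
    "a \<in> arcs D" "b \<in> arcs D"
proof -
  obtain k j where kj: "(k, j) \<in> arc_ends D" "a = ccw_arc D k j" "b = ccw_arc D k ((j + 2) mod 4)"
    using assms by (auto simp: strand_step_def ccw_arc_def)
  then have "k < n" "j < 4" by (auto simp: arc_ends_def)
  with kj show ?thesis by (intro that) (auto simp: ccw_arc_in_arcs)
qed

lemma CKh_step:
  assumes ab: "(a, b) \<in> strand_step D" and q: "q \<in> arcs D"
  shows "quasi_isomorphic F2WX (CKh D a q) (CKh D b q) \<and> quasi_isomorphic F2WX (CKh D q a) (CKh D q b)"
proof -
  obtain k j where k: "k < n" "j < 4" and a: "a = ccw_arc D k j" and b: "b = ccw_arc D k ((j + 2) mod 4)"
    and in_arcs: "a \<in> arcs D" "b \<in> arcs D" using ab by (rule strand_stepE)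
  show ?thesis
    unfolding CKh_eq
    by (rule homotopic_actions(2)[where H = "reverse_edge D k"])
      (simp_all add: chain_complex_khovanov square_zero_action_basepoint in_arcs q linear_maps
        basepoint_act_commute[OF _ q] reverse_edge_basepoint_act[OF q k(1)]
        strand_homotopy(2)[OF k, folded a b], rule strand_homotopy(1)[OF k, folded a b])
qed

text \<open>The homotopy and both actions commute with that of \<open>p\<close> and so restrict to
  its image; the cone argument then applies to this subcomplex.\<close>

lemma reduced_CKh_step_action:
  assumes ab: "(a, b) \<in> strand_step D" and p: "p \<in> arcs D"
  shows "quasi_isomorphic F2X (reduced_CKh D p a) (reduced_CKh D p b)"
proof -
  obtain k j where k: "k < n" "j < 4" and a: "a = ccw_arc D k j" and b: "b = ccw_arc D k ((j + 2) mod 4)"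
    and in_arcs: "a \<in> arcs D" "b \<in> arcs D" using ab by (rule strand_stepE)
  note P = square_zero_action_basepoint[OF p]
  show ?thesis
    unfolding reduced_CKh_eq[OF p]
  proof (rule homotopic_actions(1)[where H = "reverse_edge D k"])
    show "chain_complex (basepoint_act D p ` V) (khovanov_diff D)"
      by (rule chain_complex_image[OF chain_complex_khovanov P])
    show "square_zero_action (basepoint_act D p ` V) (khovanov_diff D) (basepoint_act D a)"
      by (rule square_zero_action_image[OF P square_zero_action_basepoint[OF in_arcs(1)]])
        (rule basepoint_act_commute[OF in_arcs(1) p])
    show "square_zero_action (basepoint_act D p ` V) (khovanov_diff D) (basepoint_act D b)"
      by (rule square_zero_action_image[OF P square_zero_action_basepoint[OF in_arcs(2)]])
        (rule basepoint_act_commute[OF in_arcs(2) p])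
    show "linear_map (basepoint_act D p ` V) (basepoint_act D p ` V) (reverse_edge D k)"
      by (rule linear_map_image[OF linear_maps(2,3)]) (rule reverse_edge_basepoint_act[OF p k(1)])
  qed (rule strand_homotopy[OF k, folded a b])+
qed

text \<open>Here the subcomplex itself changes, so the comparison passes through towers over the
  full complex. The vanishing square of the homotopy and the exactness of the two actions enter at
  this point.\<close>

lemma reduced_CKh_step_reduction:
  assumes ab: "(a, b) \<in> strand_step D" and q: "q \<in> arcs D"
  shows "quasi_isomorphic F2X (reduced_CKh D a q) (reduced_CKh D b q)"
proof -
  obtain k j where k: "k < n" "j < 4" and a: "a = ccw_arc D k j" and b: "b = ccw_arc D k ((j + 2) mod 4)"
    and in_arcs: "a \<in> arcs D" "b \<in> arcs D" using ab by (rule strand_stepE)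
  note act = square_zero_action_basepoint
  show ?thesis
    unfolding reduced_CKh_eq[OF in_arcs(1)] reduced_CKh_eq[OF in_arcs(2)]
  proof (rule homotopic_reductions[where H = "reverse_edge D k"])
    show "chain_complex (basepoint_act D a ` V) (khovanov_diff D)"
      "chain_complex (basepoint_act D b ` V) (khovanov_diff D)"
      by (rule chain_complex_image[OF chain_complex_khovanov act]; fact in_arcs)+
    show "square_zero_action (basepoint_act D a ` V) (khovanov_diff D) (basepoint_act D q)"
      by (rule square_zero_action_image[OF act[OF in_arcs(1)] act[OF q]])
        (rule basepoint_act_commute[OF q in_arcs(1)])
    show "square_zero_action (basepoint_act D b ` V) (khovanov_diff D) (basepoint_act D q)"
      by (rule square_zero_action_image[OF act[OF in_arcs(2)] act[OF q]])
        (rule basepoint_act_commute[OF q in_arcs(2)])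
    show "{y \<in> V. basepoint_act D a y = 0} = basepoint_act D a ` V"
      using chains_on_reduced_generators[OF in_arcs(1)] by simp
    show "{y \<in> V. basepoint_act D b y = 0} = basepoint_act D b ` V"
      using chains_on_reduced_generators[OF in_arcs(2)] by simp
    show "chain_complex V (khovanov_diff D)" by (rule chain_complex_khovanov)
    show "square_zero_action V (khovanov_diff D) (basepoint_act D a)"
      "square_zero_action V (khovanov_diff D) (basepoint_act D b)"
      "square_zero_action V (khovanov_diff D) (basepoint_act D q)"
      by (intro act in_arcs q)+
    show "linear_map V V (reverse_edge D k)" by (rule linear_maps)
  qed (rule strand_homotopy[OF k, folded a b] reverse_edge_reverse_edge[OF k(1)]
      basepoint_act_commute[OF in_arcs(1) q] basepoint_act_commute[OF in_arcs(2) q]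
      reverse_edge_basepoint_act[OF q k(1)])+
qed

text \<open>\<open>M\<close> leaves open which basepoint moves. Steps against the direction of a
  strand are covered by symmetry; the path without steps needs \<open>refl\<close>, because
  \<open>quasi_isomorphic\<close> includes being a differential module.\<close>

lemma same_component_induct:
  assumes pq: "same_component D p q" and refl: "diff_module R (M p)"
    and step: "\<And>a b. (a, b) \<in> strand_step D \<Longrightarrow> quasi_isomorphic R (M a) (M b)"
  shows "quasi_isomorphic R (M p) (M q)"
proof -
  have "(p, q) \<in> (strand_step D \<union> (strand_step D)\<inverse>)\<^sup>*"
    using pq by (simp add: same_component_def eq_closure_def)
  then show ?thesis
  proof (induction rule: rtrancl_induct)
    case base
    show ?case by (rule quasi_isomorphic_refl[OF refl])
  next
    case (step y z)
    then have "quasi_isomorphic R (M y) (M z)"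
      using assms(3) quasi_isomorphic_sym by blast
    with step.IH show ?case by (rule quasi_isomorphic_trans)
  qed
qed

lemma diff_module_CKh:
  assumes "p \<in> arcs D" "q \<in> arcs D"
  shows "diff_module F2WX (CKh D p q)"
  unfolding CKh_eq
  by (rule diff_module_F2WX[OF chain_complex_khovanov square_zero_action_basepoint[OF assms(1)]
        square_zero_action_basepoint[OF assms(2)]]) (rule basepoint_act_commute[OF assms])

lemma diff_module_reduced_CKh:
  assumes "p \<in> arcs D" "q \<in> arcs D"
  shows "diff_module F2X (reduced_CKh D p q)"
  unfolding reduced_CKh_eq[OF assms(1)]
  by (rule diff_module_F2X[OF chain_complex_image[OF chain_complex_khovanov square_zero_action_basepoint[OF assms(1)]]
        square_zero_action_image[OF square_zero_action_basepoint[OF assms(1)] square_zero_action_basepoint[OF assms(2)]]])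
    (rule basepoint_act_commute[OF assms(2,1)])

end

theorem theorem4p2:
  fixes L :: pd_code and p p' q q' :: nat
  assumes "link_diagram L"
    and "same_component L p p'"
    and "same_component L q q'"
  shows "quasi_isomorphic F2WX (CKh L p q) (CKh L p' q') \<and>
    quasi_isomorphic F2X (reduced_CKh L p q) (reduced_CKh L p' q')"
proof -
  interpret diagram L by (rule diagram.intro) (rule assms(1))
  have in_arcs: "p \<in> arcs L" "p' \<in> arcs L" "q \<in> arcs L"
    using assms(2,3) by (auto simp: same_component_def)
  \<comment> \<open>The basepoints move one at a time, the other one staying fixed as a commuting
    action or as the reduction.\<close>
  have "quasi_isomorphic F2WX (CKh L p q) (CKh L p' q)"
    by (rule same_component_induct[OF assms(2), where M = "\<lambda>r. CKh L r q"])
      (use diff_module_CKh CKh_step in_arcs in blast)+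
  moreover have "quasi_isomorphic F2WX (CKh L p' q) (CKh L p' q')"
    by (rule same_component_induct[OF assms(3), where M = "CKh L p'"])
      (use diff_module_CKh CKh_step in_arcs in blast)+
  moreover have "quasi_isomorphic F2X (reduced_CKh L p q) (reduced_CKh L p' q)"
    by (rule same_component_induct[OF assms(2), where M = "\<lambda>r. reduced_CKh L r q"])
      (use diff_module_reduced_CKh reduced_CKh_step_reduction in_arcs in blast)+
  moreover have "quasi_isomorphic F2X (reduced_CKh L p' q) (reduced_CKh L p' q')"
    by (rule same_component_induct[OF assms(3), where M = "reduced_CKh L p'"])
      (use diff_module_reduced_CKh reduced_CKh_step_action in_arcs in blast)+
  ultimately show ?thesis by (meson quasi_isomorphic_trans)
qed

end
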